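(* Let $(c_1,B_1),\dots,(c_m,B_m)$ be a Brascamp-Lieb datum on $\mathbb{R}^n$, i.e. for $i\le m$, $c_i>0$ is a real number and $B_i\colon\mathbb{R}^n\to\mathbb{R}^{n_i}$ is a linear surjective map, and suppose $\sum_{i=1}^m c_i n_i=n$. Assume that there exists a symmetric positive definite $n\times n$ matrix $A$ satisfying \[ A^{-1}=\sum_{i=1}^m c_i B_i^*(B_iAB_i^* )^{-1}B_i . \] Then the Brascamp-Lieb constant $C$ associated to this datum is \[ C=\Bigl(\frac{\det(A)}{\prod_{i=1}^m\det(B_iAB_i^* )^{c_i}}\Bigr)^{1/2}, \] and there is equality in \[ \int_{\mathbb{R}^n}\prod_{i=1}^m (f_i\circ B_i)^{c_i}\,\mathrm{d}x\le C\prod_{i=1}^m\Bigl(\int_{\mathbb{R}^{n_i}}f_i\,\mathrm{d}x\Bigr)^{c_i} \] for the Gaussian functions $f_i(x)=\mathrm{e}^{-\langle (B_iAB_i^* )^{-1}x,x\rangle/2}$, $x\in\mathbb{R}^{n_i}$, $i\le m$.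
   Context: The Brascamp-Lieb constant associated to the datum $(c_1,B_1),\dots,(c_m,B_m)$ is the smallest constant $C$ such that \[ \int_{\mathbb{R}^n}\prod_{i=1}^m (f_i\circ B_i)^{c_i}\,\mathrm{d}x\le C\prod_{i=1}^m\Bigl(\int_{\mathbb{R}^{n_i}}f_i\,\mathrm{d}x\Bigr)^{c_i} \] holds for every set of non-negative integrable functions $f_i\colon\mathbb{R}^{n_i}\to\mathbb{R}$, $i\le m$. Here $B_i^*$ denotes the adjoint (transpose) of $B_i$ and $\mathrm{d}x$ denotes Lebesgue measure. *)

theory Defs
  imports
    "HOL-Analysis.Embed_Measure"
    "HOL-Analysis.Lebesgue_Measure"
    "HOL-Analysis.Bochner_Integration"
    "Jordan_Normal_Form.Determinant"
begin

text \<open>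
  The target dimensions vary with the index of the datum, so Euclidean \<open>n\<close>-space is rendered as
  the carrier \<^term>\<open>carrier_vec n :: real vec set\<close> for a natural number \<open>n\<close>. Lebesgue measure on it
  is the completion of the \<open>n\<close>-fold product of Lebesgue--Borel measure on the line, transported
  along the bijection \<^const>\<open>vec\<close> between functions on \<open>{..<n}\<close> and vectors of dimension \<open>n\<close>.
\<close>

definition lebesgue_vec :: "nat \<Rightarrow> real vec measure" where
  "lebesgue_vec n = completion (embed_measure (\<Pi>\<^sub>M j\<in>{..<n}. (lborel :: real measure)) (vec n))"

lemma inj_on_vec_PiE: "inj_on (vec n) (extensional {..<n})"
proof (rule inj_onI)
  fix f g :: "nat \<Rightarrow> 'a"
  assume f: "f \<in> extensional {..<n}" and g: "g \<in> extensional {..<n}" and eq: "vec n f = vec n g"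
  have "f j = g j" if "j < n" for j
    using arg_cong[OF eq, of "\<lambda>v. vec_index v j"] that by simp
  then show "f = g" using f g by (auto intro: extensionalityI)
qed

lemma space_lebesgue_vec [simp]: "space (lebesgue_vec n) = carrier_vec n"
proof -
  have "vec n ` extensional {..<n} = (carrier_vec n :: real vec set)"
  proof (intro equalityI subsetI)
    fix v :: "real vec" assume v: "v \<in> carrier_vec n"
    then have "v = vec n (restrict (vec_index v) {..<n})" by (intro eq_vecI) auto
    moreover have "restrict (vec_index v) {..<n} \<in> extensional {..<n}" by simp
    ultimately show "v \<in> vec n ` extensional {..<n}" by (rule image_eqI)
  qed auto
  then show ?thesis
    by (simp add: lebesgue_vec_def space_embed_measure space_PiM PiE_UNIV_domain PiE_def)
qed

lemma emeasure_lebesgue_vec_box: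
  assumes "\<And>j. j < n \<Longrightarrow> a j \<le> b j"
  shows "emeasure (lebesgue_vec n) {v \<in> carrier_vec n. \<forall>j<n. vec_index v j \<in> {a j..b j}}
    = ennreal (\<Prod>j<n. b j - a j)"
proof -
  let ?M = "\<Pi>\<^sub>M j\<in>{..<n}. (lborel :: real measure)"
  let ?X = "\<Pi>\<^sub>E j\<in>{..<n}. {a j..b j}"
  interpret product_sigma_finite "\<lambda>_::nat. lborel :: real measure" ..
  have sp: "space ?M = extensional {..<n}" by (simp add: space_PiM PiE_def)
  have inj: "inj_on (vec n) (space ?M)" unfolding sp by (rule inj_on_vec_PiE)
  have X: "?X \<in> sets ?M" by (rule sets_PiM_I_finite) simp_all
  have img: "{v \<in> carrier_vec n. \<forall>j<n. vec_index v j \<in> {a j..b j}} = vec n ` ?X"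
  proof (intro equalityI subsetI)
    fix v assume v: "v \<in> {v \<in> carrier_vec n. \<forall>j<n. vec_index v j \<in> {a j..b j}}"
    then have "v = vec n (restrict (vec_index v) {..<n})" by (intro eq_vecI) auto
    moreover have "restrict (vec_index v) {..<n} \<in> ?X" using v by auto
    ultimately show "v \<in> vec n ` ?X" by (rule image_eqI)
  next
    fix v assume "v \<in> vec n ` ?X"
    then obtain f where "f \<in> ?X" "v = vec n f" by blast
    then show "v \<in> {v \<in> carrier_vec n. \<forall>j<n. vec_index v j \<in> {a j..b j}}"
      using PiE_mem[of f "{..<n}" "\<lambda>j. {a j..b j}"] by simp
  qed
  have "vec n ` ?X \<in> sets (embed_measure ?M (vec n))"
    by (rule in_sets_embed_measure[OF X])
  moreover have "vec n -` (vec n ` ?X) \<inter> space ?M = ?X"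
    using sets.sets_into_space[OF X] inj_onD[OF inj] by blast
  ultimately have "emeasure (lebesgue_vec n) (vec n ` ?X) = emeasure ?M ?X"
    unfolding lebesgue_vec_def by (simp add: emeasure_embed_measure'[OF inj])
  also have "\<dots> = (\<Prod>j<n. ennreal (b j - a j))"
  proof -
    have "emeasure ?M ?X = (\<Prod>j<n. emeasure lborel {a j..b j})"
      by (rule emeasure_PiM) simp_all
    also have "\<dots> = (\<Prod>j<n. ennreal (b j - a j))"
      using assms by (intro prod.cong refl) simp
    finally show ?thesis .
  qed
  also have "\<dots> = ennreal (\<Prod>j<n. b j - a j)"
    using assms by (intro prod_ennreal) auto
  finally show ?thesis unfolding img .
qed

definition symmetric_pos_def :: "nat \<Rightarrow> real mat \<Rightarrow> bool" where
  "symmetric_pos_def n A \<longleftrightarrow> A \<in> carrier_mat n n \<and> transpose_mat A = A \<and>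
     (\<forall>x\<in>carrier_vec n. x \<noteq> 0\<^sub>v n \<longrightarrow> scalar_prod x (A *\<^sub>v x) > 0)"

text \<open>The inverse matrix; it is unspecified if the argument is not invertible.\<close>

definition inv_mat :: "real mat \<Rightarrow> real mat" where
  "inv_mat M = the (mat_inverse M)"

text \<open>
  A datum with \<open>m\<close> members, indexed by \<open>{..<m}\<close>: the exponents \<open>c i\<close> and the linear maps from
  \<open>n\<close>-space to \<open>d i\<close>-space, given by their matrices \<open>B i\<close>.
\<close>

definition brascamp_lieb_datum ::
  "nat \<Rightarrow> nat \<Rightarrow> (nat \<Rightarrow> nat) \<Rightarrow> (nat \<Rightarrow> real) \<Rightarrow> (nat \<Rightarrow> real mat) \<Rightarrow> bool" where
  "brascamp_lieb_datum n m d c B \<longleftrightarrow>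
     (\<forall>i<m. c i > 0 \<and> B i \<in> carrier_mat (d i) n \<and>
        (\<lambda>x. B i *\<^sub>v x) ` carrier_vec n = carrier_vec (d i))"

definition brascamp_lieb_input ::
  "nat \<Rightarrow> (nat \<Rightarrow> nat) \<Rightarrow> (nat \<Rightarrow> real vec \<Rightarrow> real) \<Rightarrow> bool" where
  "brascamp_lieb_input m d f \<longleftrightarrow>
     (\<forall>i<m. integrable (lebesgue_vec (d i)) (f i) \<and> (\<forall>x\<in>carrier_vec (d i). 0 \<le> f i x))"

text \<open>
  The left-hand side is an extended nonnegative integral, since its finiteness is part of the
  inequality.
\<close>

definition brascamp_lieb_lhs ::
  "nat \<Rightarrow> nat \<Rightarrow> (nat \<Rightarrow> real) \<Rightarrow> (nat \<Rightarrow> real mat) \<Rightarrow> (nat \<Rightarrow> real vec \<Rightarrow> real) \<Rightarrow> ennreal" where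
  "brascamp_lieb_lhs n m c B f =
     (\<integral>\<^sup>+ x. ennreal (\<Prod>i<m. f i (B i *\<^sub>v x) powr c i) \<partial>lebesgue_vec n)"

definition brascamp_lieb_rhs ::
  "nat \<Rightarrow> (nat \<Rightarrow> nat) \<Rightarrow> (nat \<Rightarrow> real) \<Rightarrow> (nat \<Rightarrow> real vec \<Rightarrow> real) \<Rightarrow> ennreal" where
  "brascamp_lieb_rhs m d c f =
     ennreal (\<Prod>i<m. (\<integral> x. f i x \<partial>lebesgue_vec (d i)) powr c i)"

definition brascamp_lieb_inequality ::
  "nat \<Rightarrow> nat \<Rightarrow> (nat \<Rightarrow> nat) \<Rightarrow> (nat \<Rightarrow> real) \<Rightarrow> (nat \<Rightarrow> real mat) \<Rightarrow> ennreal \<Rightarrow> bool" where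
  "brascamp_lieb_inequality n m d c B C \<longleftrightarrow>
     (\<forall>f. brascamp_lieb_input m d f \<longrightarrow>
        brascamp_lieb_lhs n m c B f \<le> C * brascamp_lieb_rhs m d c f)"

text \<open>Candidate constants may be infinite; \<open>C\<close> is the least of all of them.\<close>

definition is_brascamp_lieb_constant ::
  "nat \<Rightarrow> nat \<Rightarrow> (nat \<Rightarrow> nat) \<Rightarrow> (nat \<Rightarrow> real) \<Rightarrow> (nat \<Rightarrow> real mat) \<Rightarrow> ennreal \<Rightarrow> bool" where
  "is_brascamp_lieb_constant n m d c B C \<longleftrightarrow>
     brascamp_lieb_inequality n m d c B C \<and>
     (\<forall>C'. brascamp_lieb_inequality n m d c B C' \<longrightarrow> C \<le> C')"

end

theory Submission
  imports Defs "HOL-Probability.Distributions" "HOL-Analysis.Regularity" "HOL-Analysis.Function_Metric"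
begin

text \<open>
  Normalisation. Write \<open>A = L L\<^sup>T\<close> and \<open>B\<^sub>i A B\<^sub>i\<^sup>T = L\<^sub>i L\<^sub>i\<^sup>T\<close> with lower triangular \<open>L\<close> and
  \<open>L\<^sub>i\<close>, and put \<open>Q\<^sub>i = L\<^sub>i\<^sup>-\<^sup>1 B\<^sub>i L\<close>. Then \<open>Q\<^sub>i Q\<^sub>i\<^sup>T = 1\<close>, and the equation for \<open>A\<close> says that
  \<open>\<Sum>\<^sub>i c\<^sub>i Q\<^sub>i\<^sup>T Q\<^sub>i = 1\<close>. The substitutions by \<open>L\<close> and \<open>L\<^sub>i\<close> contribute the factor
  \<open>det L / \<Prod>\<^sub>i (det L\<^sub>i) powr c\<^sub>i\<close>, which is the claimed \<open>C\<close>; what remains to be shown is the inequality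
  with constant 1 for the \<open>Q\<^sub>i\<close> (\<open>geometric_brascamp_lieb\<close>). The Gaussian functions of the theorem turn
  into standard ones, whose integrals are known, so the two sides agree for them; in particular no
  smaller constant is possible.

  Heat flow. Since \<open>\<Sum>\<^sub>i c\<^sub>i \<bar>Q\<^sub>i x\<bar>\<^sup>2 = \<bar>x\<bar>\<^sup>2\<close>, a Gaussian weight \<open>exp (-\<bar>x\<bar>\<^sup>2 / 2)\<close> can be distributed over the
  factors. If every \<open>f\<^sub>i\<close> is a Gaussian mixture, the inequality becomes
  \<open>E \<Prod>\<^sub>i (\<integral> exp \<langle>\<theta>\<^sub>i, X\<rangle> d\<mu>\<^sub>i) powr c\<^sub>i \<le> \<Prod>\<^sub>i (\<integral> exp (\<bar>\<theta>\<^sub>i\<bar>\<^sup>2 / 2) d\<mu>\<^sub>i) powr c\<^sub>i\<close> for a standard Gaussian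
  vector \<open>X\<close>, where \<open>\<theta>\<^sub>i\<close> takes values in the range of \<open>Q\<^sub>i\<^sup>T\<close> (\<open>gauss_laplace_prod_le\<close>). Put
  \<open>V(t, x) = \<Prod>\<^sub>i (\<integral> exp (\<langle>\<theta>\<^sub>i, x\<rangle> + t \<bar>\<theta>\<^sub>i\<bar>\<^sup>2 / 2) d\<mu>\<^sub>i) powr c\<^sub>i\<close>; the claim is \<open>E V(0, X) \<le> V(1, 0)\<close>. Each factor
  solves the heat equation, and \<open>V\<close> satisfies \<open>E V(t, x + \<surd>h X) \<le> exp (K h\<^sup>3\<^sup>/\<^sup>2) V(t + h, x)\<close>: to second order
  this is the inequality \<open>\<bar>\<Sum>\<^sub>i c\<^sub>i m\<^sub>i\<bar>\<^sup>2 \<le> \<Sum>\<^sub>i c\<^sub>i \<bar>m\<^sub>i\<bar>\<^sup>2\<close> for the means \<open>m\<^sub>i\<close> of \<open>\<theta>\<^sub>i\<close> under the measures tilted by the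
  exponentials, which is again the identity \<open>\<Sum>\<^sub>i c\<^sub>i Q\<^sub>i\<^sup>T Q\<^sub>i = 1\<close>. If the frequencies \<open>\<theta>\<^sub>i\<close> are bounded then \<open>K\<close> depends
  neither on \<open>t\<close> nor on \<open>x\<close>, so \<open>2 ^ k\<close> steps of length \<open>2 ^ -k\<close> lose only the factor \<open>exp (K / \<surd>(2 ^ k))\<close>, which
  tends to 1.

  Approximation. An integrable \<open>f\<^sub>i\<close> lies below a lower semicontinuous function with almost the same
  integral (\<open>lsc_majorant\<close>), and such a function lies below the lower limit of its truncated Gaussian
  mollifications (\<open>smoothing_liminf\<close>). Fatou's lemma then carries the inequality from Gaussian mixtures
  to all integrable functions. Passing to larger functions is harmless on the left-hand side.
\<close>

section \<open>Log-Laplace transforms of bounded random variables\<close>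

lemma exp_le_quadratic:
  fixes x :: real
  shows "exp x \<le> 1 + x + x\<^sup>2 / 2 + \<bar>x\<bar> ^ 3 * exp \<bar>x\<bar> / 6"
proof -
  obtain t where t: "\<bar>t\<bar> \<le> \<bar>x\<bar>" "exp x = (\<Sum>k<3. x ^ k / fact k) + exp t / fact 3 * x ^ 3"
    using Maclaurin_exp_le[of x 3] by blast
  have "exp t * x ^ 3 \<le> exp \<bar>x\<bar> * \<bar>x\<bar> ^ 3"
  proof (rule order_trans[OF abs_ge_self])
    show "\<bar>exp t * x ^ 3\<bar> \<le> exp \<bar>x\<bar> * \<bar>x\<bar> ^ 3"
      using t(1) by (auto simp: abs_mult power_abs intro!: mult_right_mono)
  qed
  with t(2) show ?thesis
    by (simp add: eval_nat_numeral fact_numeral algebra_simps power2_eq_square)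
qed

lemma (in prob_space) expectation_bounded:
  fixes X :: "'a \<Rightarrow> real"
  assumes [measurable]: "X \<in> borel_measurable M" and b: "\<And>x. x \<in> space M \<Longrightarrow> \<bar>X x\<bar> \<le> r"
  shows "integrable M X" "\<bar>expectation X\<bar> \<le> r"
proof -
  show i: "integrable M X" by (rule integrable_const_bound[of _ r]) (auto simp: b intro!: AE_I2)
  have "norm (expectation X) \<le> expectation (\<lambda>x. norm (X x))" by (rule integral_norm_bound)
  also have "\<dots> \<le> expectation (\<lambda>_. r)" using i b by (intro integral_mono) auto
  finally show "\<bar>expectation X\<bar> \<le> r" by (simp add: prob_space)
qed

text \<open>
  The cumulant generating function of a bounded variable is its mean plus half its variance up to an
  error of third order in the bound \<open>r\<close>. The lower bound by the mean is Jensen's inequality; the upper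
  bound comes from applying \<open>exp_le_quadratic\<close> to the centred variable, which is at most \<open>2 * r\<close> in absolute value.
\<close>

lemma (in prob_space) ln_expectation_exp_bounds:
  fixes X :: "'a \<Rightarrow> real"
  assumes [measurable]: "X \<in> borel_measurable M" and b: "\<And>x. x \<in> space M \<Longrightarrow> \<bar>X x\<bar> \<le> r"
  defines "V \<equiv> expectation (\<lambda>x. (X x)\<^sup>2) - (expectation X)\<^sup>2"
  shows "0 < expectation (\<lambda>x. exp (X x))"
    and "expectation X \<le> ln (expectation (\<lambda>x. exp (X x)))"
    and "ln (expectation (\<lambda>x. exp (X x))) \<le> expectation X + V / 2 + 4 / 3 * r ^ 3 * exp (2 * r)"
    and "\<bar>ln (expectation (\<lambda>x. exp (X x)))\<bar> \<le> r"
    and "0 \<le> V" "V \<le> r\<^sup>2"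
proof -
  have r: "0 \<le> r" using b not_empty by (meson abs_ge_zero all_not_in_conv order_trans)
  note iX = expectation_bounded[of X r, OF _ b, simplified]
  define e where "e = expectation X"
  have er: "\<bar>e\<bar> \<le> r" using iX(2) by (simp add: e_def)
  have x2: "(X x)\<^sup>2 \<le> r\<^sup>2" if "x \<in> space M" for x
    using b[OF that] r by (metis abs_ge_zero power2_abs power_mono)
  have iX2: "integrable M (\<lambda>x. (X x)\<^sup>2)" "\<bar>expectation (\<lambda>x. (X x)\<^sup>2)\<bar> \<le> r\<^sup>2"
    using expectation_bounded[of "\<lambda>x. (X x)\<^sup>2" "r\<^sup>2"] x2 by auto
  have dev: "\<bar>X x - e\<bar> \<le> 2 * r" if "x \<in> space M" for x
    using b[OF that] er by linarith
  have var: "expectation (\<lambda>x. (X x - e)\<^sup>2) = V"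
  proof -
    have "(\<lambda>x. (X x - e)\<^sup>2) = (\<lambda>x. (X x)\<^sup>2 - 2 * e * X x + e\<^sup>2)"
      by (auto simp: power2_eq_square algebra_simps)
    then show ?thesis
      using iX iX2 by (simp add: V_def e_def prob_space power2_eq_square)
  qed
  have dev2: "(X x - e)\<^sup>2 \<le> (2 * r)\<^sup>2" if "x \<in> space M" for x
    using power_mono[OF dev[OF that], of 2] by simp
  have idev: "integrable M (\<lambda>x. (X x - e)\<^sup>2)"
    by (rule expectation_bounded[of _ "(2*r)\<^sup>2"]) (use dev2 in auto)
  show "0 \<le> V" unfolding var[symmetric] by simp
  show "V \<le> r\<^sup>2" unfolding V_def using iX2(2) by (smt (verit) zero_le_power2)
  have ex: "exp (- r) \<le> exp (X x)" "exp (X x) \<le> exp r" if "x \<in> space M" for x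
    using b[OF that] by (auto simp: abs_le_iff)
  have ie: "integrable M (\<lambda>x. exp (X x))"
    by (rule expectation_bounded[of _ "exp r"]) (use b in \<open>auto simp: abs_le_iff\<close>)
  have "expectation (\<lambda>x. exp (- r)) \<le> expectation (\<lambda>x. exp (X x))"
    using ie ex by (intro integral_mono) auto
  then have lo: "exp (- r) \<le> expectation (\<lambda>x. exp (X x))" by (simp add: prob_space)
  have "expectation (\<lambda>x. exp (X x)) \<le> expectation (\<lambda>x. exp r)"
    using ie ex by (intro integral_mono) auto
  then have hi: "expectation (\<lambda>x. exp (X x)) \<le> exp r" by (simp add: prob_space)
  show pos: "0 < expectation (\<lambda>x. exp (X x))" using lo less_le_trans[OF exp_gt_zero] by blast
  show "\<bar>ln (expectation (\<lambda>x. exp (X x)))\<bar> \<le> r"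
    using lo hi pos by (auto simp: abs_le_iff ln_ge_iff minus_le_iff) (metis exp_gt_zero ln_exp ln_le_cancel_iff)
  have split: "exp (X x) = exp e * exp (X x - e)" for x by (simp add: exp_diff)
  have i2: "integrable M (\<lambda>x. exp (X x - e))"
    using integrable_mult_right[OF ie, of "exp (- e)"] by (simp add: exp_diff exp_minus field_simps)
  have Ee: "expectation (\<lambda>x. exp (X x)) = exp e * expectation (\<lambda>x. exp (X x - e))"
    by (subst split) simp
  have zero: "expectation (\<lambda>x. X x - e) = 0" using iX by (simp add: e_def prob_space)
  have "expectation (\<lambda>x. 1 + (X x - e)) \<le> expectation (\<lambda>x. exp (X x - e))"
    using i2 iX by (intro integral_mono) auto
  then have "1 \<le> expectation (\<lambda>x. exp (X x - e))" using iX zero by (simp add: prob_space)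
  then have "exp e \<le> expectation (\<lambda>x. exp (X x))" unfolding Ee by simp
  then show "expectation X \<le> ln (expectation (\<lambda>x. exp (X x)))"
    using pos by (simp add: ln_ge_iff e_def)
  \<comment> \<open>The centred variable has mean 0, so only its variance and the cubic remainder survive.\<close>
  have "expectation (\<lambda>x. exp (X x - e))
      \<le> expectation (\<lambda>x. 1 + (X x - e) + (X x - e)\<^sup>2 / 2 + 8 * r ^ 3 * exp (2 * r) / 6)"
  proof (intro integral_mono i2)
    show "integrable M (\<lambda>x. 1 + (X x - e) + (X x - e)\<^sup>2 / 2 + 8 * r ^ 3 * exp (2 * r) / 6)"
      using iX idev by simp
    fix x assume x: "x \<in> space M"
    have "\<bar>X x - e\<bar> ^ 3 * exp \<bar>X x - e\<bar> \<le> (2 * r) ^ 3 * exp (2 * r)"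
      using dev[OF x] r by (intro mult_mono power_mono) auto
    then show "exp (X x - e) \<le> 1 + (X x - e) + (X x - e)\<^sup>2 / 2 + 8 * r ^ 3 * exp (2 * r) / 6"
      using exp_le_quadratic[of "X x - e"] by (simp add: power_mult_distrib)
  qed
  also have "\<dots> = 1 + V / 2 + 4 / 3 * r ^ 3 * exp (2 * r)"
    using iX idev zero var by (simp add: prob_space)
  also have "\<dots> \<le> exp (V / 2 + 4 / 3 * r ^ 3 * exp (2 * r))"
    by (simp add: add.assoc)
  finally have "expectation (\<lambda>x. exp (X x)) \<le> exp (e + (V / 2 + 4 / 3 * r ^ 3 * exp (2 * r)))"
    unfolding Ee by (simp add: exp_add)
  then show "ln (expectation (\<lambda>x. exp (X x))) \<le> expectation X + V / 2 + 4 / 3 * r ^ 3 * exp (2 * r)"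
    using pos by (metis add.assoc e_def exp_gt_zero ln_exp ln_le_cancel_iff)
qed

text \<open>
  Second-order expansion of \<open>exp (\<Sum>\<^sub>i c\<^sub>i \<psi>\<^sub>i)\<close> when each \<open>\<psi>\<^sub>i\<close> is a linear term \<open>a\<^sub>i\<close> plus half a quadratic
  term \<open>v\<^sub>i\<close>. The point is that the remainder depends only on \<open>r\<close> and on the total weight \<open>S\<close>; it is what
  makes the error of a time step uniform.
\<close>

lemma exp_weighted_sum_le_quadratic:
  fixes \<psi> a v c :: "nat \<Rightarrow> real"
  assumes c: "\<And>i. i < m \<Longrightarrow> 0 \<le> c i" and r: "0 \<le> r"
    and lo: "\<And>i. i < m \<Longrightarrow> a i \<le> \<psi> i"
    and hi: "\<And>i. i < m \<Longrightarrow> \<psi> i \<le> a i + v i / 2 + 4 / 3 * r ^ 3 * exp (2 * r)"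
    and psi: "\<And>i. i < m \<Longrightarrow> \<bar>\<psi> i\<bar> \<le> r" and a: "\<And>i. i < m \<Longrightarrow> \<bar>a i\<bar> \<le> r"
    and v: "\<And>i. i < m \<Longrightarrow> v i \<le> r\<^sup>2"
  defines "S \<equiv> \<Sum>i<m. c i"
  shows "exp (\<Sum>i<m. c i * \<psi> i) \<le> 1 + (\<Sum>i<m. c i * a i) + (\<Sum>i<m. c i * v i) / 2
      + (\<Sum>i<m. c i * a i)\<^sup>2 / 2 + 2 * (S + S\<^sup>2 + S ^ 3) * (r ^ 3 * exp ((S + 3) * r))"
proof -
  define D where "D = (\<Sum>i<m. c i * \<psi> i)"
  define p where "p = (\<Sum>i<m. c i * a i)"
  define w where "w = (\<Sum>i<m. c i * v i)"
  define E where "E = exp ((S + 3) * r)"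
  have S: "0 \<le> S" unfolding S_def using c by (intro sum_nonneg) auto
  have abs_le: "\<bar>\<Sum>i<m. c i * x i\<bar> \<le> S * r" if "\<And>i. i < m \<Longrightarrow> \<bar>x i\<bar> \<le> r" for x :: "nat \<Rightarrow> real"
    unfolding S_def sum_distrib_right
    by (rule order_trans[OF sum_abs]) (auto intro!: sum_mono mult_left_mono simp: abs_mult c that)
  have Dr: "\<bar>D\<bar> \<le> S * r" and pr: "\<bar>p\<bar> \<le> S * r"
    unfolding D_def p_def by (intro abs_le psi a; simp)+
  have Dp: "p \<le> D" unfolding D_def p_def using c lo by (intro sum_mono mult_left_mono) auto
  have "D \<le> (\<Sum>i<m. c i * (a i + v i / 2 + 4 / 3 * r ^ 3 * exp (2 * r)))"
    unfolding D_def using c hi by (intro sum_mono mult_left_mono) auto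
  also have "\<dots> = p + w / 2 + S * (4 / 3 * r ^ 3 * exp (2 * r))"
    unfolding S_def sum_distrib_right
    by (simp add: p_def w_def distrib_left sum.distrib sum_divide_distrib)
  finally have D1: "D \<le> p + w / 2 + S * (4 / 3 * r ^ 3 * exp (2 * r))" .
  have "w \<le> S * r\<^sup>2" unfolding w_def S_def sum_distrib_right
    using c v by (intro sum_mono mult_left_mono) auto
  have e3: "exp (2 * r) \<le> E" "exp (S * r) \<le> E" "exp (3 * r) \<le> E" "1 \<le> E"
    unfolding E_def using S r by (auto simp: algebra_simps)
  have re: "r * exp (2 * r) \<le> exp (3 * r)"
  proof -
    have "r \<le> exp r" by (meson exp_ge_add_one_self_aux order_trans r linorder_linear add_increasing exp_ge_add_one_self zero_le_one order.refl add_mono_thms_linordered_semiring(1))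
    then have "r * exp (2 * r) \<le> exp r * exp (2 * r)" by simp
    then show ?thesis by (simp add: exp_add[symmetric])
  qed
  have "r ^ 3 * exp (2 * r) \<le> r\<^sup>2 * E"
    using re e3(3) mult_left_mono[of "r * exp (2 * r)" E "r\<^sup>2"] by (simp add: power2_eq_square power3_eq_cube mult.assoc)
  moreover have "r\<^sup>2 \<le> r\<^sup>2 * E" using e3(4) by (simp add: mult_le_cancel_left1)
  ultimately have "w / 2 + S * (4 / 3 * r ^ 3 * exp (2 * r)) \<le> S * (r\<^sup>2 * E) / 2 + S * (4 / 3 * (r\<^sup>2 * E))"
    using \<open>w \<le> S * r\<^sup>2\<close> S by (intro add_mono) (auto intro!: order_trans[OF \<open>w \<le> S * r\<^sup>2\<close>] mult_left_mono)
  then have D2: "D - p \<le> S * (11 / 6) * (r\<^sup>2 * E)" using D1 by (simp add: algebra_simps)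
  \<comment> \<open>The square of \<open>D\<close> may be replaced by the square of its linear part \<open>p\<close>: the difference is cubic in \<open>r\<close>.\<close>
  have "D\<^sup>2 - p\<^sup>2 = (D - p) * (D + p)" by (simp add: power2_eq_square algebra_simps)
  also have "\<dots> \<le> (D - p) * (2 * (S * r))" using Dp Dr pr by (intro mult_left_mono) auto
  also have "\<dots> \<le> (S * (11 / 6) * (r\<^sup>2 * E)) * (2 * (S * r))"
    using D2 S r by (intro mult_right_mono) auto
  finally have D3: "D\<^sup>2 \<le> p\<^sup>2 + S\<^sup>2 * (11 / 3) * (r ^ 3 * E)"
    by (simp add: power2_eq_square power3_eq_cube mult_ac)
  have "\<bar>D\<bar> ^ 3 * exp \<bar>D\<bar> \<le> (S * r) ^ 3 * E"
    using Dr e3(2) S r by (intro mult_mono power_mono) (auto intro: order_trans[of _ "exp (S * r)"])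
  then have D4: "\<bar>D\<bar> ^ 3 * exp \<bar>D\<bar> \<le> S ^ 3 * (r ^ 3 * E)" by (simp add: power_mult_distrib mult.assoc)
  have "r ^ 3 * exp (2 * r) \<le> r ^ 3 * E" using r e3(1) by (intro mult_left_mono) auto
  then have "S * (4 / 3 * r ^ 3 * exp (2 * r)) \<le> S * (4 / 3 * (r ^ 3 * E))"
    using S by (intro mult_left_mono) auto
  moreover have "0 \<le> S * (r ^ 3 * E)" "0 \<le> S\<^sup>2 * (r ^ 3 * E)" "0 \<le> S ^ 3 * (r ^ 3 * E)"
    using S r by (auto simp: E_def)
  ultimately have "exp D \<le> 1 + p + w / 2 + p\<^sup>2 / 2 + 2 * (S + S\<^sup>2 + S ^ 3) * (r ^ 3 * E)"
    using exp_le_quadratic[of D] D1 D3 D4 by (simp add: algebra_simps)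
  then show ?thesis unfolding D_def p_def w_def E_def .
qed

section \<open>Standard Gaussian measure\<close>

text \<open>
  Points of \<open>n\<close>-space are modelled as functions on \<open>{..<n}\<close> extended by \<^const>\<open>undefined\<close>, so that the theory of
  finite product measures applies.
\<close>

abbreviation borel_fun :: "nat \<Rightarrow> (nat \<Rightarrow> real) measure" where
  "borel_fun n \<equiv> (\<Pi>\<^sub>M j\<in>{..<n}. borel)"

definition lebesgue_fun :: "nat \<Rightarrow> (nat \<Rightarrow> real) measure" where
  "lebesgue_fun n = (\<Pi>\<^sub>M j\<in>{..<n}. lborel)"

definition std_normal :: "real measure" where
  "std_normal = density lborel (\<lambda>x. ennreal (std_normal_density x))"

definition gauss :: "nat \<Rightarrow> (nat \<Rightarrow> real) measure" where
  "gauss n = (\<Pi>\<^sub>M j\<in>{..<n}. std_normal)"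

interpretation std_normal: prob_space std_normal
  unfolding std_normal_def by (rule prob_space_normal_density) simp

lemma sets_std_normal [simp, measurable_cong]: "sets std_normal = sets borel"
  by (simp add: std_normal_def)

lemma space_std_normal [simp]: "space std_normal = UNIV"
  by (simp add: std_normal_def)

lemma sets_gauss [measurable_cong]: "sets (gauss n) = sets (borel_fun n)"
  unfolding gauss_def by (intro sets_PiM_cong) simp_all

lemma sets_lebesgue_fun [measurable_cong]: "sets (lebesgue_fun n) = sets (borel_fun n)"
  unfolding lebesgue_fun_def by (intro sets_PiM_cong) simp_all

lemma space_gauss [simp]: "space (gauss n) = extensional {..<n}"
  by (simp add: gauss_def space_PiM PiE_UNIV_domain PiE_def)

lemma space_lebesgue_fun [simp]: "space (lebesgue_fun n) = extensional {..<n}"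
  by (simp add: lebesgue_fun_def space_PiM PiE_def)

interpretation gauss_coords: product_sigma_finite "\<lambda>_::nat. std_normal"
  by standard

interpretation lebesgue_coords: product_sigma_finite "\<lambda>_::nat. lborel :: real measure"
  by standard

interpretation gauss: prob_space "gauss n" for n
  unfolding gauss_def by (intro prob_space_PiM) (rule std_normal.prob_space_axioms)

interpretation lebesgue_fun: sigma_finite_measure "lebesgue_fun n" for n
  unfolding lebesgue_fun_def by (rule lebesgue_coords.sigma_finite) simp

text \<open>
  Beyond \<open>n\<close> a point is constantly \<^const>\<open>undefined\<close>, so all coordinates are measurable, not only the first \<open>n\<close>.
\<close>

lemma measurable_coord: "(\<lambda>x. x j) \<in> borel_measurable (borel_fun n)"
proof (cases "j < n")
  case False
  then have "x j = undefined" if "x \<in> space (borel_fun n)" for x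
    using that by (auto simp: space_PiM PiE_def extensional_def)
  then show ?thesis by (subst measurable_cong[where g="\<lambda>_. undefined"]) auto
qed simp

lemma integrable_std_normal_iff:
  assumes [measurable]: "f \<in> borel_measurable borel"
  shows "integrable std_normal f \<longleftrightarrow> integrable lborel (\<lambda>x. std_normal_density x * f x)" (is ?A)
    and "integral\<^sup>L std_normal f = (\<integral>x. std_normal_density x * f x \<partial>lborel)" (is ?B)
proof -
  show ?A unfolding std_normal_def by (subst integrable_density) simp_all
  show ?B unfolding std_normal_def by (subst integral_density) simp_all
qed

lemma std_normal_moments:
  "integrable std_normal (\<lambda>x. x)" "integral\<^sup>L std_normal (\<lambda>x. x) = 0"
  "integrable std_normal (\<lambda>x. x\<^sup>2)" "integral\<^sup>L std_normal (\<lambda>x. x\<^sup>2) = 1"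
  using integrable_std_normal_moment[of 1] integral_std_normal_moment_odd[of 0]
    integrable_std_normal_moment[of 2] integral_std_normal_moment_even[of 1]
  by (simp_all add: integrable_std_normal_iff fact_numeral)

lemma integrable_std_normal_exp: "integrable std_normal (\<lambda>x. exp (K * \<bar>x\<bar>))"
proof -
  have shift: "integrable std_normal (\<lambda>x. exp (a * x))" for a :: real
  proof -
    \<comment> \<open>Completing the square: a normal density times an exponential is a multiple of a shifted normal density.\<close>
    have "std_normal_density x * exp (a * x) = exp (a\<^sup>2 / 2) * normal_density a 1 x" for x
      by (simp add: normal_density_def exp_add[symmetric] mult_exp_exp power2_eq_square field_simps)
    then show ?thesis by (simp add: integrable_std_normal_iff)
  qed
  have "integrable std_normal (\<lambda>x. exp (K * x) + exp (- K * x))" using shift[of K] shift[of "- K"] by (intro Bochner_Integration.integrable_add)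
  then show ?thesis
  proof (rule Bochner_Integration.integrable_bound)
    show "AE x in std_normal. norm (exp (K * \<bar>x\<bar>)) \<le> norm (exp (K * x) + exp (- K * x))"
    proof (rule AE_I2)
      fix x :: real
      show "norm (exp (K * \<bar>x\<bar>)) \<le> norm (exp (K * x) + exp (- K * x))"
        using exp_gt_zero[of "K * x"] exp_gt_zero[of "- K * x"] by (cases "0 \<le> x") (simp_all del: exp_gt_zero)
    qed
  qed measurable
qed

lemma integrable_gauss_exp: "integrable (gauss n) (\<lambda>x. exp (K * (\<Sum>j<n. \<bar>x j\<bar>)))"
proof -
  have "integrable (gauss n) (\<lambda>x. \<Prod>j<n. exp (K * \<bar>x j\<bar>))"
    unfolding gauss_def using gauss_coords.product_integrable_prod[of "{..<n}" "\<lambda>_ x. exp (K * \<bar>x\<bar>)"]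
      integrable_std_normal_exp by simp
  then show ?thesis by (simp add: sum_distrib_left exp_sum)
qed

lemma gauss_coord:
  assumes "j < n"
  shows "integrable (gauss n) (\<lambda>x. x j)" "(\<integral>x. x j \<partial>gauss n) = 0"
proof -
  define f where "f = (\<lambda>i x. if i = j then x else (1::real))"
  have eq: "(\<Prod>i<n. f i (x i)) = x j" for x
    using assms by (simp add: f_def prod.If_cases Int_absorb1 prod.delta cong: if_cong)
  have i: "integrable std_normal (f i)" for i
    by (cases "i = j") (auto simp: f_def std_normal_moments)
  show "integrable (gauss n) (\<lambda>x. x j)"
    using gauss_coords.product_integrable_prod[of "{..<n}" f] i by (simp add: gauss_def eq)
  have "(\<Prod>i<n. integral\<^sup>L std_normal (f i)) = 0"
    using assms std_normal_moments(2) by (intro prod_zero bexI[of _ j]) (auto simp: f_def)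
  then show "(\<integral>x. x j \<partial>gauss n) = 0"
    using gauss_coords.product_integral_prod[of "{..<n}" f] i by (simp add: gauss_def eq)
qed

lemma gauss_coord_mult:
  assumes "j < n" "k < n"
  shows "integrable (gauss n) (\<lambda>x. x j * x k)"
    "(\<integral>x. x j * x k \<partial>gauss n) = (if j = k then 1 else 0)"
proof -
  define f where "f = (\<lambda>i x. (if i = j then x else 1) * (if i = k then x else (1::real)))"
  have eq: "(\<Prod>i<n. f i (x i)) = x j * x k" for x
    using assms by (simp add: f_def prod.distrib prod.delta cong: if_cong)
  have i: "integrable std_normal (f i)" for i
    using std_normal_moments(1) std_normal_moments(3)[unfolded power2_eq_square]
    by (cases "i = j"; cases "i = k") (simp_all add: f_def)
  show "integrable (gauss n) (\<lambda>x. x j * x k)"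
    using gauss_coords.product_integrable_prod[of "{..<n}" f] i by (simp add: gauss_def eq)
  have "(\<Prod>i<n. integral\<^sup>L std_normal (f i)) = (if j = k then 1 else 0)"
  proof (cases "j = k")
    case True
    then have "integral\<^sup>L std_normal (f i) = 1" for i
      using std_normal_moments(4)
      by (cases "i = k") (auto simp: f_def power2_eq_square std_normal.prob_space[simplified space_std_normal])
    then show ?thesis using True by simp
  next
    case False
    then have "integral\<^sup>L std_normal (f j) = 0" by (simp add: f_def std_normal_moments)
    then show ?thesis using False assms by (auto intro!: prod_zero)
  qed
  then show "(\<integral>x. x j * x k \<partial>gauss n) = (if j = k then 1 else 0)"
    using gauss_coords.product_integral_prod[of "{..<n}" f] i by (simp add: gauss_def eq)
qed

text \<open>
  The convolution semigroup of centred normal densities, integrated against a test function.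
\<close>

lemma std_normal_sum:
  fixes a b r :: real
  assumes ab: "0 < a" "0 < b" and r: "r = sqrt (a\<^sup>2 + b\<^sup>2)" and [measurable]: "H \<in> borel_measurable borel"
  shows "(\<integral>\<^sup>+ z. (\<integral>\<^sup>+ y. H (a * y + b * z) \<partial>std_normal) \<partial>std_normal) = (\<integral>\<^sup>+ y. H (r * y) \<partial>std_normal)"
proof -
  have r0: "0 < r" using ab r by (simp add: sum_power2_gt_zero_iff)
  have dens: "(\<integral>\<^sup>+ y. G (c * y) \<partial>std_normal) = (\<integral>\<^sup>+ u. normal_density 0 c u * G u \<partial>lborel)"
    if "0 < c" and [measurable]: "G \<in> borel_measurable borel" for c :: real and G :: "real \<Rightarrow> ennreal"
  proof -
    have "(\<integral>\<^sup>+ u. normal_density 0 c u * G u \<partial>lborel)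
        = ennreal c * (\<integral>\<^sup>+ y. normal_density 0 c (c * y) * G (c * y) \<partial>lborel)"
      using that by (subst nn_integral_real_affine[where c=c and t=0]) auto
    also have "\<dots> = (\<integral>\<^sup>+ y. ennreal (std_normal_density y) * G (c * y) \<partial>lborel)"
    proof (subst nn_integral_cmult[symmetric], simp, intro nn_integral_cong)
      fix y
      have "c * normal_density 0 c (c * y) = std_normal_density y"
        using that by (simp add: normal_density_def power_mult_distrib real_sqrt_mult field_simps)
      then show "ennreal c * (ennreal (normal_density 0 c (c * y)) * G (c * y))
          = ennreal (std_normal_density y) * G (c * y)"
        using that by (simp add: mult.assoc[symmetric] ennreal_mult'[symmetric])
    qed
    finally show ?thesis by (simp add: std_normal_def nn_integral_density)
  qed
  have "(\<integral>\<^sup>+ z. (\<integral>\<^sup>+ y. H (a * y + b * z) \<partial>std_normal) \<partial>std_normal)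
      = (\<integral>\<^sup>+ z. (\<integral>\<^sup>+ u. normal_density 0 a u * H (u + b * z) \<partial>lborel) \<partial>std_normal)"
    using dens[of a "\<lambda>u. H (u + b * z)" for z] ab by simp
  also have "\<dots> = (\<integral>\<^sup>+ z. (\<integral>\<^sup>+ u. normal_density 0 a (u - b * z) * H u \<partial>lborel) \<partial>std_normal)"
  proof (rule nn_integral_cong)
    fix z
    show "(\<integral>\<^sup>+ u. normal_density 0 a u * H (u + b * z) \<partial>lborel)
        = (\<integral>\<^sup>+ u. normal_density 0 a (u - b * z) * H u \<partial>lborel)"
      using nn_integral_real_affine[of "\<lambda>u. normal_density 0 a (u - b * z) * H u" 1 "b * z"]
      by (simp add: add.commute)
  qed
  also have "\<dots> = (\<integral>\<^sup>+ v. normal_density 0 b v * (\<integral>\<^sup>+ u. normal_density 0 a (u - v) * H u \<partial>lborel) \<partial>lborel)"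
    using dens[of b "\<lambda>v. (\<integral>\<^sup>+ u. normal_density 0 a (u - v) * H u \<partial>lborel)"] ab by simp
  also have "\<dots> = (\<integral>\<^sup>+ v. (\<integral>\<^sup>+ u. normal_density 0 b v * (normal_density 0 a (u - v) * H u) \<partial>lborel) \<partial>lborel)"
    by (simp add: nn_integral_cmult)
  also have "\<dots> = (\<integral>\<^sup>+ u. (\<integral>\<^sup>+ v. normal_density 0 b v * (normal_density 0 a (u - v) * H u) \<partial>lborel) \<partial>lborel)"
    by (rule lborel_pair.Fubini') measurable
  also have "\<dots> = (\<integral>\<^sup>+ u. (\<integral>\<^sup>+ v. ennreal (normal_density 0 a (u - v) * normal_density 0 b v) \<partial>lborel) * H u \<partial>lborel)"
    by (intro nn_integral_cong, subst nn_integral_multc[symmetric])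
      (auto simp: ennreal_mult' mult_ac intro!: nn_integral_cong)
  also have "\<dots> = (\<integral>\<^sup>+ u. normal_density 0 r u * H u \<partial>lborel)"
    using fun_cong[OF conv_normal_density_zero_mean[OF ab]] by (simp add: r)
  also have "\<dots> = (\<integral>\<^sup>+ y. H (r * y) \<partial>std_normal)" using dens[of r H] r0 by simp
  finally show ?thesis .
qed

lemma measurable_restrict_fun [measurable (raw)]:
  assumes "\<And>j. j < n \<Longrightarrow> (\<lambda>x. f x j) \<in> borel_measurable M"
  shows "(\<lambda>x. restrict (f x) {..<n}) \<in> M \<rightarrow>\<^sub>M (borel_fun n)"
  by (rule measurable_restrict) (use assms in auto)

lemma emeasure_distr_indicator:
  assumes "f \<in> M \<rightarrow>\<^sub>M N" "X \<in> sets N"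
  shows "emeasure (distr M N f) X = (\<integral>\<^sup>+ x. indicator X (f x) \<partial>M)"
  using assms nn_integral_distr[of f M N "indicator X"] by simp

text \<open>
  For independent standard Gaussian vectors \<open>Y\<close> and \<open>Z\<close> the vector \<open>a Y + b Z\<close> is distributed like
  \<open>\<surd>(a\<^sup>2 + b\<^sup>2) Y\<close>. On a box both laws factor into one-dimensional ones, where \<open>std_normal_sum\<close> applies, and
  boxes determine a product measure.
\<close>

lemma gauss_sum:
  fixes a b r :: real
  assumes ab: "0 < a" "0 < b" and r: "r = sqrt (a\<^sup>2 + b\<^sup>2)"
    and H[measurable]: "H \<in> borel_measurable (borel_fun n)"
  shows "(\<integral>\<^sup>+ z. (\<integral>\<^sup>+ y. H (\<lambda>j\<in>{..<n}. a * y j + b * z j) \<partial>gauss n) \<partial>gauss n)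
    = (\<integral>\<^sup>+ y. H (\<lambda>j\<in>{..<n}. r * y j) \<partial>gauss n)"
proof -
  let ?B = "\<Pi>\<^sub>M j\<in>{..<n}. (borel :: real measure)"
  interpret pair_prob_space "gauss n" "gauss n" ..
  define S :: "(nat \<Rightarrow> real) \<times> (nat \<Rightarrow> real) \<Rightarrow> nat \<Rightarrow> real"
    where "S = (\<lambda>(z, y). \<lambda>j\<in>{..<n}. a * y j + b * z j)"
  define T :: "(nat \<Rightarrow> real) \<Rightarrow> nat \<Rightarrow> real" where "T = (\<lambda>y. \<lambda>j\<in>{..<n}. r * y j)"
  have S[measurable]: "S \<in> gauss n \<Otimes>\<^sub>M gauss n \<rightarrow>\<^sub>M ?B" unfolding S_def by measurable
  have T[measurable]: "T \<in> gauss n \<rightarrow>\<^sub>M ?B" unfolding T_def by measurable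
  have psf: "prob_space (distr std_normal borel ((*) r))"
    by (rule std_normal.prob_space_distr) simp
  have box: "(\<Pi>\<^sub>E j\<in>{..<n}. A j) \<in> sets ?B" if "\<And>j. j < n \<Longrightarrow> A j \<in> sets borel" for A
    by (rule sets_PiM_I_finite) (use that in auto)
  have coord: "emeasure (distr std_normal borel ((*) r)) X = (\<integral>\<^sup>+ y. indicator X (r * y) \<partial>std_normal)"
    if X[measurable]: "X \<in> sets borel" for X
    by (rule emeasure_distr_indicator) simp_all
  have psf': "product_sigma_finite (\<lambda>j::nat. distr std_normal borel ((*) r))"
    using psf by (simp add: product_sigma_finite_def prob_space_imp_sigma_finite)
  have img: "distr (gauss n) ?B T = (\<Pi>\<^sub>M j\<in>{..<n}. distr std_normal borel ((*) r))"
  proof (rule product_sigma_finite.PiM_eqI[OF psf' finite_lessThan])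
    show "sets (distr (gauss n) ?B T) = sets (\<Pi>\<^sub>M j\<in>{..<n}. distr std_normal borel ((*) r))"
      by (simp, intro sets_PiM_cong) simp_all
    fix A :: "nat \<Rightarrow> real set" assume "\<And>j. j \<in> {..<n} \<Longrightarrow> A j \<in> sets (distr std_normal borel ((*) r))"
    then have A[measurable]: "A j \<in> sets borel" if "j < n" for j using that by simp
    have "emeasure (distr (gauss n) ?B T) (Pi\<^sub>E {..<n} A) = (\<integral>\<^sup>+ y. indicator (Pi\<^sub>E {..<n} A) (T y) \<partial>gauss n)"
      using box[of A] A by (intro emeasure_distr_indicator) auto
    also have "\<dots> = (\<integral>\<^sup>+ y. (\<Prod>j<n. indicator (A j) (r * y j)) \<partial>gauss n)"
      by (intro nn_integral_cong) (auto simp: T_def indicator_def PiE_iff prod_eq_1_iff prod_zero_iff)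
    also have "\<dots> = (\<Prod>j<n. \<integral>\<^sup>+ y. indicator (A j) (r * y) \<partial>std_normal)"
      unfolding gauss_def by (intro gauss_coords.product_nn_integral_prod) auto
    finally show "emeasure (distr (gauss n) ?B T) (Pi\<^sub>E {..<n} A)
      = (\<Prod>j<n. emeasure (distr std_normal borel ((*) r)) (A j))"
      by (simp add: coord A)
  qed
  have "distr (gauss n \<Otimes>\<^sub>M gauss n) ?B S = distr (gauss n) ?B T"
    unfolding img
  proof (rule product_sigma_finite.PiM_eqI[OF psf' finite_lessThan])
    show "sets (distr (gauss n \<Otimes>\<^sub>M gauss n) ?B S) = sets (\<Pi>\<^sub>M j\<in>{..<n}. distr std_normal borel ((*) r))"
      by (simp, intro sets_PiM_cong) simp_all
    fix A :: "nat \<Rightarrow> real set" assume "\<And>j. j \<in> {..<n} \<Longrightarrow> A j \<in> sets (distr std_normal borel ((*) r))"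
    then have A[measurable]: "A j \<in> sets borel" if "j < n" for j using that by simp
    have "emeasure (distr (gauss n \<Otimes>\<^sub>M gauss n) ?B S) (Pi\<^sub>E {..<n} A)
      = (\<integral>\<^sup>+ p. indicator (Pi\<^sub>E {..<n} A) (S p) \<partial>(gauss n \<Otimes>\<^sub>M gauss n))"
      using box[of A] A by (intro emeasure_distr_indicator) auto
    also have "\<dots> = (\<integral>\<^sup>+ z. (\<integral>\<^sup>+ y. indicator (Pi\<^sub>E {..<n} A) (S (z, y)) \<partial>gauss n) \<partial>gauss n)"
      using box[of A] A by (subst gauss.nn_integral_fst[symmetric]) auto
    also have "\<dots> = (\<integral>\<^sup>+ z. (\<integral>\<^sup>+ y. (\<Prod>j<n. indicator (A j) (a * y j + b * z j)) \<partial>gauss n) \<partial>gauss n)"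
    proof (intro nn_integral_cong)
      fix z y :: "nat \<Rightarrow> real"
      show "indicator (Pi\<^sub>E {..<n} A) (S (z, y)) = (\<Prod>j<n. indicator (A j) (a * y j + b * z j) :: ennreal)"
        by (auto simp: S_def indicator_def PiE_iff prod_eq_1_iff prod_zero_iff)
    qed
    also have "\<dots> = (\<integral>\<^sup>+ z. (\<Prod>j<n. \<integral>\<^sup>+ y. indicator (A j) (a * y + b * z j) \<partial>std_normal) \<partial>gauss n)"
      unfolding gauss_def
      by (intro nn_integral_cong gauss_coords.product_nn_integral_prod) auto
    also have "\<dots> = (\<Prod>j<n. \<integral>\<^sup>+ z. \<integral>\<^sup>+ y. indicator (A j) (a * y + b * z) \<partial>std_normal \<partial>std_normal)"
      unfolding gauss_def
      by (intro gauss_coords.product_nn_integral_prod) auto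
    also have "\<dots> = (\<Prod>j<n. emeasure (distr std_normal borel ((*) r)) (A j))"
      using std_normal_sum[OF ab r, of "indicator (A j)" for j] by (intro prod.cong refl) (simp add: coord A)
    finally show "emeasure (distr (gauss n \<Otimes>\<^sub>M gauss n) ?B S) (Pi\<^sub>E {..<n} A)
      = (\<Prod>j<n. emeasure (distr std_normal borel ((*) r)) (A j))" .
  qed
  then have "(\<integral>\<^sup>+ x. H x \<partial>distr (gauss n \<Otimes>\<^sub>M gauss n) ?B S) = (\<integral>\<^sup>+ x. H x \<partial>distr (gauss n) ?B T)"
    by simp
  then have 1: "(\<integral>\<^sup>+ p. H (S p) \<partial>(gauss n \<Otimes>\<^sub>M gauss n)) = (\<integral>\<^sup>+ y. H (T y) \<partial>gauss n)"
    by (simp add: nn_integral_distr)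
  have 2: "(\<integral>\<^sup>+ z. (\<integral>\<^sup>+ y. H (S (z, y)) \<partial>gauss n) \<partial>gauss n) = (\<integral>\<^sup>+ p. H (S p) \<partial>(gauss n \<Otimes>\<^sub>M gauss n))"
    using gauss.nn_integral_fst[of "\<lambda>p. H (S p)" "gauss n"] measurable_compose[OF S H] by simp
  show ?thesis using 2[unfolded 1] unfolding S_def T_def case_prod_conv .
qed

section \<open>One step of the heat flow\<close>

definition dot :: "nat \<Rightarrow> (nat \<Rightarrow> real) \<Rightarrow> (nat \<Rightarrow> real) \<Rightarrow> real" where
  "dot n x y = (\<Sum>j<n. x j * y j)"

lemma dot_cong: "(\<And>j. j < n \<Longrightarrow> x j = x' j) \<Longrightarrow> (\<And>j. j < n \<Longrightarrow> y j = y' j) \<Longrightarrow> dot n x y = dot n x' y'"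
  unfolding dot_def by (intro sum.cong) auto

lemma measurable_dot [measurable (raw)]:
  assumes "\<And>j. j < n \<Longrightarrow> (\<lambda>x. f x j) \<in> borel_measurable M" "\<And>j. j < n \<Longrightarrow> (\<lambda>x. g x j) \<in> borel_measurable M"
  shows "(\<lambda>x. dot n (f x) (g x)) \<in> borel_measurable M"
  unfolding dot_def using assms by (intro borel_measurable_sum borel_measurable_times) auto

text \<open>
  The third moment that controls the remainder of a time step: the exponential factor accounts for the
  growth of the functions that are being averaged.
\<close>

definition gauss_cubic :: "nat \<Rightarrow> real \<Rightarrow> real" where
  "gauss_cubic n K = (\<integral>z. (\<Sum>j<n. \<bar>z j\<bar>) ^ 3 * exp (K * (\<Sum>j<n. \<bar>z j\<bar>)) \<partial>gauss n)"

lemma integrable_gauss_cubic: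
  "integrable (gauss n) (\<lambda>z. (\<Sum>j<n. \<bar>z j\<bar>) ^ 3 * exp (K * (\<Sum>j<n. \<bar>z j\<bar>)))"
proof (rule Bochner_Integration.integrable_bound)
  show "integrable (gauss n) (\<lambda>z. 6 * exp ((K + 1) * (\<Sum>j<n. \<bar>z j\<bar>)))"
    by (intro integrable_mult_right integrable_gauss_exp)
  have cube: "t ^ 3 \<le> 6 * exp t" if t: "0 \<le> t" for t :: real
  proof -
    obtain s where "exp t = (\<Sum>k<4. t ^ k / fact k) + exp s / fact 4 * t ^ 4"
      using Maclaurin_exp_le[of t 4] by blast
    moreover have "0 \<le> exp s / fact 4 * t ^ 4" by simp
    ultimately have "exp t \<ge> t ^ 3 / 6 + t\<^sup>2 / 2 + t + 1"
      by (simp add: eval_nat_numeral fact_numeral)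
    moreover have "0 \<le> t\<^sup>2" by simp
    ultimately show ?thesis using t by linarith
  qed
  show "AE z in gauss n. norm ((\<Sum>j<n. \<bar>z j\<bar>) ^ 3 * exp (K * (\<Sum>j<n. \<bar>z j\<bar>)))
      \<le> norm (6 * exp ((K + 1) * (\<Sum>j<n. \<bar>z j\<bar>)))"
  proof (rule AE_I2)
    fix z :: "nat \<Rightarrow> real"
    define N where "N = (\<Sum>j<n. \<bar>z j\<bar>)"
    have "0 \<le> N" by (simp add: N_def sum_nonneg)
    then have "N ^ 3 * exp (K * N) \<le> 6 * exp N * exp (K * N)" using cube by (intro mult_right_mono) auto
    then show "norm ((\<Sum>j<n. \<bar>z j\<bar>) ^ 3 * exp (K * (\<Sum>j<n. \<bar>z j\<bar>)))
      \<le> norm (6 * exp ((K + 1) * (\<Sum>j<n. \<bar>z j\<bar>)))"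
      unfolding N_def[symmetric] using \<open>0 \<le> N\<close> by (simp add: algebra_simps exp_add)
  qed
qed measurable

lemma integral_double_sum:
  fixes f :: "nat \<Rightarrow> nat \<Rightarrow> 'a \<Rightarrow> real"
  assumes f: "\<And>j k. j < n \<Longrightarrow> k < n \<Longrightarrow> integrable M (f j k)"
  shows "integrable M (\<lambda>x. \<Sum>j<n. \<Sum>k<n. f j k x)"
    and "(\<integral>x. (\<Sum>j<n. \<Sum>k<n. f j k x) \<partial>M) = (\<Sum>j<n. \<Sum>k<n. integral\<^sup>L M (f j k))"
proof -
  have i: "integrable M (\<lambda>x. \<Sum>k<n. f j k x)" if "j < n" for j
    by (intro Bochner_Integration.integrable_sum) (use f that in auto)
  show "integrable M (\<lambda>x. \<Sum>j<n. \<Sum>k<n. f j k x)"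
    by (rule Bochner_Integration.integrable_sum) (use i in auto)
  have "(\<integral>x. (\<Sum>j<n. \<Sum>k<n. f j k x) \<partial>M) = (\<Sum>j<n. \<integral>x. (\<Sum>k<n. f j k x) \<partial>M)"
    by (intro Bochner_Integration.integral_sum) (use i in auto)
  also have "\<dots> = (\<Sum>j<n. \<Sum>k<n. integral\<^sup>L M (f j k))"
    by (intro sum.cong refl Bochner_Integration.integral_sum) (use f in auto)
  finally show "(\<integral>x. (\<Sum>j<n. \<Sum>k<n. f j k x) \<partial>M) = (\<Sum>j<n. \<Sum>k<n. integral\<^sup>L M (f j k))" .
qed

lemma gauss_quadratic:
  "integrable (gauss n) (\<lambda>z. \<Sum>j<n. \<Sum>k<n. G j k * (z j * z k))"
  "(\<integral>z. (\<Sum>j<n. \<Sum>k<n. G j k * (z j * z k)) \<partial>gauss n) = (\<Sum>j<n. G j j)"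
proof -
  have i: "integrable (gauss n) (\<lambda>z. G j k * (z j * z k))" if "j < n" "k < n" for j k
    using gauss_coord_mult[OF that] by simp
  show "integrable (gauss n) (\<lambda>z. \<Sum>j<n. \<Sum>k<n. G j k * (z j * z k))"
    by (rule integral_double_sum(1)[OF i])
  have "(\<integral>z. (\<Sum>j<n. \<Sum>k<n. G j k * (z j * z k)) \<partial>gauss n)
      = (\<Sum>j<n. \<Sum>k<n. \<integral>z. G j k * (z j * z k) \<partial>gauss n)"
    by (rule integral_double_sum(2)[OF i])
  also have "\<dots> = (\<Sum>j<n. \<Sum>k<n. if j = k then G j k else 0)"
    by (intro sum.cong refl) (simp add: gauss_coord_mult)
  finally show "(\<integral>z. (\<Sum>j<n. \<Sum>k<n. G j k * (z j * z k)) \<partial>gauss n) = (\<Sum>j<n. G j j)"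
    by simp
qed

lemma gauss_linear:
  "integrable (gauss n) (\<lambda>z. dot n b z)" "(\<integral>z. dot n b z \<partial>gauss n) = 0"
proof -
  have i: "integrable (gauss n) (\<lambda>z. b j * z j)" if "j < n" for j
    using gauss_coord(1)[OF that] by simp
  show "integrable (gauss n) (\<lambda>z. dot n b z)"
    unfolding dot_def by (intro Bochner_Integration.integrable_sum) (use i in auto)
  show "(\<integral>z. dot n b z \<partial>gauss n) = 0"
    unfolding dot_def using i by (subst Bochner_Integration.integral_sum) (auto simp: gauss_coord)
qed

text \<open>
  The constant in the error \<open>h\<^sup>3\<^sup>/\<^sup>2\<close> of a time step, for total weight \<open>S\<close> and frequencies bounded by \<open>R\<close>.
\<close>

definition step_const :: "nat \<Rightarrow> real \<Rightarrow> real \<Rightarrow> real" where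
  "step_const n S R = 2 * (S + S\<^sup>2 + S ^ 3) * R ^ 3 * gauss_cubic n ((S + 3) * R)"

text \<open>
  Expand the product to second order in \<open>\<surd>h z\<close>. The linear term averages to zero, and the average of the
  quadratic form with matrix \<open>G\<close> is its trace
  \<open>\<Sum>\<^sub>i c\<^sub>i (E \<bar>\<theta>\<^sub>i\<bar>\<^sup>2 - \<bar>m\<^sub>i\<bar>\<^sup>2) + \<bar>\<Sum>\<^sub>i c\<^sub>i m\<^sub>i\<bar>\<^sup>2\<close> with the means \<open>m\<^sub>i\<close>. By the contraction hypothesis it is at most
  \<open>\<Sum>\<^sub>i c\<^sub>i E \<bar>\<theta>\<^sub>i\<bar>\<^sup>2\<close>, the sum in the exponent on the right.
\<close>

lemma one_step:
  fixes \<theta> :: "nat \<Rightarrow> 'a \<Rightarrow> nat \<Rightarrow> real" and P :: "nat \<Rightarrow> 'a measure"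
  assumes c: "\<And>i. i < m \<Longrightarrow> 0 \<le> c i" and P: "\<And>i. i < m \<Longrightarrow> prob_space (P i)"
    and meas: "\<And>i j. i < m \<Longrightarrow> j < n \<Longrightarrow> (\<lambda>w. \<theta> i w j) \<in> borel_measurable (P i)"
    and bound: "\<And>i j w. i < m \<Longrightarrow> j < n \<Longrightarrow> w \<in> space (P i) \<Longrightarrow> \<bar>\<theta> i w j\<bar> \<le> R" and R: "0 \<le> R"
    and contraction: "(\<Sum>j<n. (\<Sum>i<m. c i * (\<integral>w. \<theta> i w j \<partial>P i))\<^sup>2)
      \<le> (\<Sum>i<m. c i * (\<Sum>j<n. (\<integral>w. \<theta> i w j \<partial>P i)\<^sup>2))"
    and h: "0 \<le> h" "h \<le> 1"
  defines "S \<equiv> \<Sum>i<m. c i"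
  shows "(\<integral>\<^sup>+ z. ennreal (\<Prod>i<m. (\<integral>w. exp (sqrt h * dot n (\<theta> i w) z) \<partial>P i) powr c i) \<partial>gauss n)
    \<le> ennreal (exp (h / 2 * (\<Sum>i<m. c i * (\<integral>w. dot n (\<theta> i w) (\<theta> i w) \<partial>P i)) + step_const n S R * (h * sqrt h)))"
proof -
  define mean where "mean = (\<lambda>i j. \<integral>w. \<theta> i w j \<partial>P i)"
  define mom where "mom = (\<lambda>i j k. \<integral>w. \<theta> i w j * \<theta> i w k \<partial>P i)"
  define b where "b = (\<lambda>j. \<Sum>i<m. c i * mean i j)"
  define G where "G = (\<lambda>j k. (\<Sum>i<m. c i * (mom i j k - mean i j * mean i k)) + b j * b k)"
  define N where "N = (\<lambda>z::nat \<Rightarrow> real. \<Sum>j<n. \<bar>z j\<bar>)"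
  define K where "K = 2 * (S + S\<^sup>2 + S ^ 3)"
  \<comment> \<open>The second-order expansion of the product; \<open>G\<close> collects its quadratic terms.\<close>
  define F where "F = (\<lambda>z. 1 + sqrt h * dot n b z + h / 2 * (\<Sum>j<n. \<Sum>k<n. G j k * (z j * z k))
     + K * (h * sqrt h) * R ^ 3 * (N z ^ 3 * exp ((S + 3) * R * N z)))"
  have S0: "0 \<le> S" unfolding S_def using c by (intro sum_nonneg) auto
  have K0: "0 \<le> K" using S0 by (simp add: K_def)
  have i1: "integrable (P i) (\<lambda>w. \<theta> i w j)" if "i < m" "j < n" for i j
    using prob_space.expectation_bounded(1)[OF P[OF that(1)] meas[OF that] bound[OF that]] by simp
  have i2: "integrable (P i) (\<lambda>w. \<theta> i w j * \<theta> i w k)" if "i < m" "j < n" "k < n" for i j k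
  proof (rule prob_space.expectation_bounded(1)[OF P[OF that(1)]])
    show "(\<lambda>w. \<theta> i w j * \<theta> i w k) \<in> borel_measurable (P i)" using meas that by simp
    show "\<bar>\<theta> i w j * \<theta> i w k\<bar> \<le> R * R" if "w \<in> space (P i)" for w
      unfolding abs_mult using bound that \<open>i < m\<close> \<open>j < n\<close> \<open>k < n\<close> R by (intro mult_mono) auto
  qed
  have pointwise: "(\<Prod>i<m. (\<integral>w. exp (sqrt h * dot n (\<theta> i w) z) \<partial>P i) powr c i) \<le> F z" for z
  proof -
    define X where "X = (\<lambda>i w. sqrt h * dot n (\<theta> i w) z)"
    define r where "r = sqrt h * (R * N z)"
    define \<psi> where "\<psi> = (\<lambda>i. ln (\<integral>w. exp (X i w) \<partial>P i))"
    define a where "a = (\<lambda>i. \<integral>w. X i w \<partial>P i)"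
    define v where "v = (\<lambda>i. (\<integral>w. (X i w)\<^sup>2 \<partial>P i) - (a i)\<^sup>2)"
    have N0: "0 \<le> N z" unfolding N_def by (intro sum_nonneg) auto
    have r0: "0 \<le> r" unfolding r_def using h R N0 by auto
    have Xm: "X i \<in> borel_measurable (P i)" if "i < m" for i
      unfolding X_def using meas that by measurable
    have Xb: "\<bar>X i w\<bar> \<le> r" if "i < m" "w \<in> space (P i)" for i w
    proof -
      have "\<bar>dot n (\<theta> i w) z\<bar> \<le> R * N z"
        unfolding dot_def N_def sum_distrib_left
        by (rule order_trans[OF sum_abs]) (auto intro!: sum_mono mult_right_mono simp: abs_mult bound that)
      then show ?thesis unfolding X_def r_def abs_mult using h by (auto intro!: mult_left_mono)
    qed
    note bnds = prob_space.ln_expectation_exp_bounds[OF P Xm Xb]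
    have am: "a i = sqrt h * dot n (mean i) z" if "i < m" for i
      unfolding a_def X_def dot_def mean_def using i1 that
      by (simp add: Bochner_Integration.integral_sum)
    have m2: "(\<integral>w. (X i w)\<^sup>2 \<partial>P i) = h * (\<Sum>j<n. \<Sum>k<n. mom i j k * (z j * z k))" if "i < m" for i
    proof -
      have "(X i w)\<^sup>2 = h * (\<Sum>j<n. \<Sum>k<n. (\<theta> i w j * \<theta> i w k) * (z j * z k))" for w
        unfolding X_def dot_def power_mult_distrib using h
        by (simp add: power2_eq_square sum_product mult_ac)
      moreover have "(\<integral>w. (\<Sum>j<n. \<Sum>k<n. (\<theta> i w j * \<theta> i w k) * (z j * z k)) \<partial>P i)
          = (\<Sum>j<n. \<Sum>k<n. mom i j k * (z j * z k))"
      proof -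
        have "integrable (P i) (\<lambda>w. (\<theta> i w j * \<theta> i w k) * (z j * z k))" if "j < n" "k < n" for j k
          using i2[OF \<open>i < m\<close> that] by (rule integrable_mult_left)
        from integral_double_sum(2)[OF this] show ?thesis by (simp add: mom_def)
      qed
      ultimately show ?thesis by simp
    qed
    have lin: "(\<Sum>i<m. c i * a i) = sqrt h * dot n b z"
    proof -
      have "(\<Sum>i<m. c i * a i) = (\<Sum>i<m. \<Sum>j<n. sqrt h * (c i * mean i j * z j))"
        by (intro sum.cong refl) (simp add: am dot_def sum_distrib_left mult_ac)
      also have "\<dots> = sqrt h * dot n b z"
        unfolding dot_def b_def sum_distrib_left sum_distrib_right
        by (subst sum.swap) (simp add: mult_ac)
      finally show ?thesis .
    qed
    have quad: "(\<Sum>i<m. c i * v i) + (\<Sum>i<m. c i * a i)\<^sup>2 = h * (\<Sum>j<n. \<Sum>k<n. G j k * (z j * z k))"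
    proof -
      have dot2: "(dot n x z)\<^sup>2 = (\<Sum>j<n. \<Sum>k<n. x j * x k * (z j * z k))" for x
        unfolding dot_def by (simp add: power2_eq_square sum_product mult_ac)
      have "c i * v i = (\<Sum>j<n. \<Sum>k<n. h * (c i * (mom i j k - mean i j * mean i k)) * (z j * z k))" if "i < m" for i
        unfolding v_def am[OF that] m2[OF that] power_mult_distrib dot2 using h
        by (simp add: sum_distrib_left sum_subtractf[symmetric] algebra_simps)
      then have "(\<Sum>i<m. c i * v i) = (\<Sum>i<m. \<Sum>j<n. \<Sum>k<n. h * (c i * (mom i j k - mean i j * mean i k)) * (z j * z k))"
        by (intro sum.cong) auto
      also have "\<dots> = (\<Sum>j<n. \<Sum>k<n. h * (\<Sum>i<m. c i * (mom i j k - mean i j * mean i k)) * (z j * z k))"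
        by (subst sum.swap, rule sum.cong[OF refl], subst sum.swap)
          (simp only: sum_distrib_left sum_distrib_right mult.assoc)
      finally have "(\<Sum>i<m. c i * v i) + (\<Sum>i<m. c i * a i)\<^sup>2
        = (\<Sum>j<n. \<Sum>k<n. h * (\<Sum>i<m. c i * (mom i j k - mean i j * mean i k)) * (z j * z k))
         + (\<Sum>j<n. \<Sum>k<n. h * (b j * b k * (z j * z k)))"
        unfolding lin power_mult_distrib dot2 using h by (simp add: sum_distrib_left)
      also have "\<dots> = h * (\<Sum>j<n. \<Sum>k<n. G j k * (z j * z k))"
        unfolding sum.distrib[symmetric] sum_distrib_left G_def
        by (intro sum.cong refl) (simp only: distrib_left distrib_right mult.assoc sum_distrib_left sum_distrib_right)
      finally show ?thesis .
    qed
    have "(\<Prod>i<m. (\<integral>w. exp (X i w) \<partial>P i) powr c i) = exp (\<Sum>i<m. c i * \<psi> i)"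
      unfolding exp_sum[OF finite_lessThan]
      by (intro prod.cong refl) (use bnds(1) in \<open>auto simp: powr_def \<psi>_def\<close>, force)
    also have "\<dots> \<le> 1 + (\<Sum>i<m. c i * a i) + (\<Sum>i<m. c i * v i) / 2
      + (\<Sum>i<m. c i * a i)\<^sup>2 / 2 + K * (r ^ 3 * exp ((S + 3) * r))"
      unfolding K_def S_def
    proof (rule exp_weighted_sum_le_quadratic[OF c r0])
      fix i assume i: "i < m"
      show "a i \<le> \<psi> i" "\<psi> i \<le> a i + v i / 2 + 4 / 3 * r ^ 3 * exp (2 * r)" "\<bar>\<psi> i\<bar> \<le> r" "v i \<le> r\<^sup>2"
        using bnds(2-6)[OF i i i] by (simp_all add: a_def \<psi>_def v_def)
      show "\<bar>a i\<bar> \<le> r" unfolding a_def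
        by (rule prob_space.expectation_bounded(2)[OF P[OF i] Xm[OF i] Xb[OF i]])
    qed
    also have "\<dots> = 1 + sqrt h * dot n b z + h / 2 * (\<Sum>j<n. \<Sum>k<n. G j k * (z j * z k))
        + K * (r ^ 3 * exp ((S + 3) * r))"
      using quad lin by simp
    also have "\<dots> \<le> F z"
    proof -
      have "r ^ 3 = (h * sqrt h) * R ^ 3 * N z ^ 3"
        unfolding r_def using h by (simp add: power_mult_distrib power3_eq_cube)
      moreover have "exp ((S + 3) * r) \<le> exp ((S + 3) * R * N z)"
        unfolding r_def using h S0 R N0
        by (simp add: mult.assoc mult_left_mono mult_left_le_one_le)
      ultimately have "r ^ 3 * exp ((S + 3) * r) \<le> (h * sqrt h) * R ^ 3 * N z ^ 3 * exp ((S + 3) * R * N z)"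
        using h R N0 by (auto intro!: mult_left_mono)
      then have "K * (r ^ 3 * exp ((S + 3) * r)) \<le> K * ((h * sqrt h) * R ^ 3 * N z ^ 3 * exp ((S + 3) * R * N z))"
        using K0 by (rule mult_left_mono)
      then show ?thesis unfolding F_def by (simp add: mult_ac)
    qed
    finally show ?thesis unfolding X_def .
  qed
  have ints: "integrable (gauss n) F" unfolding F_def N_def
    by (intro Bochner_Integration.integrable_add integrable_mult_right gauss_linear gauss_quadratic integrable_gauss_cubic) simp
  have F0: "0 \<le> F z" for z
    by (rule order_trans[OF _ pointwise]) (auto intro!: prod_nonneg)
  have "(\<integral>z. F z \<partial>gauss n) = 1 + h / 2 * (\<Sum>j<n. G j j) + K * (h * sqrt h) * R ^ 3 * gauss_cubic n ((S + 3) * R)"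
    unfolding F_def N_def gauss_cubic_def using gauss_linear gauss_quadratic integrable_gauss_cubic
    by (simp add: gauss.prob_space[simplified])
  also have "\<dots> \<le> 1 + (h / 2 * (\<Sum>i<m. c i * (\<integral>w. dot n (\<theta> i w) (\<theta> i w) \<partial>P i)) + step_const n S R * (h * sqrt h))"
  proof -
    have "(\<Sum>j<n. G j j) = (\<Sum>i<m. c i * (\<Sum>j<n. mom i j j)) - (\<Sum>i<m. c i * (\<Sum>j<n. (mean i j)\<^sup>2)) + (\<Sum>j<n. (b j)\<^sup>2)"
      unfolding G_def sum.distrib
      by (subst sum.swap) (simp add: sum_distrib_left sum_subtractf algebra_simps power2_eq_square)
    also have "\<dots> \<le> (\<Sum>i<m. c i * (\<Sum>j<n. mom i j j))"
      using contraction by (simp add: b_def mean_def)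
    also have "\<dots> = (\<Sum>i<m. c i * (\<integral>w. dot n (\<theta> i w) (\<theta> i w) \<partial>P i))"
      unfolding dot_def mom_def using i2 by (intro sum.cong refl) (simp add: Bochner_Integration.integral_sum)
    finally have "h / 2 * (\<Sum>j<n. G j j) \<le> h / 2 * (\<Sum>i<m. c i * (\<integral>w. dot n (\<theta> i w) (\<theta> i w) \<partial>P i))"
      using h by (intro mult_left_mono) auto
    then show ?thesis by (simp add: step_const_def K_def mult_ac)
  qed
  also have "\<dots> \<le> exp (h / 2 * (\<Sum>i<m. c i * (\<integral>w. dot n (\<theta> i w) (\<theta> i w) \<partial>P i)) + step_const n S R * (h * sqrt h))"
    by (rule exp_ge_add_one_self)
  finally have le: "(\<integral>z. F z \<partial>gauss n) \<le> \<dots>" .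
  have "(\<integral>\<^sup>+ z. ennreal (\<Prod>i<m. (\<integral>w. exp (sqrt h * dot n (\<theta> i w) z) \<partial>P i) powr c i) \<partial>gauss n)
      \<le> (\<integral>\<^sup>+ z. ennreal (F z) \<partial>gauss n)"
    using pointwise by (intro nn_integral_mono ennreal_leI)
  also have "\<dots> = ennreal (\<integral>z. F z \<partial>gauss n)"
    using ints F0 by (intro nn_integral_eq_integral) auto
  finally show ?thesis using le by (meson ennreal_leI order_trans)
qed

section \<open>Iterating the heat flow\<close>

text \<open>
  The measures \<open>M i\<close> mix exponentials with frequencies \<open>\<theta> i\<close>. The contraction property is demanded of all
  probability measures on the same spaces because it is applied to exponentially tilted versions of
  \<open>M i\<close>, which change with time and place.
\<close>

locale exponential_families =
  fixes n m :: nat and c :: "nat \<Rightarrow> real" and M :: "nat \<Rightarrow> 'a measure"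
    and \<theta> :: "nat \<Rightarrow> 'a \<Rightarrow> nat \<Rightarrow> real" and R :: real
  assumes c: "i < m \<Longrightarrow> 0 \<le> c i"
    and finite: "i < m \<Longrightarrow> finite_measure (M i)"
    and nonzero: "i < m \<Longrightarrow> emeasure (M i) (space (M i)) \<noteq> 0"
    and meas: "i < m \<Longrightarrow> j < n \<Longrightarrow> (\<lambda>w. \<theta> i w j) \<in> borel_measurable (M i)"
    and bound: "i < m \<Longrightarrow> j < n \<Longrightarrow> w \<in> space (M i) \<Longrightarrow> \<bar>\<theta> i w j\<bar> \<le> R"
    and R: "0 \<le> R"
    and contraction: "(\<And>i. i < m \<Longrightarrow> prob_space (P i) \<and> sets (P i) = sets (M i)) \<Longrightarrow>
        (\<Sum>j<n. (\<Sum>i<m. c i * (\<integral>w. \<theta> i w j \<partial>P i))\<^sup>2)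
        \<le> (\<Sum>i<m. c i * (\<Sum>j<n. (\<integral>w. \<theta> i w j \<partial>P i)\<^sup>2))"
begin

definition exp_weight :: "nat \<Rightarrow> real \<Rightarrow> (nat \<Rightarrow> real) \<Rightarrow> 'a \<Rightarrow> real" where
  "exp_weight i t x w = exp (dot n (\<theta> i w) x + t / 2 * dot n (\<theta> i w) (\<theta> i w))"

text \<open>
  A solution of the heat equation: averaging over a Gaussian displacement of variance \<open>h\<close> advances \<open>t\<close> by \<open>h\<close>.
\<close>

definition laplace :: "nat \<Rightarrow> real \<Rightarrow> (nat \<Rightarrow> real) \<Rightarrow> real" where
  "laplace i t x = (\<integral>w. exp_weight i t x w \<partial>M i)"

definition laplace_prod :: "real \<Rightarrow> (nat \<Rightarrow> real) \<Rightarrow> real" where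
  "laplace_prod t x = (\<Prod>i<m. laplace i t x powr c i)"

lemma abs_dot_le:
  assumes "i < m" "w \<in> space (M i)"
  shows "\<bar>dot n (\<theta> i w) x\<bar> \<le> R * (\<Sum>j<n. \<bar>x j\<bar>)"
  unfolding dot_def sum_distrib_left
  by (rule order_trans[OF sum_abs]) (auto intro!: sum_mono mult_right_mono simp: abs_mult bound assms)

lemma dot_self_le:
  assumes "i < m" "w \<in> space (M i)"
  shows "\<bar>dot n (\<theta> i w) (\<theta> i w)\<bar> \<le> real n * R\<^sup>2"
proof -
  have "\<bar>dot n (\<theta> i w) (\<theta> i w)\<bar> \<le> (\<Sum>j<n. \<bar>\<theta> i w j * \<theta> i w j\<bar>)"
    unfolding dot_def by (rule sum_abs)
  also have "\<dots> \<le> (\<Sum>j<n. R\<^sup>2)"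
    unfolding abs_mult power2_eq_square using assms R bound by (intro sum_mono mult_mono) auto
  finally show ?thesis by simp
qed

lemma exp_weight_pos [simp]: "0 < exp_weight i t x w"
  by (simp add: exp_weight_def)

lemma exp_weight_nonneg [simp]: "0 \<le> exp_weight i t x w"
  by (simp add: less_imp_le)

lemma exp_weight_measurable [measurable]:
  assumes i: "i < m"
  shows "exp_weight i t x \<in> borel_measurable (M i)"
proof -
  note [measurable] = meas[OF i]
  show ?thesis unfolding exp_weight_def[abs_def] by measurable
qed

lemma exp_weight_integrable:
  assumes i: "i < m"
  shows "integrable (M i) (exp_weight i t x)"
proof (rule finite_measure.integrable_const_bound[OF finite[OF i]])
  have "\<bar>t / 2 * dot n (\<theta> i w) (\<theta> i w)\<bar> \<le> \<bar>t / 2\<bar> * (real n * R\<^sup>2)" if "w \<in> space (M i)" for w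
    unfolding abs_mult using dot_self_le[OF i that] by (intro mult_left_mono) auto
  then have "exp_weight i t x w \<le> exp (R * (\<Sum>j<n. \<bar>x j\<bar>) + \<bar>t / 2\<bar> * (real n * R\<^sup>2))" if "w \<in> space (M i)" for w
    unfolding exp_weight_def exp_le_cancel_iff using abs_dot_le[OF i that, of x] that
    by (smt (verit))
  then show "AE w in M i. norm (exp_weight i t x w) \<le> exp (R * (\<Sum>j<n. \<bar>x j\<bar>) + \<bar>t / 2\<bar> * (real n * R\<^sup>2))"
    by (intro AE_I2) (simp add: exp_weight_def)
qed (use i in measurable)

lemma laplace_pos:
  assumes i: "i < m"
  shows "0 < laplace i t x"
proof -
  have "integral\<^sup>L (M i) (exp_weight i t x) \<noteq> 0"
  proof
    assume "integral\<^sup>L (M i) (exp_weight i t x) = 0"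
    then have "AE w in M i. exp_weight i t x w = 0"
      by (subst (asm) integral_nonneg_eq_0_iff_AE) (auto simp: exp_weight_integrable i)
    then have "AE w in M i. False"
      by eventually_elim (metis exp_weight_pos less_irrefl)
    then show False using nonzero[OF i] by (auto simp: eventually_False ae_filter_eq_bot_iff)
  qed
  moreover have "0 \<le> integral\<^sup>L (M i) (exp_weight i t x)"
    by (rule integral_nonneg_AE) simp
  ultimately show ?thesis unfolding laplace_def by (rule le_neq_trans[OF _ not_sym, rotated])
qed

lemma laplace_cong: "(\<And>j. j < n \<Longrightarrow> x j = y j) \<Longrightarrow> laplace i t x = laplace i t y"
  unfolding laplace_def exp_weight_def
  by (intro Bochner_Integration.integral_cong refl arg_cong[where f=exp] arg_cong2[where f="(+)"] dot_cong) auto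

lemma laplace_measurable [measurable]:
  assumes i: "i < m"
  shows "laplace i t \<in> borel_measurable (borel_fun n)"
proof -
  interpret finite_measure "M i" by (rule finite[OF i])
  note [measurable] = meas[OF i]
  have "(\<lambda>(x, w). exp_weight i t x w) \<in> borel_measurable ((borel_fun n) \<Otimes>\<^sub>M M i)"
    unfolding exp_weight_def by measurable
  then show ?thesis unfolding laplace_def[abs_def] by (rule borel_measurable_lebesgue_integral)
qed

lemma laplace_prod_measurable [measurable]: "laplace_prod t \<in> borel_measurable (borel_fun n)"
  unfolding laplace_prod_def[abs_def] by measurable

lemma laplace_prod_cong: "(\<And>j. j < n \<Longrightarrow> x j = y j) \<Longrightarrow> laplace_prod t x = laplace_prod t y"
  unfolding laplace_prod_def by (intro prod.cong refl arg_cong2[where f="(powr)"] laplace_cong) auto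

lemma laplace_prod_nonneg: "0 \<le> laplace_prod t x"
  unfolding laplace_prod_def by (intro prod_nonneg) auto

definition tilt :: "nat \<Rightarrow> real \<Rightarrow> (nat \<Rightarrow> real) \<Rightarrow> 'a measure" where
  "tilt i t x = density (M i) (\<lambda>w. ennreal (exp_weight i t x w / laplace i t x))"

lemma integral_tilt:
  assumes i: "i < m" and [measurable]: "f \<in> borel_measurable (M i)"
  shows "integral\<^sup>L (tilt i t x) f = (\<integral>w. exp_weight i t x w * f w \<partial>M i) / laplace i t x"
proof -
  have "integral\<^sup>L (tilt i t x) f = (\<integral>w. (exp_weight i t x w / laplace i t x) * f w \<partial>M i)"
    unfolding tilt_def using i laplace_pos[OF i, of t x]
    by (subst integral_density) (auto simp: less_imp_le)
  then show ?thesis by (simp add: field_simps)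
qed

lemma prob_space_tilt:
  assumes i: "i < m"
  shows "prob_space (tilt i t x)"
proof (rule prob_spaceI)
  have "emeasure (tilt i t x) (space (tilt i t x)) = (\<integral>\<^sup>+ w. ennreal (exp_weight i t x w / laplace i t x) \<partial>M i)"
    unfolding tilt_def using i by (subst emeasure_density) (auto intro!: nn_integral_cong)
  also have "\<dots> = ennreal (\<integral>w. exp_weight i t x w / laplace i t x \<partial>M i)"
    using exp_weight_integrable[OF i] laplace_pos[OF i, of t x]
    by (intro nn_integral_eq_integral) (auto simp: less_imp_le)
  also have "\<dots> = 1" using laplace_pos[OF i, of t x] by (simp add: laplace_def)
  finally show "emeasure (tilt i t x) (space (tilt i t x)) = 1" .
qed

lemma sets_tilt [simp]: "sets (tilt i t x) = sets (M i)"
  by (simp add: tilt_def)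

lemma space_tilt [simp]: "space (tilt i t x) = space (M i)"
  by (simp add: tilt_def)

lemma expectation_tilt_exp:
  assumes i: "i < m"
  shows "(\<integral>w. exp (s * dot n (\<theta> i w) z) \<partial>tilt i t x) = laplace i t (\<lambda>j. x j + s * z j) / laplace i t x"
proof -
  have "exp_weight i t x w * exp (s * dot n (\<theta> i w) z) = exp_weight i t (\<lambda>j. x j + s * z j) w" for w
    unfolding exp_weight_def mult_exp_exp dot_def
    by (simp add: sum_distrib_left sum.distrib algebra_simps)
  moreover have "(\<lambda>w. exp (s * dot n (\<theta> i w) z)) \<in> borel_measurable (M i)"
    using meas[OF i] by measurable
  ultimately show ?thesis using integral_tilt[OF i] by (simp add: laplace_def)
qed

text \<open>
  The logarithmic time derivative of the Laplace transform is half the tilted second moment of the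
  frequency; Jensen's inequality turns this into a bound over a whole time step.
\<close>

lemma laplace_time_step:
  assumes i: "i < m" and h: "0 \<le> h"
  shows "laplace i t x * exp (h / 2 * (\<integral>w. dot n (\<theta> i w) (\<theta> i w) \<partial>tilt i t x)) \<le> laplace i (t + h) x"
proof -
  interpret prob_space "tilt i t x" by (rule prob_space_tilt[OF i])
  let ?X = "\<lambda>w. h / 2 * dot n (\<theta> i w) (\<theta> i w)"
  have X: "?X \<in> borel_measurable (tilt i t x)"
    using meas[OF i] by (simp add: tilt_def)
  have b: "\<bar>?X w\<bar> \<le> h / 2 * (real n * R\<^sup>2)" if "w \<in> space (tilt i t x)" for w
    unfolding abs_mult using dot_self_le[OF i, of w] that h by (auto intro!: mult_mono)
  have "expectation ?X \<le> ln (expectation (\<lambda>w. exp (?X w)))"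
    by (rule ln_expectation_exp_bounds(2)[OF X b])
  then have "exp (expectation ?X) \<le> expectation (\<lambda>w. exp (?X w))"
    using ln_expectation_exp_bounds(1)[OF X b] exp_le_cancel_iff exp_ln by metis
  moreover have "expectation (\<lambda>w. exp (?X w)) = laplace i (t + h) x / laplace i t x"
  proof -
    have "exp_weight i t x w * exp (?X w) = exp_weight i (t + h) x w" for w
      unfolding exp_weight_def mult_exp_exp by (simp add: algebra_simps add_divide_distrib)
    moreover have "(\<lambda>w. exp (?X w)) \<in> borel_measurable (M i)" using X by (simp add: tilt_def)
    ultimately show ?thesis using integral_tilt[OF i] by (simp add: laplace_def)
  qed
  moreover have "expectation ?X = h / 2 * (\<integral>w. dot n (\<theta> i w) (\<theta> i w) \<partial>tilt i t x)"
    by (rule integral_mult_right_zero)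
  ultimately have "exp (h / 2 * (\<integral>w. dot n (\<theta> i w) (\<theta> i w) \<partial>tilt i t x)) \<le> laplace i (t + h) x / laplace i t x"
    by (simp only:)
  then show ?thesis using laplace_pos[OF i, of t x] by (simp only: pos_le_divide_eq mult.commute)
qed

text \<open>
  Up to the factor \<open>C\<close>, the function \<^const>\<open>laplace_prod\<close> is a supersolution of the heat equation over time
  steps of length \<open>h\<close>.
\<close>

definition comparison :: "real \<Rightarrow> real \<Rightarrow> bool" where
  "comparison h C \<longleftrightarrow> (\<forall>t x. (\<integral>\<^sup>+ z. ennreal (laplace_prod t (\<lambda>j. x j + sqrt h * z j)) \<partial>gauss n)
     \<le> ennreal (C * laplace_prod (t + h) x))"

text \<open>
  Dividing by the value at \<open>(t, x)\<close> turns the Laplace transforms into expectations under the tilted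
  probability measures, so that \<open>one_step\<close> applies; \<open>laplace_time_step\<close> identifies its right-hand side with the
  growth in time.
\<close>

lemma comparison_small:
  assumes h: "0 \<le> h" "h \<le> 1"
  shows "comparison h (exp (step_const n (\<Sum>i<m. c i) R * (h * sqrt h)))"
  unfolding comparison_def
proof (intro allI)
  fix t x
  let ?E = "\<lambda>i. \<integral>w. dot n (\<theta> i w) (\<theta> i w) \<partial>tilt i t x"
  let ?k = "step_const n (\<Sum>i<m. c i) R * (h * sqrt h)"
  have "laplace_prod t (\<lambda>j. x j + sqrt h * z j)
      = laplace_prod t x * (\<Prod>i<m. (\<integral>w. exp (sqrt h * dot n (\<theta> i w) z) \<partial>tilt i t x) powr c i)" for z
    unfolding laplace_prod_def prod.distrib[symmetric]
  proof (intro prod.cong refl)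
    fix i assume "i \<in> {..<m}"
    then have i: "i < m" by simp
    show "laplace i t (\<lambda>j. x j + sqrt h * z j) powr c i
      = laplace i t x powr c i * (\<integral>w. exp (sqrt h * dot n (\<theta> i w) z) \<partial>tilt i t x) powr c i"
      unfolding expectation_tilt_exp[OF i]
      using laplace_pos[OF i, of t x] laplace_pos[OF i, of t "\<lambda>j. x j + sqrt h * z j"]
      by (simp add: powr_mult[symmetric])
  qed
  note factor = this
  have fac: "(\<lambda>z. \<integral>w. exp (sqrt h * dot n (\<theta> i w) z) \<partial>tilt i t x) \<in> borel_measurable (gauss n)" if i: "i < m" for i
  proof -
    have "(\<lambda>z. laplace i t (\<lambda>j\<in>{..<n}. x j + sqrt h * z j)) \<in> borel_measurable (gauss n)"
      using i by measurable
    moreover have "laplace i t (\<lambda>j\<in>{..<n}. x j + sqrt h * z j) = laplace i t (\<lambda>j. x j + sqrt h * z j)" for z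
      by (rule laplace_cong) simp
    ultimately show ?thesis unfolding expectation_tilt_exp[OF i] by simp
  qed
  have "(\<lambda>z. (\<Prod>i<m. (\<integral>w. exp (sqrt h * dot n (\<theta> i w) z) \<partial>tilt i t x) powr c i)) \<in> borel_measurable (gauss n)"
  proof (rule borel_measurable_prod)
    fix i assume "i \<in> {..<m}"
    then have [measurable]: "(\<lambda>z. \<integral>w. exp (sqrt h * dot n (\<theta> i w) z) \<partial>tilt i t x) \<in> borel_measurable (gauss n)"
      using fac by simp
    show "(\<lambda>z. (\<integral>w. exp (sqrt h * dot n (\<theta> i w) z) \<partial>tilt i t x) powr c i) \<in> borel_measurable (gauss n)"
      by measurable
  qed
  then have "(\<integral>\<^sup>+ z. ennreal (laplace_prod t (\<lambda>j. x j + sqrt h * z j)) \<partial>gauss n)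
     = ennreal (laplace_prod t x) * (\<integral>\<^sup>+ z. ennreal (\<Prod>i<m. (\<integral>w. exp (sqrt h * dot n (\<theta> i w) z) \<partial>tilt i t x) powr c i) \<partial>gauss n)"
    by (simp add: factor ennreal_mult' laplace_prod_nonneg nn_integral_cmult)
  also have "\<dots> \<le> ennreal (laplace_prod t x) * ennreal (exp (h / 2 * (\<Sum>i<m. c i * ?E i) + ?k))"
  proof (intro mult_left_mono one_step h R c)
    fix i assume i: "i < m"
    show "prob_space (tilt i t x)" by (rule prob_space_tilt[OF i])
    fix j assume j: "j < n"
    show "(\<lambda>w. \<theta> i w j) \<in> borel_measurable (tilt i t x)" using meas[OF i j] by (simp add: tilt_def)
    show "\<bar>\<theta> i w j\<bar> \<le> R" if "w \<in> space (tilt i t x)" for w using bound[OF i j] that by simp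
  next
    show "(\<Sum>j<n. (\<Sum>i<m. c i * (\<integral>w. \<theta> i w j \<partial>tilt i t x))\<^sup>2)
        \<le> (\<Sum>i<m. c i * (\<Sum>j<n. (\<integral>w. \<theta> i w j \<partial>tilt i t x)\<^sup>2))"
      by (rule contraction) (auto intro: prob_space_tilt)
  qed simp_all
  also have "\<dots> = ennreal (laplace_prod t x * exp (h / 2 * (\<Sum>i<m. c i * ?E i)) * exp ?k)"
    by (simp add: ennreal_mult'[symmetric] laplace_prod_nonneg exp_add mult.assoc)
  also have "\<dots> \<le> ennreal (exp ?k * laplace_prod (t + h) x)"
  proof (intro ennreal_leI)
    have "laplace_prod t x * exp (h / 2 * (\<Sum>i<m. c i * ?E i)) = (\<Prod>i<m. (laplace i t x * exp (h / 2 * ?E i)) powr c i)"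
      unfolding laplace_prod_def sum_distrib_left exp_sum[OF finite_lessThan] prod.distrib[symmetric]
    proof (intro prod.cong refl)
      fix i assume "i \<in> {..<m}"
      then show "laplace i t x powr c i * exp (h / 2 * (c i * ?E i)) = (laplace i t x * exp (h / 2 * ?E i)) powr c i"
        using laplace_pos[of i t x] by (simp add: powr_mult exp_powr_real mult_ac)
    qed
    also have "\<dots> \<le> laplace_prod (t + h) x"
      unfolding laplace_prod_def
    proof (intro prod_mono conjI)
      fix i assume "i \<in> {..<m}"
      then have i: "i < m" by simp
      show "(laplace i t x * exp (h / 2 * ?E i)) powr c i \<le> laplace i (t + h) x powr c i"
        using laplace_pos[OF i, of t x] by (intro powr_mono2 c[OF i] laplace_time_step[OF i h(1)]) simp
    qed simp
    finally show "laplace_prod t x * exp (h / 2 * (\<Sum>i<m. c i * ?E i)) * exp ?k \<le> exp ?k * laplace_prod (t + h) x"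
      by (simp add: mult.commute)
  qed
  finally show "(\<integral>\<^sup>+ z. ennreal (laplace_prod t (\<lambda>j. x j + sqrt h * z j)) \<partial>gauss n)
     \<le> ennreal (exp ?k * laplace_prod (t + h) x)" .
qed

text \<open>
  Two steps of length \<open>h\<close> make one of length \<open>2 * h\<close>, as independent Gaussian displacements add up to a
  Gaussian one.
\<close>

lemma comparison_double:
  assumes C: "comparison h C" "0 \<le> C" and h: "0 < h"
  shows "comparison (2 * h) (C\<^sup>2)"
  unfolding comparison_def
proof (intro allI)
  fix t x
  define H where "H = (\<lambda>y. ennreal (laplace_prod t (\<lambda>j\<in>{..<n}. x j + y j)))"
  have H[measurable]: "H \<in> borel_measurable (borel_fun n)" unfolding H_def by measurable
  have Heq: "H (\<lambda>j\<in>{..<n}. y j) = ennreal (laplace_prod t (\<lambda>j. x j + y j))" for y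
    unfolding H_def by (intro arg_cong[where f=ennreal] laplace_prod_cong) simp
  have rt: "sqrt (2 * h) = sqrt ((sqrt h)\<^sup>2 + (sqrt h)\<^sup>2)" using h by simp
  have "(\<integral>\<^sup>+ z. ennreal (laplace_prod t (\<lambda>j. x j + sqrt (2 * h) * z j)) \<partial>gauss n)
    = (\<integral>\<^sup>+ z. H (\<lambda>j\<in>{..<n}. sqrt (2 * h) * z j) \<partial>gauss n)"
    unfolding Heq ..
  also have "\<dots> = (\<integral>\<^sup>+ z. (\<integral>\<^sup>+ y. H (\<lambda>j\<in>{..<n}. sqrt h * y j + sqrt h * z j) \<partial>gauss n) \<partial>gauss n)"
    using gauss_sum[OF _ _ rt H] h by simp
  also have "\<dots> = (\<integral>\<^sup>+ z. (\<integral>\<^sup>+ y. ennreal (laplace_prod t (\<lambda>j. (x j + sqrt h * z j) + sqrt h * y j)) \<partial>gauss n) \<partial>gauss n)"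
    unfolding Heq by (simp add: add_ac)
  also have "\<dots> \<le> (\<integral>\<^sup>+ z. ennreal (C * laplace_prod (t + h) (\<lambda>j. x j + sqrt h * z j)) \<partial>gauss n)"
    by (intro nn_integral_mono C(1)[unfolded comparison_def, rule_format])
  also have "\<dots> = ennreal C * (\<integral>\<^sup>+ z. ennreal (laplace_prod (t + h) (\<lambda>j. x j + sqrt h * z j)) \<partial>gauss n)"
  proof -
    have "(\<lambda>z. laplace_prod (t + h) (\<lambda>j\<in>{..<n}. x j + sqrt h * z j)) \<in> borel_measurable (gauss n)"
      by measurable
    moreover have "laplace_prod (t + h) (\<lambda>j\<in>{..<n}. x j + sqrt h * z j) = laplace_prod (t + h) (\<lambda>j. x j + sqrt h * z j)" for z
      by (rule laplace_prod_cong) simp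
    ultimately show ?thesis using C(2) by (simp add: ennreal_mult' nn_integral_cmult)
  qed
  also have "\<dots> \<le> ennreal C * ennreal (C * laplace_prod (t + h + h) x)"
    by (intro mult_left_mono C(1)[unfolded comparison_def, rule_format]) simp
  also have "\<dots> = ennreal (C\<^sup>2 * laplace_prod (t + 2 * h) x)"
    using C(2) by (simp add: ennreal_mult'[symmetric] power2_eq_square mult.assoc add.assoc)
  finally show "(\<integral>\<^sup>+ z. ennreal (laplace_prod t (\<lambda>j. x j + sqrt (2 * h) * z j)) \<partial>gauss n)
    \<le> ennreal (C\<^sup>2 * laplace_prod (t + 2 * h) x)" .
qed

text \<open>
  A step of length \<open>2 ^ -k\<close> costs \<open>exp (K * 2 powr (-3 * k / 2))\<close>. Doubling \<open>k\<close> times gives a step of length 1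
  at the cost of \<open>exp (K * 2 powr (-k / 2))\<close>, which tends to 1.
\<close>

theorem gauss_laplace_prod_le:
  "(\<integral>\<^sup>+ z. ennreal (\<Prod>i<m. (\<integral>w. exp (dot n (\<theta> i w) z) \<partial>M i) powr c i) \<partial>gauss n)
    \<le> ennreal (\<Prod>i<m. (\<integral>w. exp (dot n (\<theta> i w) (\<theta> i w) / 2) \<partial>M i) powr c i)"
proof -
  define K where "K = step_const n (\<Sum>i<m. c i) R"
  have iter: "comparison (2 ^ k * h) (exp (2 ^ k * (K * (h * sqrt h))))" if h: "0 < h" "h \<le> 1" for h k
  proof (induction k)
    case 0
    show ?case using comparison_small[of h] h by (simp add: K_def)
  next
    case (Suc k)
    show ?case using comparison_double[OF Suc] h by (simp add: exp_double[symmetric] mult.assoc)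
  qed
  have comp: "comparison 1 (exp (K * sqrt ((1 / 2) ^ k)))" for k
    using iter[of "(1 / 2) ^ k" k] by (simp add: power_one_over power_le_one field_simps)
  \<comment> \<open>The starting point is time 0 and place 0; \<open>0 + sqrt 1 * z j\<close> is the form in which \<^const>\<open>comparison\<close> provides it.\<close>
  define I where "I = (\<integral>\<^sup>+ z. ennreal (laplace_prod 0 (\<lambda>j. 0 + sqrt 1 * z j)) \<partial>gauss n)"
  have "I \<le> ennreal (exp (K * sqrt ((1 / 2) ^ k)) * laplace_prod (0 + 1) (\<lambda>j. 0))" for k
    using comp[of k] unfolding comparison_def I_def by (elim allE)
  moreover have "(\<lambda>k. ennreal (exp (K * sqrt ((1 / 2) ^ k)) * laplace_prod (0 + 1) (\<lambda>j. 0)))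
      \<longlonglongrightarrow> ennreal (exp (K * sqrt 0) * laplace_prod (0 + 1) (\<lambda>j. 0))"
    by (intro tendsto_intros LIMSEQ_power_zero) auto
  ultimately have "I \<le> ennreal (exp (K * sqrt 0) * laplace_prod (0 + 1) (\<lambda>j. 0))"
    by (intro LIMSEQ_le_const) auto
  then show ?thesis
    by (simp add: I_def laplace_prod_def laplace_def exp_weight_def dot_def)
qed

end

section \<open>Triangular changes of variables\<close>

text \<open>
  A change of variables for measurable functions gives an upper bound for the integral of an arbitrary
  function, as that integral is the supremum over the simple functions below it. It is
  applied to functions composed with the maps of the datum.
\<close>

lemma nn_integral_le_of_measurable_eq:
  fixes k :: ennreal
  assumes eq: "\<And>f. f \<in> borel_measurable M \<Longrightarrow> (\<integral>\<^sup>+ x. f x \<partial>M) = k * (\<integral>\<^sup>+ x. f (T x) \<partial>N)"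
  shows "(\<integral>\<^sup>+ x. F x \<partial>M) \<le> k * (\<integral>\<^sup>+ x. F (T x) \<partial>N)"
proof -
  have "integral\<^sup>S M g \<le> k * (\<integral>\<^sup>+ x. F (T x) \<partial>N)" if g: "simple_function M g" "g \<le> F" for g
  proof -
    have "integral\<^sup>S M g = k * (\<integral>\<^sup>+ x. g (T x) \<partial>N)"
      using eq[of g] g by (simp add: nn_integral_eq_simple_integral borel_measurable_simple_function)
    also have "\<dots> \<le> k * (\<integral>\<^sup>+ x. F (T x) \<partial>N)"
      using g(2) by (intro mult_left_mono nn_integral_mono) (auto simp: le_fun_def)
    finally show ?thesis .
  qed
  then show ?thesis unfolding nn_integral_def[of M] by (intro SUP_least) auto
qed

definition lower_map :: "nat \<Rightarrow> (nat \<Rightarrow> nat \<Rightarrow> real) \<Rightarrow> (nat \<Rightarrow> real) \<Rightarrow> (nat \<Rightarrow> real) \<Rightarrow> nat \<Rightarrow> real" where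
  "lower_map n L v x = (\<lambda>j\<in>{..<n}. v j + (\<Sum>k\<le>j. L j k * x k))"

lemma measurable_lower_map [measurable]:
  "lower_map n L v \<in> (borel_fun n) \<rightarrow>\<^sub>M (borel_fun n)"
  unfolding lower_map_def[abs_def]
proof (rule measurable_restrict_fun)
  fix j assume j: "j < n"
  have [measurable]: "(\<lambda>x. x k) \<in> borel_measurable (borel_fun n)" if "k \<le> j" for k
    using that j by (intro measurable_component_singleton) auto
  show "(\<lambda>x. v j + (\<Sum>k\<le>j. L j k * x k)) \<in> borel_measurable (borel_fun n)"
    by measurable
qed

text \<open>
  For a triangular map the substitution can be carried out one coordinate at a time: the last
  coordinate of the image is an affine function of the last coordinate, with slope \<open>L n n\<close> and an offset
  that depends on the earlier ones, and the earlier coordinates of the image do not involve the last one.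
\<close>

lemma nn_integral_lower_map:
  fixes f :: "(nat \<Rightarrow> real) \<Rightarrow> ennreal"
  assumes "f \<in> borel_measurable (borel_fun n)" "\<And>j. j < n \<Longrightarrow> 0 < L j j"
  shows "(\<integral>\<^sup>+ x. f x \<partial>lebesgue_fun n)
    = ennreal (\<Prod>j<n. L j j) * (\<integral>\<^sup>+ x. f (lower_map n L v x) \<partial>lebesgue_fun n)"
  using assms
proof (induction n arbitrary: f)
  case 0
  have "x = lower_map 0 L v x" if "x \<in> extensional {}" for x :: "nat \<Rightarrow> real"
    using that by (auto simp: lower_map_def)
  then show ?case by (auto intro!: nn_integral_cong)
next
  case (Suc n)
  have B: "borel_measurable (\<Pi>\<^sub>M j\<in>insert n {..<n}. borel) = borel_measurable (Pi\<^sub>M (insert n {..<n}) (\<lambda>_. lborel :: real measure))"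
    by (intro measurable_cong_sets sets_PiM_cong) auto
  have split: "(\<integral>\<^sup>+ x. g x \<partial>lebesgue_fun (Suc n)) = (\<integral>\<^sup>+ x. (\<integral>\<^sup>+ y. g (x(n := y)) \<partial>lborel) \<partial>lebesgue_fun n)"
    if "g \<in> borel_measurable (borel_fun (Suc n))" for g :: "_ \<Rightarrow> ennreal"
    unfolding lebesgue_fun_def lessThan_Suc
    by (rule lebesgue_coords.product_nn_integral_insert) (use that in \<open>simp_all add: lessThan_Suc B\<close>)
  have fm[measurable]: "f \<in> borel_measurable (\<Pi>\<^sub>M j\<in>insert n {..<n}. borel)" using Suc.prems(1) by (simp add: lessThan_Suc)
  define G where "G = (\<lambda>z. \<integral>\<^sup>+ s. f (z(n := s)) \<partial>lborel)"
  have up: "(\<lambda>(z, s). z(n := s)) \<in> (borel_fun n) \<Otimes>\<^sub>M lborel \<rightarrow>\<^sub>M (\<Pi>\<^sub>M j\<in>insert n {..<n}. borel :: real measure)"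
  proof (rule measurable_PiM_single')
    fix i assume i: "i \<in> insert n {..<n}"
    show "(\<lambda>x. (case x of (z, s) \<Rightarrow> z(n := s)) i) \<in> (borel_fun n) \<Otimes>\<^sub>M lborel \<rightarrow>\<^sub>M (borel :: real measure)"
      using i by (cases "i = n") (auto simp: split_beta')
  next
    show "(\<lambda>x. case x of (z, s) \<Rightarrow> z(n := s)) \<in> space ((borel_fun n) \<Otimes>\<^sub>M lborel) \<rightarrow> (\<Pi>\<^sub>E i\<in>insert n {..<n}. space (borel :: real measure))"
      by (auto simp: space_pair_measure space_PiM PiE_def extensional_def)
  qed
  have G[measurable]: "G \<in> borel_measurable (borel_fun n)"
    unfolding G_def by (rule lborel.borel_measurable_nn_integral) (use measurable_compose[OF up fm] in \<open>simp add: split_beta'\<close>)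
  have inner: "ennreal (L n n) * (\<integral>\<^sup>+ y. f (lower_map (Suc n) L v (x(n := y))) \<partial>lborel) = G (lower_map n L v x)"
    if x: "x \<in> space (lebesgue_fun n)" for x
  proof -
    let ?z = "lower_map n L v x" and ?c = "v n + (\<Sum>k<n. L n k * x k)"
    have "lower_map (Suc n) L v (x(n := y)) = ?z(n := ?c + L n n * y)" for y
    proof
      fix j
      have "(\<Sum>k\<le>j. L j k * (x(n := y)) k) = (\<Sum>k\<le>j. L j k * x k)" if "j < n"
        using that by (intro sum.cong) auto
      moreover have "(\<Sum>k\<le>n. L n k * (x(n := y)) k) = (\<Sum>k<n. L n k * x k) + L n n * y"
        by (simp add: lessThan_Suc_atMost[symmetric])
      ultimately show "lower_map (Suc n) L v (x(n := y)) j = (?z(n := ?c + L n n * y)) j"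
        by (auto simp: lower_map_def less_Suc_eq)
    qed
    moreover have "(\<lambda>s. f (?z(n := s))) \<in> borel_measurable lborel"
    proof -
      have "?z \<in> space (borel_fun n)" by (simp add: lower_map_def space_PiM)
      then have "(\<lambda>s. (?z, s)) \<in> lborel \<rightarrow>\<^sub>M (borel_fun n) \<Otimes>\<^sub>M lborel" by (rule measurable_Pair1')
      from measurable_compose[OF measurable_compose[OF this up] fm] show ?thesis by simp
    qed
    ultimately show ?thesis
      using Suc.prems(2)[of n] nn_integral_real_affine[of "\<lambda>s. f (?z(n := s))" "L n n" ?c]
      by (simp add: G_def)
  qed
  have m1: "(\<lambda>x. f (lower_map (Suc n) L v x)) \<in> borel_measurable (borel_fun (Suc n))"
    using Suc.prems(1) by measurable
  have m2: "(\<lambda>x. \<integral>\<^sup>+ y. f (lower_map (Suc n) L v (x(n := y))) \<partial>lborel) \<in> borel_measurable (lebesgue_fun n)"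
    using measurable_compose[OF up, of "\<lambda>x. f (lower_map (Suc n) L v x)"] m1
    by (intro lborel.borel_measurable_nn_integral) (simp add: split_beta' lessThan_Suc cong: measurable_cong_sets)
  have "ennreal (\<Prod>j<Suc n. L j j) * (\<integral>\<^sup>+ x. f (lower_map (Suc n) L v x) \<partial>lebesgue_fun (Suc n))
      = ennreal (\<Prod>j<n. L j j) * (\<integral>\<^sup>+ x. ennreal (L n n) * (\<integral>\<^sup>+ y. f (lower_map (Suc n) L v (x(n := y))) \<partial>lborel) \<partial>lebesgue_fun n)"
  proof -
    have "ennreal (\<Prod>j<Suc n. L j j) = ennreal (\<Prod>j<n. L j j) * ennreal (L n n)"
      using Suc.prems(2) unfolding prod.lessThan_Suc
      by (intro ennreal_mult prod_nonneg) (auto simp: less_imp_le)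
    then show ?thesis by (simp only: split[OF m1] nn_integral_cmult[OF m2] mult.assoc)
  qed
  also have "\<dots> = ennreal (\<Prod>j<n. L j j) * (\<integral>\<^sup>+ x. G (lower_map n L v x) \<partial>lebesgue_fun n)"
    by (intro arg_cong2[where f="(*)"] refl nn_integral_cong inner)
  also have "\<dots> = (\<integral>\<^sup>+ x. G x \<partial>lebesgue_fun n)"
    using Suc.IH[OF G] Suc.prems(2) by simp
  also have "\<dots> = (\<integral>\<^sup>+ x. f x \<partial>lebesgue_fun (Suc n))"
    unfolding G_def by (rule split[OF Suc.prems(1), symmetric])
  finally show ?case ..
qed

lemma gauss_density:
  "gauss n = density (lebesgue_fun n) (\<lambda>x. ennreal (exp (- dot n x x / 2) / sqrt (2 * pi) ^ n))"
proof -
  define D where "D = (\<lambda>x::nat \<Rightarrow> real. \<Prod>j<n. ennreal (std_normal_density (x j)))"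
  have D[measurable]: "D \<in> borel_measurable (lebesgue_fun n)"
    unfolding D_def by measurable
  have "density (lebesgue_fun n) D = gauss n"
    unfolding gauss_def
  proof (rule gauss_coords.PiM_eqI)
    show "sets (density (lebesgue_fun n) D) = sets (Pi\<^sub>M {..<n} (\<lambda>j. std_normal))"
      using sets_lebesgue_fun[of n] sets_gauss[of n] by (simp add: gauss_def)
    fix A :: "nat \<Rightarrow> real set" assume "\<And>j. j \<in> {..<n} \<Longrightarrow> A j \<in> sets std_normal"
    then have A[measurable]: "A j \<in> sets borel" if "j < n" for j using that by simp
    have box: "Pi\<^sub>E {..<n} A \<in> sets (lebesgue_fun n)"
      unfolding lebesgue_fun_def by (rule sets_PiM_I_finite) (use A in auto)
    have "emeasure (density (lebesgue_fun n) D) (Pi\<^sub>E {..<n} A)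
      = (\<integral>\<^sup>+ x. (\<Prod>j<n. ennreal (std_normal_density (x j)) * indicator (A j) (x j)) \<partial>lebesgue_fun n)"
    proof (subst emeasure_density[OF D box], intro nn_integral_cong)
      fix x assume "x \<in> space (lebesgue_fun n)"
      then have "indicator (Pi\<^sub>E {..<n} A) x = (\<Prod>j<n. indicator (A j) (x j) :: ennreal)"
        by (auto simp: indicator_def PiE_iff prod_eq_1_iff prod_zero_iff)
      then show "D x * indicator (Pi\<^sub>E {..<n} A) x = (\<Prod>j<n. ennreal (std_normal_density (x j)) * indicator (A j) (x j))"
        by (simp add: D_def prod.distrib)
    qed
    also have "\<dots> = (\<Prod>j<n. \<integral>\<^sup>+ x. ennreal (std_normal_density x) * indicator (A j) x \<partial>lborel)"
      unfolding lebesgue_fun_def by (rule lebesgue_coords.product_nn_integral_prod) (use A in auto)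
    also have "\<dots> = (\<Prod>j<n. emeasure std_normal (A j))"
      unfolding std_normal_def by (intro prod.cong refl, subst emeasure_density) (use A in auto)
    finally show "emeasure (density (lebesgue_fun n) D) (Pi\<^sub>E {..<n} A) = (\<Prod>j<n. emeasure std_normal (A j))" .
  qed simp
  moreover have "D = (\<lambda>x. ennreal (exp (- dot n x x / 2) / sqrt (2 * pi) ^ n))"
  proof
    fix x
    have "D x = ennreal (\<Prod>j<n. exp (- (x j * x j) / 2) / sqrt (2 * pi))"
      unfolding D_def by (subst prod_ennreal) (auto simp: normal_density_def power2_eq_square)
    also have "(\<Prod>j<n. exp (- (x j * x j) / 2) / sqrt (2 * pi)) = exp (- dot n x x / 2) / sqrt (2 * pi) ^ n"
      unfolding prod_dividef exp_sum[OF finite_lessThan, symmetric] dot_def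
      by (simp add: sum_negf sum_divide_distrib)
    finally show "D x = ennreal (exp (- dot n x x / 2) / sqrt (2 * pi) ^ n)" .
  qed
  ultimately show ?thesis by simp
qed

lemma nn_integral_gauss:
  assumes [measurable]: "f \<in> borel_measurable (borel_fun n)"
  shows "(\<integral>\<^sup>+ x. ennreal (exp (- dot n x x / 2)) * f x \<partial>lebesgue_fun n)
    = ennreal (sqrt (2 * pi) ^ n) * (\<integral>\<^sup>+ x. f x \<partial>gauss n)"
proof -
  have dm: "(\<lambda>x. dot n x x) \<in> borel_measurable (lebesgue_fun n)" by measurable
  have "ennreal (sqrt (2 * pi) ^ n) * (\<integral>\<^sup>+ x. f x \<partial>gauss n)
     = (\<integral>\<^sup>+ x. ennreal (sqrt (2 * pi) ^ n) * (ennreal (exp (- dot n x x / 2) / sqrt (2 * pi) ^ n) * f x) \<partial>lebesgue_fun n)"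
    unfolding gauss_density using dm by (simp add: nn_integral_density nn_integral_cmult)
  also have "\<dots> = (\<integral>\<^sup>+ x. ennreal (exp (- dot n x x / 2)) * f x \<partial>lebesgue_fun n)"
    by (intro nn_integral_cong) (simp add: mult.assoc[symmetric] ennreal_mult'[symmetric])
  finally show ?thesis ..
qed

section \<open>The inequality for Gaussian mixtures\<close>

definition lin :: "nat \<Rightarrow> nat \<Rightarrow> (nat \<Rightarrow> nat \<Rightarrow> real) \<Rightarrow> (nat \<Rightarrow> real) \<Rightarrow> nat \<Rightarrow> real" where
  "lin d n Q x = (\<lambda>k\<in>{..<d}. dot n (Q k) x)"

lemma measurable_lin [measurable]: "lin d n Q \<in> (borel_fun n) \<rightarrow>\<^sub>M (borel_fun d)"
  unfolding lin_def[abs_def] by measurable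

text \<open>
  Up to the factor \<open>sqrt (2 * pi) ^ d\<close> this is the convolution of \<open>p\<close> with the standard Gaussian density.
\<close>

definition blur :: "nat \<Rightarrow> ((nat \<Rightarrow> real) \<Rightarrow> real) \<Rightarrow> (nat \<Rightarrow> real) \<Rightarrow> real" where
  "blur d p y = (\<integral>w. p w * exp (- (\<Sum>k<d. (w k - y k)\<^sup>2) / 2) \<partial>lebesgue_fun d)"

text \<open>
  \<open>coisometry\<close> says that \<open>Q i\<close> times its transpose is the identity, and \<open>decomposition\<close> that the weighted
  sum of the transpose of \<open>Q i\<close> times \<open>Q i\<close> is the identity, each in terms of quadratic forms.
\<close>

locale geometric_datum =
  fixes n m :: nat and d :: "nat \<Rightarrow> nat" and c :: "nat \<Rightarrow> real" and Q :: "nat \<Rightarrow> nat \<Rightarrow> nat \<Rightarrow> real"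
  assumes c_pos: "i < m \<Longrightarrow> 0 < c i"
    and dims: "(\<Sum>i<m. c i * real (d i)) = real n"
    and coisometry: "i < m \<Longrightarrow> (\<Sum>j<n. (\<Sum>k<d i. Q i k j * w k)\<^sup>2) = dot (d i) w w"
    and decomposition: "(\<Sum>i<m. c i * dot (d i) (lin (d i) n (Q i) x) (lin (d i) n (Q i) x)) = dot n x x"
begin

text \<open>
  With \<open>b = \<Sum>\<^sub>i c\<^sub>i Q\<^sub>i\<^sup>T w\<^sub>i\<close>, move \<open>Q\<^sub>i\<close> to the other side in \<open>\<langle>b, b\<rangle> = \<Sum>\<^sub>i c\<^sub>i \<langle>w\<^sub>i, Q\<^sub>i b\<rangle>\<close> and use
  \<open>2 \<langle>w, q\<rangle> \<le> \<bar>w\<bar>\<^sup>2 + \<bar>q\<bar>\<^sup>2\<close>; by the decomposition of the identity the second terms sum up to \<open>\<bar>b\<bar>\<^sup>2\<close>.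
\<close>

lemma norm_weighted_adjoint_sum_le:
  "(\<Sum>j<n. (\<Sum>i<m. c i * (\<Sum>k<d i. Q i k j * w i k))\<^sup>2) \<le> (\<Sum>i<m. c i * dot (d i) (w i) (w i))"
proof -
  define b where "b = (\<lambda>j. \<Sum>i<m. c i * (\<Sum>k<d i. Q i k j * w i k))"
  have "dot n b b = (\<Sum>j<n. \<Sum>i<m. \<Sum>k<d i. c i * (w i k * (Q i k j * b j)))"
    unfolding dot_def
  proof (intro sum.cong refl)
    fix j
    have "b j * b j = (\<Sum>i<m. c i * (\<Sum>k<d i. Q i k j * w i k)) * b j" by (simp add: b_def)
    then show "b j * b j = (\<Sum>i<m. \<Sum>k<d i. c i * (w i k * (Q i k j * b j)))"
      by (simp add: sum_distrib_left sum_distrib_right mult_ac)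
  qed
  also have "\<dots> = (\<Sum>i<m. \<Sum>j<n. \<Sum>k<d i. c i * (w i k * (Q i k j * b j)))" by (rule sum.swap)
  also have "\<dots> = (\<Sum>i<m. c i * dot (d i) (w i) (lin (d i) n (Q i) b))"
  proof (rule sum.cong[OF refl])
    fix i
    show "(\<Sum>j<n. \<Sum>k<d i. c i * (w i k * (Q i k j * b j))) = c i * dot (d i) (w i) (lin (d i) n (Q i) b)"
      by (subst sum.swap) (simp add: dot_def lin_def sum_distrib_left)
  qed
  also have "\<dots> \<le> (\<Sum>i<m. c i * ((dot (d i) (w i) (w i) + dot (d i) (lin (d i) n (Q i) b) (lin (d i) n (Q i) b)) / 2))"
  proof (intro sum_mono mult_left_mono)
    fix i assume "i \<in> {..<m}"
    then show "0 \<le> c i" using c_pos by (simp add: less_imp_le)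
    let ?q = "lin (d i) n (Q i) b"
    have "0 \<le> (\<Sum>k<d i. (w i k - ?q k)\<^sup>2)" by (intro sum_nonneg) simp
    also have "\<dots> = dot (d i) (w i) (w i) + dot (d i) ?q ?q - 2 * dot (d i) (w i) ?q"
      by (simp add: dot_def power2_eq_square algebra_simps sum.distrib sum_subtractf sum_distrib_left)
    finally show "dot (d i) (w i) ?q \<le> (dot (d i) (w i) (w i) + dot (d i) ?q ?q) / 2" by simp
  qed
  also have "\<dots> = ((\<Sum>i<m. c i * dot (d i) (w i) (w i)) + dot n b b) / 2"
    unfolding decomposition[of b, symmetric]
    by (simp add: sum_divide_distrib[symmetric] distrib_left sum.distrib)
  finally have "dot n b b \<le> (\<Sum>i<m. c i * dot (d i) (w i) (w i))" by simp
  then show ?thesis by (simp add: dot_def[of n] b_def power2_eq_square)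
qed

text \<open>
  Completing the square, \<open>\<bar>w - Q\<^sub>i x\<bar>\<^sup>2 = \<bar>w\<bar>\<^sup>2 - 2 \<langle>Q\<^sub>i\<^sup>T w, x\<rangle> + \<bar>Q\<^sub>i x\<bar>\<^sup>2\<close>. The last terms combine to
  \<open>exp (-\<bar>x\<bar>\<^sup>2 / 2)\<close>, which turns Lebesgue measure into the Gaussian measure, and the rest is a Laplace
  transform with frequency \<open>Q\<^sub>i\<^sup>T w\<close> of length \<open>\<bar>w\<bar>\<close>. On the right-hand side of \<open>gauss_laplace_prod_le\<close> the factors
  \<open>exp (\<bar>w\<bar>\<^sup>2 / 2)\<close> and \<open>exp (-\<bar>w\<bar>\<^sup>2 / 2)\<close> cancel, which leaves the integrals of \<open>p i\<close>.
\<close>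

lemma smoothed_inequality:
  fixes p :: "nat \<Rightarrow> (nat \<Rightarrow> real) \<Rightarrow> real"
  assumes p[measurable]: "\<And>i. i < m \<Longrightarrow> p i \<in> borel_measurable (borel_fun (d i))"
    and p0: "\<And>i w. i < m \<Longrightarrow> 0 \<le> p i w"
    and pint: "\<And>i. i < m \<Longrightarrow> integrable (lebesgue_fun (d i)) (p i)"
    and K: "0 \<le> K"
    and supp: "\<And>i w k. i < m \<Longrightarrow> p i w \<noteq> 0 \<Longrightarrow> k < d i \<Longrightarrow> \<bar>w k\<bar> \<le> K"
  shows "(\<integral>\<^sup>+ x. ennreal (\<Prod>i<m. blur (d i) (p i) (lin (d i) n (Q i) x) powr c i) \<partial>lebesgue_fun n)
    \<le> ennreal (sqrt (2 * pi) ^ n * (\<Prod>i<m. (\<integral>w. p i w \<partial>lebesgue_fun (d i)) powr c i))"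
proof (cases "\<exists>i<m. (\<integral>w. p i w \<partial>lebesgue_fun (d i)) = 0")
  case True
  then obtain i where i: "i < m" "(\<integral>w. p i w \<partial>lebesgue_fun (d i)) = 0" by blast
  then have "AE w in lebesgue_fun (d i). p i w = 0"
    using pint p0 by (subst (asm) integral_nonneg_eq_0_iff_AE) auto
  then have "blur (d i) (p i) (lin (d i) n (Q i) x) = 0" for x
    unfolding blur_def by (intro integral_eq_zero_AE) auto
  then have zero: "(\<Prod>i<m. blur (d i) (p i) (lin (d i) n (Q i) x) powr c i) = 0" for x
    using i(1) by (intro prod_zero bexI[of _ i]) auto
  show ?thesis unfolding zero by simp
next
  case False
  \<comment> \<open>The support of \<open>p i\<close> is bounded, so clipping changes nothing there, but it bounds the frequencies everywhere.\<close>
  define clip where "clip = (\<lambda>t::real. max (- K) (min K t))"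
  have clip_id: "clip t = t" if "\<bar>t\<bar> \<le> K" for t using that by (auto simp: clip_def)
  have clip_le: "\<bar>clip t\<bar> \<le> K" for t using K by (auto simp: clip_def)
  have [measurable]: "clip \<in> borel_measurable borel" unfolding clip_def by measurable
  define M where "M = (\<lambda>i. density (lebesgue_fun (d i)) (\<lambda>w. ennreal (p i w * exp (- dot (d i) w w / 2))))"
  define \<theta> where "\<theta> = (\<lambda>i w j. \<Sum>k<d i. Q i k j * clip (w k))"
  define R where "R = (\<Sum>i<m. \<Sum>j<n. \<Sum>k<d i. \<bar>Q i k j\<bar> * K)"
  have setsM: "sets (M i) = sets (borel_fun (d i))" for i
    unfolding M_def using sets_lebesgue_fun by simp
  have intM: "integral\<^sup>L (M i) f = (\<integral>w. p i w * exp (- dot (d i) w w / 2) * f w \<partial>lebesgue_fun (d i))"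
    if i: "i < m" and [measurable]: "f \<in> borel_measurable (borel_fun (d i))" for i f
  proof -
    note [measurable] = p[OF i]
    show ?thesis unfolding M_def using p0[OF i] by (subst integral_density) auto
  qed
  have coord[measurable]: "(\<lambda>w. clip (w k)) \<in> borel_measurable (borel_fun (d i))" if "k < d i" for i k
    by (rule measurable_compose[OF measurable_component_singleton]) (use that in auto)
  interpret exponential_families n m c M \<theta> R
  proof (rule exponential_families.intro)
    fix i assume i: "i < m"
    note [measurable] = p[OF i]
    show "0 \<le> c i" using c_pos[OF i] by simp
    have pe: "integrable (lebesgue_fun (d i)) (\<lambda>w. p i w * exp (- dot (d i) w w / 2))"
    proof (rule Bochner_Integration.integrable_bound[OF pint[OF i]])
      show "AE w in lebesgue_fun (d i). norm (p i w * exp (- dot (d i) w w / 2)) \<le> norm (p i w)"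
        using p0[OF i] by (intro AE_I2) (auto simp: dot_def intro!: mult_left_le sum_nonneg)
    qed measurable
    have spM: "emeasure (M i) (space (M i)) = ennreal (\<integral>w. p i w * exp (- dot (d i) w w / 2) \<partial>lebesgue_fun (d i))"
    proof -
      have "emeasure (M i) (space (M i)) = (\<integral>\<^sup>+ w. ennreal (p i w * exp (- dot (d i) w w / 2)) \<partial>lebesgue_fun (d i))"
        unfolding M_def space_density using sets.top[of "lebesgue_fun (d i)"]
        by (subst emeasure_density) (auto intro!: nn_integral_cong)
      also have "\<dots> = ennreal (\<integral>w. p i w * exp (- dot (d i) w w / 2) \<partial>lebesgue_fun (d i))"
        using pe p0[OF i] by (intro nn_integral_eq_integral) auto
      finally show ?thesis .
    qed
    show "finite_measure (M i)" by (rule finite_measureI) (simp add: spM)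
    show "emeasure (M i) (space (M i)) \<noteq> 0"
    proof
      assume "emeasure (M i) (space (M i)) = 0"
      then have "(\<integral>w. p i w * exp (- dot (d i) w w / 2) \<partial>lebesgue_fun (d i)) = 0"
        unfolding spM using p0[OF i] by (simp add: antisym integral_nonneg_AE)
      then have "AE w in lebesgue_fun (d i). p i w * exp (- dot (d i) w w / 2) = 0"
        using pe p0[OF i] by (subst (asm) integral_nonneg_eq_0_iff_AE) auto
      then have "(\<integral>w. p i w \<partial>lebesgue_fun (d i)) = 0" by (intro integral_eq_zero_AE) auto
      then show False using False i by blast
    qed
    fix j assume j: "j < n"
    show "(\<lambda>w. \<theta> i w j) \<in> borel_measurable (M i)"
      unfolding \<theta>_def measurable_cong_sets[OF setsM refl] by (intro borel_measurable_sum borel_measurable_times coord) auto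
    fix w
    have "\<bar>\<theta> i w j\<bar> \<le> (\<Sum>k<d i. \<bar>Q i k j\<bar> * K)"
      unfolding \<theta>_def by (rule order_trans[OF sum_abs]) (auto intro!: sum_mono mult_left_mono simp: abs_mult clip_le)
    also have "\<dots> \<le> (\<Sum>j<n. \<Sum>k<d i. \<bar>Q i k j\<bar> * K)"
      using j K by (intro member_le_sum[of j "{..<n}" "\<lambda>j. \<Sum>k<d i. \<bar>Q i k j\<bar> * K"]) (auto intro!: sum_nonneg)
    also have "\<dots> \<le> R" unfolding R_def
      using i K by (intro member_le_sum[of i "{..<m}" "\<lambda>i. \<Sum>j<n. \<Sum>k<d i. \<bar>Q i k j\<bar> * K"]) (auto intro!: sum_nonneg)
    finally show "\<bar>\<theta> i w j\<bar> \<le> R" .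
  next
    show "0 \<le> R" unfolding R_def using K by (intro sum_nonneg) auto
  next
    fix P :: "nat \<Rightarrow> (nat \<Rightarrow> real) measure"
    assume P: "\<And>i. i < m \<Longrightarrow> prob_space (P i) \<and> sets (P i) = sets (M i)"
    define mean where "mean = (\<lambda>i k. \<integral>w. clip (w k) \<partial>P i)"
    have eq: "(\<integral>w. \<theta> i w j \<partial>P i) = (\<Sum>k<d i. Q i k j * mean i k)" if i: "i < m" for i j
    proof -
      have "integrable (P i) (\<lambda>w. Q i k j * clip (w k))" if k: "k < d i" for k
      proof -
        have sP: "sets (P i) = sets (borel_fun (d i))" using P[OF i] setsM[of i] by simp
        have "(\<lambda>w. clip (w k)) \<in> borel_measurable (P i)"
          unfolding measurable_cong_sets[OF sP refl] by (rule coord[OF k])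
        then have "integrable (P i) (\<lambda>w. clip (w k))"
          using P[OF i] clip_le by (intro prob_space.expectation_bounded(1)[where r=K]) simp_all
        then show ?thesis by (rule integrable_mult_right)
      qed
      then show ?thesis unfolding \<theta>_def mean_def by (subst Bochner_Integration.integral_sum) auto
    qed
    have "(\<Sum>j<n. (\<Sum>i<m. c i * (\<integral>\<omega>. \<theta> i \<omega> j \<partial>P i))\<^sup>2)
        = (\<Sum>j<n. (\<Sum>i<m. c i * (\<Sum>k<d i. Q i k j * mean i k))\<^sup>2)" by (simp add: eq)
    also have "\<dots> \<le> (\<Sum>i<m. c i * dot (d i) (mean i) (mean i))" by (rule norm_weighted_adjoint_sum_le)
    also have "\<dots> = (\<Sum>i<m. c i * (\<Sum>j<n. (\<integral>\<omega>. \<theta> i \<omega> j \<partial>P i)\<^sup>2))"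
      by (intro sum.cong refl) (simp add: eq coisometry)
    finally show "(\<Sum>j<n. (\<Sum>i<m. c i * (\<integral>\<omega>. \<theta> i \<omega> j \<partial>P i))\<^sup>2)
      \<le> (\<Sum>i<m. c i * (\<Sum>j<n. (\<integral>\<omega>. \<theta> i \<omega> j \<partial>P i)\<^sup>2))" .
  qed
  have \<theta>_meas: "(\<lambda>w. dot n (\<theta> i w) x) \<in> borel_measurable (borel_fun (d i))"
     "(\<lambda>w. dot n (\<theta> i w) (\<theta> i w)) \<in> borel_measurable (borel_fun (d i))" if i: "i < m" for i x
    using meas[OF i] unfolding measurable_cong_sets[OF setsM refl] by (intro measurable_dot; simp)+
  have kernel: "blur (d i) (p i) (lin (d i) n (Q i) x)
    = exp (- dot (d i) (lin (d i) n (Q i) x) (lin (d i) n (Q i) x) / 2) * (\<integral>w. exp (dot n (\<theta> i w) x) \<partial>M i)"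
    (is "_ = exp (- ?q / 2) * _") if i: "i < m" for i x
  proof -
    have "(\<integral>w. exp (dot n (\<theta> i w) x) \<partial>M i)
       = (\<integral>w. p i w * exp (- dot (d i) w w / 2) * exp (dot n (\<theta> i w) x) \<partial>lebesgue_fun (d i))"
      using \<theta>_meas(1)[OF i] by (intro intM[OF i]) simp
    then have "exp (- ?q / 2) * (\<integral>w. exp (dot n (\<theta> i w) x) \<partial>M i)
       = (\<integral>w. exp (- ?q / 2) * (p i w * exp (- dot (d i) w w / 2) * exp (dot n (\<theta> i w) x)) \<partial>lebesgue_fun (d i))"
      by simp
    also have "\<dots> = blur (d i) (p i) (lin (d i) n (Q i) x)"
      unfolding blur_def
    proof (intro Bochner_Integration.integral_cong refl)
      fix w
      show "exp (- ?q / 2) * (p i w * exp (- dot (d i) w w / 2) * exp (dot n (\<theta> i w) x))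
        = p i w * exp (- (\<Sum>k<d i. (w k - lin (d i) n (Q i) x k)\<^sup>2) / 2)"
      proof (cases "p i w = 0")
        case False
        have "clip (w k) = w k" if "k < d i" for k by (intro clip_id supp[OF i False that])
        then have "dot n (\<theta> i w) x = (\<Sum>j<n. \<Sum>k<d i. w k * (Q i k j * x j))"
          unfolding dot_def \<theta>_def by (simp add: sum_distrib_left sum_distrib_right mult_ac)
        also have "\<dots> = dot (d i) w (lin (d i) n (Q i) x)"
          by (subst sum.swap) (simp add: dot_def lin_def sum_distrib_left)
        finally have "dot n (\<theta> i w) x = dot (d i) w (lin (d i) n (Q i) x)" .
        moreover have "(\<Sum>k<d i. (w k - lin (d i) n (Q i) x k)\<^sup>2) = dot (d i) w w + ?q - 2 * dot (d i) w (lin (d i) n (Q i) x)"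
          by (simp add: dot_def power2_eq_square algebra_simps sum.distrib sum_subtractf sum_distrib_left)
        ultimately have "- ?q / 2 + - dot (d i) w w / 2 + dot n (\<theta> i w) x
            = - (\<Sum>k<d i. (w k - lin (d i) n (Q i) x k)\<^sup>2) / 2" by simp
        moreover have "exp (- ?q / 2) * (p i w * exp (- dot (d i) w w / 2) * exp (dot n (\<theta> i w) x))
            = p i w * exp (- ?q / 2 + - dot (d i) w w / 2 + dot n (\<theta> i w) x)"
          unfolding exp_add by simp
        ultimately show ?thesis by (simp only:)
      qed simp
    qed
    finally show ?thesis ..
  qed
  have total: "(\<integral>w. exp (dot n (\<theta> i w) (\<theta> i w) / 2) \<partial>M i) = (\<integral>w. p i w \<partial>lebesgue_fun (d i))" if i: "i < m" for i
  proof -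
    have "(\<integral>w. exp (dot n (\<theta> i w) (\<theta> i w) / 2) \<partial>M i)
       = (\<integral>w. p i w * exp (- dot (d i) w w / 2) * exp (dot n (\<theta> i w) (\<theta> i w) / 2) \<partial>lebesgue_fun (d i))"
      using \<theta>_meas(2)[OF i] by (intro intM[OF i]) simp
    also have "\<dots> = (\<integral>w. p i w \<partial>lebesgue_fun (d i))"
    proof (intro Bochner_Integration.integral_cong refl)
      fix w
      show "p i w * exp (- dot (d i) w w / 2) * exp (dot n (\<theta> i w) (\<theta> i w) / 2) = p i w"
      proof (cases "p i w = 0")
        case False
        have "clip (w k) = w k" if "k < d i" for k by (intro clip_id supp[OF i False that])
        moreover have "dot n (\<theta> i w) (\<theta> i w) = dot (d i) (\<lambda>k. clip (w k)) (\<lambda>k. clip (w k))"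
          unfolding coisometry[OF i, symmetric] by (simp add: dot_def \<theta>_def power2_eq_square)
        ultimately have "dot n (\<theta> i w) (\<theta> i w) = dot (d i) w w" by (simp add: dot_def)
        then show ?thesis by (simp add: mult.assoc mult_exp_exp)
      qed simp
    qed
    finally show ?thesis .
  qed
  have mixm: "(\<lambda>x. \<Prod>i<m. (\<integral>w. exp (dot n (\<theta> i w) x) \<partial>M i) powr c i) \<in> borel_measurable (borel_fun n)"
    using laplace_prod_measurable[of 0] by (simp add: laplace_prod_def[abs_def] laplace_def exp_weight_def)
  have "(\<integral>\<^sup>+ x. ennreal (\<Prod>i<m. blur (d i) (p i) (lin (d i) n (Q i) x) powr c i) \<partial>lebesgue_fun n)
    = (\<integral>\<^sup>+ x. ennreal (exp (- dot n x x / 2)) * ennreal (\<Prod>i<m. (\<integral>w. exp (dot n (\<theta> i w) x) \<partial>M i) powr c i) \<partial>lebesgue_fun n)"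
  proof (intro nn_integral_cong)
    fix x
    let ?q = "\<lambda>i. dot (d i) (lin (d i) n (Q i) x) (lin (d i) n (Q i) x)"
    have "(\<Prod>i<m. blur (d i) (p i) (lin (d i) n (Q i) x) powr c i)
      = (\<Prod>i<m. exp (- (c i * ?q i) / 2) * (\<integral>w. exp (dot n (\<theta> i w) x) \<partial>M i) powr c i)"
    proof (intro prod.cong refl)
      fix i assume "i \<in> {..<m}"
      then have i: "i < m" by simp
      have "0 \<le> (\<integral>w. exp (dot n (\<theta> i w) x) \<partial>M i)" by (rule integral_nonneg_AE) simp
      then show "blur (d i) (p i) (lin (d i) n (Q i) x) powr c i
         = exp (- (c i * ?q i) / 2) * (\<integral>w. exp (dot n (\<theta> i w) x) \<partial>M i) powr c i"
        unfolding kernel[OF i] by (simp add: powr_mult exp_powr_real mult_ac)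
    qed
    also have "\<dots> = exp (- dot n x x / 2) * (\<Prod>i<m. (\<integral>w. exp (dot n (\<theta> i w) x) \<partial>M i) powr c i)"
      unfolding prod.distrib exp_sum[OF finite_lessThan, symmetric] decomposition[of x, symmetric]
      by (simp add: sum_negf sum_divide_distrib)
    finally show "ennreal (\<Prod>i<m. blur (d i) (p i) (lin (d i) n (Q i) x) powr c i)
      = ennreal (exp (- dot n x x / 2)) * ennreal (\<Prod>i<m. (\<integral>w. exp (dot n (\<theta> i w) x) \<partial>M i) powr c i)"
      by (simp add: ennreal_mult')
  qed
  also have "\<dots> = ennreal (sqrt (2 * pi) ^ n) * (\<integral>\<^sup>+ x. ennreal (\<Prod>i<m. (\<integral>w. exp (dot n (\<theta> i w) x) \<partial>M i) powr c i) \<partial>gauss n)"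
    using mixm by (intro nn_integral_gauss) simp
  also have "\<dots> \<le> ennreal (sqrt (2 * pi) ^ n) * ennreal (\<Prod>i<m. (\<integral>w. exp (dot n (\<theta> i w) (\<theta> i w) / 2) \<partial>M i) powr c i)"
    by (intro mult_left_mono gauss_laplace_prod_le) simp
  also have "\<dots> = ennreal (sqrt (2 * pi) ^ n * (\<Prod>i<m. (\<integral>w. p i w \<partial>lebesgue_fun (d i)) powr c i))"
    by (simp add: total ennreal_mult')
  finally show ?thesis .
qed

end

section \<open>Lower semicontinuous majorants\<close>

text \<open>
  The sum counts the \<open>k\<close> with \<open>k * e < y\<close>, so it equals \<open>e * \<lceil>y / e\<rceil>\<close>: the layer cake representation with step \<open>e\<close>.
\<close>

lemma ceiling_layers:
  fixes y :: ennreal and e :: real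
  assumes e: "0 < e"
  shows "y \<le> (\<Sum>k. ennreal e * indicator {y. ennreal (real k * e) < y} y)"
    and "(\<Sum>k. ennreal e * indicator {y. ennreal (real k * e) < y} y) \<le> y + ennreal e"
proof -
  let ?a = "\<lambda>k. ennreal e * indicator {y. ennreal (real k * e) < y} y"
  have "y \<le> (\<Sum>k. ?a k) \<and> (\<Sum>k. ?a k) \<le> y + ennreal e"
  proof (cases y)
    case (real r)
    define K where "K = nat \<lceil>r / e\<rceil>"
    have "ennreal (real k * e) < y \<longleftrightarrow> k < K" for k
    proof -
      have "ennreal (real k * e) < y \<longleftrightarrow> real k * e < r" using e real by (simp add: ennreal_less_iff)
      also have "\<dots> \<longleftrightarrow> real k < r / e" using e by (simp add: field_simps)
      also have "\<dots> \<longleftrightarrow> k < K" unfolding K_def by linarith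
      finally show ?thesis .
    qed
    then have "(\<Sum>k. ?a k) = (\<Sum>k<K. ?a k)" by (intro suminf_finite) auto
    also have "\<dots> = (\<Sum>k<K. ennreal e)" using \<open>\<And>k. _ \<longleftrightarrow> k < K\<close> by (intro sum.cong) auto
    also have "\<dots> = ennreal (real K * e)" using e by (simp add: ennreal_mult' ennreal_of_nat_eq_real_of_nat)
    finally have s: "(\<Sum>k. ?a k) = ennreal (real K * e)" .
    have "0 \<le> r / e" using real e by simp
    then have "0 \<le> \<lceil>r / e\<rceil>" by linarith
    then have "real K = of_int \<lceil>r / e\<rceil>" by (simp add: K_def)
    then have "r / e \<le> real K" "real K \<le> r / e + 1" by linarith+
    then have "r \<le> real K * e" "real K * e \<le> r + e" using e by (auto simp: field_simps)
    then show ?thesis unfolding s using real e by (simp add: ennreal_plus[symmetric] del: ennreal_plus)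
  next
    case top
    have "(\<Sum>k::nat. ennreal e) = \<infinity>"
    proof (rule ccontr)
      assume "(\<Sum>k::nat. ennreal e) \<noteq> \<infinity>"
      then have "summable (\<lambda>k::nat. e)" using e by (intro summable_suminf_not_top) auto
      then show False using e by (simp add: summable_const_iff)
    qed
    moreover have "?a k = ennreal e" for k by (simp add: top)
    ultimately show ?thesis by (simp add: top)
  qed
  then show "y \<le> (\<Sum>k. ?a k)" "(\<Sum>k. ?a k) \<le> y + ennreal e" by auto
qed

text \<open>
  The Gaussian measure viewed on the space of all sequences, which is a complete separable metric space, so
  that finite Borel measures on it are outer regular.
\<close>

definition gauss_borel :: "nat \<Rightarrow> (nat \<Rightarrow> real) measure" where
  "gauss_borel n = distr (gauss n) borel (\<lambda>x. x)"

lemma measurable_id_gauss: "(\<lambda>x. x) \<in> gauss n \<rightarrow>\<^sub>M (borel :: (nat \<Rightarrow> real) measure)"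
proof -
  have "(\<lambda>x. x) \<in> (borel_fun n) \<rightarrow>\<^sub>M (\<Pi>\<^sub>M j\<in>UNIV. (borel :: real measure))"
    by (rule measurable_PiM_single') (auto intro: measurable_coord)
  then show ?thesis by (subst measurable_cong_sets[OF sets_gauss sets_PiM_equal_borel[symmetric]])
qed

lemma measurable_restrict_borel:
  "(\<lambda>x. restrict x {..<n}) \<in> (borel :: (nat \<Rightarrow> real) measure) \<rightarrow>\<^sub>M (borel_fun n)"
proof -
  have "(\<lambda>x. restrict x {..<n}) \<in> (\<Pi>\<^sub>M j\<in>UNIV. (borel :: real measure)) \<rightarrow>\<^sub>M (borel_fun n)"
    by (rule measurable_restrict_subset) simp
  then show ?thesis by (subst measurable_cong_sets[OF sets_PiM_equal_borel[symmetric] refl])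
qed

text \<open>
  Measures of sets are written as integrals of indicators because \<open>U\<close> is a set of arbitrary sequences.
\<close>

lemma gauss_outer_regular:
  assumes E: "E \<in> sets (borel_fun n)" and e: "0 < e"
  obtains U :: "(nat \<Rightarrow> real) set" where "open U" "E \<subseteq> U"
    "(\<integral>\<^sup>+ x. indicator U x \<partial>gauss n) \<le> (\<integral>\<^sup>+ x. indicator E x \<partial>gauss n) + ennreal e"
proof -
  let ?E = "(\<lambda>x. restrict x {..<n}) -` E"
  have Eb: "?E \<in> sets borel"
    using measurable_sets[OF measurable_restrict_borel E] by simp
  have em: "emeasure (gauss_borel n) X = (\<integral>\<^sup>+ x. indicator X x \<partial>gauss n)" if "X \<in> sets borel" for X
    unfolding gauss_borel_def by (rule emeasure_distr_indicator[OF measurable_id_gauss that])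
  interpret G: prob_space "gauss_borel n"
    unfolding gauss_borel_def by (rule gauss.prob_space_distr[OF measurable_id_gauss])
  have fin: "emeasure (gauss_borel n) ?E \<noteq> \<infinity>" using G.emeasure_finite by simp
  have "emeasure (gauss_borel n) ?E = (INF U\<in>{U. ?E \<subseteq> U \<and> open U}. emeasure (gauss_borel n) U)"
    using G.emeasure_finite by (intro outer_regular Eb) (simp_all add: gauss_borel_def)
  moreover have "emeasure (gauss_borel n) ?E < emeasure (gauss_borel n) ?E + ennreal e"
    using fin e by (simp add: ennreal_add_left_cancel_less less_top)
  ultimately obtain U where U: "?E \<subseteq> U" "open U" "emeasure (gauss_borel n) U < emeasure (gauss_borel n) ?E + ennreal e"
    by (metis (mono_tags, lifting) INF_less_iff mem_Collect_eq)
  have ext: "E \<subseteq> extensional {..<n}" using sets.sets_into_space[OF E] by (auto simp: space_PiM PiE_def)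
  have "E \<subseteq> U" using ext U(1) by (auto simp: subset_iff extensional_restrict)
  moreover have "(\<integral>\<^sup>+ x. indicator ?E x \<partial>gauss n) = (\<integral>\<^sup>+ x. indicator E x \<partial>gauss n)"
    by (intro nn_integral_cong) (auto simp: indicator_def extensional_restrict)
  ultimately show ?thesis using that[of U] U em[of U] em[OF Eb] by (auto simp: borel_open less_imp_le)
qed

text \<open>
  Divide by the Gaussian weight to get into the setting of a finite measure. There, enclose the
  superlevel sets of the quotient \<open>f\<close> at the levels \<open>k * e\<close> in open sets \<open>U k\<close> and take \<open>e\<close> times the sum of the indicators:
  this is lower semicontinuous, at least \<open>f\<close>, and rounding up costs at most \<open>e\<close> because the measure has
  total mass 1. Multiplying by the weight again keeps lower semicontinuity since the weight is
  continuous. Semicontinuity is stated along sequences, as it is going to be used.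
\<close>

lemma lsc_majorant:
  fixes g :: "(nat \<Rightarrow> real) \<Rightarrow> ennreal"
  assumes g[measurable]: "g \<in> borel_measurable (borel_fun n)" and \<delta>: "0 < \<delta>"
  obtains h where "h \<in> borel_measurable (borel_fun n)" "\<And>x. x \<in> extensional {..<n} \<Longrightarrow> g x \<le> h x"
    "(\<integral>\<^sup>+ x. h x \<partial>lebesgue_fun n) \<le> (\<integral>\<^sup>+ x. g x \<partial>lebesgue_fun n) + ennreal \<delta>"
    "\<And>x u. x \<in> extensional {..<n} \<Longrightarrow> (\<And>k. u k \<in> extensional {..<n}) \<Longrightarrow>
        (\<And>j. j < n \<Longrightarrow> (\<lambda>k. u k j) \<longlonglongrightarrow> x j) \<Longrightarrow> h x \<le> liminf (\<lambda>k. h (u k))"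
proof -
  define \<kappa> where "\<kappa> = sqrt (2 * pi) ^ n"
  have \<kappa>: "0 < \<kappa>" by (simp add: \<kappa>_def)
  define e where "e = \<delta> / (3 * \<kappa>)"
  have e: "0 < e" using \<delta> \<kappa> by (simp add: e_def)
  \<comment> \<open>\<open>w\<close> is the Gaussian density up to its normalising factor \<open>\<kappa>\<close>, and \<open>f\<close> is the density of \<open>g\<close> relative to it.
        Rounding costs \<open>e\<close> and the open sets cost \<open>e * (1 + 1 / 2 + \<dots>) = 2 * e\<close>, whence \<open>3 * e\<close> in total.\<close>
  define w where "w = (\<lambda>x::nat \<Rightarrow> real. exp (- dot n x x / 2))"
  define f where "f = (\<lambda>x. ennreal (exp (dot n x x / 2)) * g x)"
  define E where "E = (\<lambda>k::nat. {x \<in> space (borel_fun n). ennreal (real k * e) < f x})"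
  have wf: "ennreal (w x) * f x = g x" for x
    unfolding w_def f_def by (simp add: mult.assoc[symmetric] ennreal_mult'[symmetric] mult_exp_exp)
  have f[measurable]: "f \<in> borel_measurable (borel_fun n)" unfolding f_def by measurable
  have Em: "E k \<in> sets (borel_fun n)" for k unfolding E_def by measurable
  have "\<exists>U. open U \<and> E k \<subseteq> U \<and>
    (\<integral>\<^sup>+ x. indicator U x \<partial>gauss n) \<le> (\<integral>\<^sup>+ x. indicator (E k) x \<partial>gauss n) + ennreal ((1 / 2) ^ k)" for k
    by (rule gauss_outer_regular[OF Em, of "(1 / 2) ^ k"]) auto
  then obtain U where U: "\<And>k. open (U k)" "\<And>k. E k \<subseteq> U k"
    "\<And>k. (\<integral>\<^sup>+ x. indicator (U k) x \<partial>gauss n) \<le> (\<integral>\<^sup>+ x. indicator (E k) x \<partial>gauss n) + ennreal ((1 / 2) ^ k)"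
    by metis
  define H where "H = (\<lambda>x. \<Sum>k. ennreal e * indicator (U k) x)"
  have Um[measurable]: "(indicator (U k) :: _ \<Rightarrow> ennreal) \<in> borel_measurable (borel_fun n)" for k
  proof -
    have "(\<lambda>x. indicator (U k) x :: ennreal) \<in> borel_measurable (gauss n)"
      using U(1)[of k] by (intro measurable_compose[OF measurable_id_gauss] borel_measurable_indicator) simp
    then show ?thesis by (simp cong: measurable_cong_sets add: sets_gauss)
  qed
  have H[measurable]: "H \<in> borel_measurable (borel_fun n)" unfolding H_def by measurable
  have fH: "f x \<le> H x" if x: "x \<in> extensional {..<n}" for x
  proof -
    have "f x \<le> (\<Sum>k. ennreal e * indicator {y. ennreal (real k * e) < y} (f x))"
      by (rule ceiling_layers(1)[OF e])
    also have "\<dots> \<le> H x" unfolding H_def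
      using x U(2) by (intro suminf_le mult_left_mono) (auto simp: indicator_def E_def space_PiM PiE_def)
    finally show ?thesis .
  qed
  have "(\<integral>\<^sup>+ x. H x \<partial>gauss n) = (\<Sum>k. ennreal e * (\<integral>\<^sup>+ x. indicator (U k) x \<partial>gauss n))"
    unfolding H_def by (subst nn_integral_suminf) (auto simp: nn_integral_cmult)
  also have "\<dots> \<le> (\<Sum>k. ennreal e * ((\<integral>\<^sup>+ x. indicator (E k) x \<partial>gauss n) + ennreal ((1 / 2) ^ k)))"
    by (intro suminf_le mult_left_mono U(3)) auto
  also have "\<dots> = (\<Sum>k. ennreal e * (\<integral>\<^sup>+ x. indicator (E k) x \<partial>gauss n)) + ennreal e * (\<Sum>k. ennreal ((1 / 2) ^ k))"
    by (simp add: distrib_left suminf_add[symmetric])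
  also have "(\<Sum>k. ennreal ((1 / 2) ^ k)) = ennreal 2"
    using geometric_sums[of "1 / 2 :: real"] by (intro suminf_ennreal_eq) auto
  finally have upper: "(\<integral>\<^sup>+ x. H x \<partial>gauss n)
    \<le> (\<Sum>k. ennreal e * (\<integral>\<^sup>+ x. indicator (E k) x \<partial>gauss n)) + ennreal e * ennreal 2" .
  have "(\<Sum>k. ennreal e * (\<integral>\<^sup>+ x. indicator (E k) x \<partial>gauss n))
      = (\<integral>\<^sup>+ x. (\<Sum>k. ennreal e * indicator (E k) x) \<partial>gauss n)"
    using Em by (subst nn_integral_suminf) (auto simp: nn_integral_cmult sets_gauss)
  also have "\<dots> \<le> (\<integral>\<^sup>+ x. f x + ennreal e \<partial>gauss n)"
  proof (intro nn_integral_mono)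
    fix x
    have "(\<Sum>k. ennreal e * indicator (E k) x) \<le> (\<Sum>k. ennreal e * indicator {y. ennreal (real k * e) < y} (f x))"
      by (intro suminf_le mult_left_mono) (auto simp: indicator_def E_def)
    also have "\<dots> \<le> f x + ennreal e" by (rule ceiling_layers(2)[OF e])
    finally show "(\<Sum>k. ennreal e * indicator (E k) x) \<le> f x + ennreal e" .
  qed
  also have "\<dots> = (\<integral>\<^sup>+ x. f x \<partial>gauss n) + ennreal e"
    by (subst nn_integral_add) (auto simp: gauss.emeasure_space_1[simplified])
  finally have IH0: "(\<integral>\<^sup>+ x. H x \<partial>gauss n) \<le> (\<integral>\<^sup>+ x. f x \<partial>gauss n) + ennreal e + ennreal e * ennreal 2"
    by (intro order_trans[OF upper] add_right_mono)
  have IH: "(\<integral>\<^sup>+ x. H x \<partial>gauss n) \<le> (\<integral>\<^sup>+ x. f x \<partial>gauss n) + ennreal (3 * e)"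
  proof -
    have "ennreal e * ennreal 2 = ennreal (2 * e)" using e by (subst ennreal_mult'[symmetric]) (simp_all add: mult.commute)
    then have "ennreal e + ennreal e * ennreal 2 = ennreal (3 * e)"
      using e by (simp add: ennreal_plus[symmetric] del: ennreal_plus)
    then show ?thesis using IH0 by (simp only: add.assoc)
  qed
  define h where "h = (\<lambda>x. ennreal (w x) * H x)"
  show ?thesis
  proof (rule that[of h])
    show hm: "h \<in> borel_measurable (borel_fun n)" unfolding h_def w_def by measurable
    show "g x \<le> h x" if "x \<in> extensional {..<n}" for x
      unfolding h_def wf[symmetric] using fH[OF that] by (intro mult_left_mono) auto
    have "(\<integral>\<^sup>+ x. h x \<partial>lebesgue_fun n) = ennreal \<kappa> * (\<integral>\<^sup>+ x. H x \<partial>gauss n)"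
      unfolding h_def w_def \<kappa>_def by (rule nn_integral_gauss[OF H])
    also have "\<dots> \<le> ennreal \<kappa> * ((\<integral>\<^sup>+ x. f x \<partial>gauss n) + ennreal (3 * e))"
      by (intro mult_left_mono IH) simp
    also have "\<dots> = ennreal \<kappa> * (\<integral>\<^sup>+ x. f x \<partial>gauss n) + ennreal \<delta>"
      using \<kappa> \<delta> by (simp add: distrib_left ennreal_mult'[symmetric] e_def)
    also have "ennreal \<kappa> * (\<integral>\<^sup>+ x. f x \<partial>gauss n) = (\<integral>\<^sup>+ x. g x \<partial>lebesgue_fun n)"
      unfolding \<kappa>_def wf[symmetric] w_def by (rule nn_integral_gauss[OF f, symmetric])
    finally show "(\<integral>\<^sup>+ x. h x \<partial>lebesgue_fun n) \<le> (\<integral>\<^sup>+ x. g x \<partial>lebesgue_fun n) + ennreal \<delta>" .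
  next
    fix x and u :: "nat \<Rightarrow> nat \<Rightarrow> real"
    assume x: "x \<in> extensional {..<n}" and u: "\<And>k. u k \<in> extensional {..<n}"
      and lim: "\<And>j. j < n \<Longrightarrow> (\<lambda>k. u k j) \<longlonglongrightarrow> x j"
    have "(\<lambda>k. u k j) \<longlonglongrightarrow> x j" for j
    proof (cases "j < n")
      case False
      then have "u k j = x j" for k using x u[of k] by (simp add: extensional_def)
      then show ?thesis by simp
    qed (rule lim)
    then have ux: "u \<longlonglongrightarrow> x"
      unfolding limitin_canonical_iff[symmetric] euclidean_product_topology[symmetric] limitin_componentwise
      by (simp add: limitin_canonical_iff)
    have "(\<lambda>k. w (u k)) \<longlonglongrightarrow> w x"
      unfolding w_def dot_def by (intro tendsto_intros lim) auto
    then have wx: "(\<lambda>k. ennreal (w (u k))) \<longlonglongrightarrow> ennreal (w x)" by (rule tendsto_ennrealI)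
    \<comment> \<open>Finitely many of the open sets are handled at once: those containing \<open>x\<close> eventually contain \<open>u k\<close>.\<close>
    have part: "ennreal (w x) * (\<Sum>i<N. ennreal e * indicator (U i) x) \<le> liminf (\<lambda>k. h (u k))" (is "_ * ?S \<le> _") for N
    proof -
      have "?S \<noteq> \<infinity>" by (auto simp: ennreal_mult_eq_top_iff indicator_def)
      have "eventually (\<lambda>k. \<forall>i<N. x \<in> U i \<longrightarrow> u k \<in> U i) sequentially"
        using topological_tendstoD[OF ux U(1)]
        by (auto intro!: eventually_ball_finite[of "{..<N}", simplified Ball_def lessThan_iff] simp: eventually_mono)
      then have "eventually (\<lambda>k. ennreal (w (u k)) * ?S \<le> h (u k)) sequentially"
      proof eventually_elim
        case (elim k)
        have "?S \<le> (\<Sum>i<N. ennreal e * indicator (U i) (u k))"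
          using elim by (intro sum_mono mult_left_mono) (auto simp: indicator_def)
        also have "\<dots> \<le> H (u k)" unfolding H_def by (rule sum_le_suminf) auto
        finally show ?case unfolding h_def by (intro mult_left_mono) auto
      qed
      then have "liminf (\<lambda>k. ennreal (w (u k)) * ?S) \<le> liminf (\<lambda>k. h (u k))" by (rule Liminf_mono)
      moreover have "(\<lambda>k. ennreal (w (u k)) * ?S) \<longlonglongrightarrow> ennreal (w x) * ?S"
        using wx \<open>?S \<noteq> \<infinity>\<close> by (intro tendsto_mult_ennreal tendsto_const) auto
      ultimately show ?thesis by (simp add: lim_imp_Liminf)
    qed
    have "h x = (SUP N. ennreal (w x) * (\<Sum>i<N. ennreal e * indicator (U i) x))"
      unfolding h_def H_def suminf_eq_SUP by (simp add: SUP_mult_left_ennreal)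
    then show "h x \<le> liminf (\<lambda>k. h (u k))" using part by (auto intro: SUP_least)
  qed
qed

section \<open>The geometric Brascamp-Lieb inequality\<close>

text \<open>
  For \<open>\<eta> < 1\<close> each \<open>F i k\<close> eventually exceeds \<open>\<eta> * f i\<close>; let \<open>\<eta>\<close> tend to 1. If some \<open>f i\<close> vanishes then so does the
  product on the left.
\<close>

lemma prod_powr_le_liminf:
  fixes f c :: "nat \<Rightarrow> real" and F :: "nat \<Rightarrow> nat \<Rightarrow> real"
  assumes f: "\<And>i. i < m \<Longrightarrow> 0 \<le> f i" and c: "\<And>i. i < m \<Longrightarrow> 0 \<le> c i"
    and le: "\<And>i. i < m \<Longrightarrow> ennreal (f i) \<le> liminf (\<lambda>k. ennreal (F i k))"
  shows "ennreal (\<Prod>i<m. f i powr c i) \<le> liminf (\<lambda>k. ennreal (\<Prod>i<m. F i k powr c i))"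
proof (cases "\<exists>i<m. f i = 0")
  case True
  then obtain i where "i < m" "f i = 0" by blast
  then have zero: "(\<Prod>i<m. f i powr c i) = 0" by (intro prod_zero bexI[of _ i]) auto
  show ?thesis unfolding zero by simp
next
  case False
  then have pos: "0 < f i" if "i < m" for i using f[OF that] that by force
  have step: "ennreal (\<Prod>i<m. (\<eta> * f i) powr c i) \<le> liminf (\<lambda>k. ennreal (\<Prod>i<m. F i k powr c i))"
    if \<eta>: "0 \<le> \<eta>" "\<eta> < 1" for \<eta>
  proof (rule Liminf_bounded)
    have "eventually (\<lambda>k. \<eta> * f i < F i k) sequentially" if i: "i < m" for i
    proof -
      have "ennreal (\<eta> * f i) < ennreal (f i)"
        using \<eta> pos[OF i] by (simp add: ennreal_less_iff)
      then have "eventually (\<lambda>k. ennreal (\<eta> * f i) < ennreal (F i k)) sequentially"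
        using le[OF i] unfolding le_Liminf_iff by blast
      then show ?thesis
        by eventually_elim (use \<eta> pos[OF i] in \<open>simp add: ennreal_less_iff\<close>)
    qed
    then have "eventually (\<lambda>k. \<forall>i\<in>{..<m}. \<eta> * f i < F i k) sequentially"
      by (intro eventually_ball_finite) auto
    then show "eventually (\<lambda>k. ennreal (\<Prod>i<m. (\<eta> * f i) powr c i) \<le> ennreal (\<Prod>i<m. F i k powr c i)) sequentially"
      by eventually_elim (use \<eta> f c in \<open>auto intro!: ennreal_leI prod_mono powr_mono2 simp: less_imp_le\<close>)
  qed
  let ?\<eta> = "\<lambda>N. 1 - inverse (real (Suc N))"
  have "?\<eta> \<longlonglongrightarrow> 1 - 0" by (intro tendsto_diff tendsto_const LIMSEQ_inverse_real_of_nat)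
  then have "(\<lambda>N. ennreal (\<Prod>i<m. (?\<eta> N * f i) powr c i)) \<longlonglongrightarrow> ennreal (\<Prod>i<m. ((1 - 0) * f i) powr c i)"
    using pos by (intro tendsto_ennrealI tendsto_prod tendsto_powr tendsto_mult tendsto_const) force+
  then have "ennreal (\<Prod>i<m. ((1 - 0) * f i) powr c i) \<le> liminf (\<lambda>k. ennreal (\<Prod>i<m. F i k powr c i))"
  proof (rule LIMSEQ_le_const2)
    have "ennreal (\<Prod>i<m. (?\<eta> N * f i) powr c i) \<le> liminf (\<lambda>k. ennreal (\<Prod>i<m. F i k powr c i))" for N
      by (rule step) (auto simp: field_simps)
    then show "\<exists>N. \<forall>k\<ge>N. ennreal (\<Prod>i<m. (?\<eta> k * f i) powr c i) \<le> liminf (\<lambda>k. ennreal (\<Prod>i<m. F i k powr c i))"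
      by blast
  qed
  then show ?thesis by simp
qed

lemma nn_integral_lebesgue_fun_translate:
  fixes f :: "(nat \<Rightarrow> real) \<Rightarrow> ennreal"
  assumes [measurable]: "f \<in> borel_measurable (borel_fun n)"
  shows "(\<integral>\<^sup>+ x. f x \<partial>lebesgue_fun n) = (\<integral>\<^sup>+ x. f (\<lambda>j\<in>{..<n}. v j + x j) \<partial>lebesgue_fun n)"
proof -
  have "lower_map n (\<lambda>j k. if j = k then 1 else 0) v x = (\<lambda>j\<in>{..<n}. v j + x j)" for x
    by (auto simp: lower_map_def restrict_def fun_eq_iff if_distrib[of "\<lambda>a. a * _"] cong: if_cong)
  then show ?thesis
    using nn_integral_lower_map[OF assms, of "\<lambda>j k. if j = k then 1 else 0" v] by simp
qed

lemma nn_integral_lebesgue_fun_scale: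
  fixes f :: "(nat \<Rightarrow> real) \<Rightarrow> ennreal"
  assumes [measurable]: "f \<in> borel_measurable (borel_fun n)" and s: "0 < s"
  shows "(\<integral>\<^sup>+ x. f x \<partial>lebesgue_fun n) = ennreal (s ^ n) * (\<integral>\<^sup>+ x. f (\<lambda>j\<in>{..<n}. s * x j) \<partial>lebesgue_fun n)"
proof -
  have "lower_map n (\<lambda>j k. if j = k then s else 0) (\<lambda>_. 0) x = (\<lambda>j\<in>{..<n}. s * x j)" for x
    by (auto simp: lower_map_def restrict_def fun_eq_iff if_distrib[of "\<lambda>a. a * _"] cong: if_cong)
  then show ?thesis
    using nn_integral_lower_map[OF assms(1), of "\<lambda>j k. if j = k then s else 0" "\<lambda>_. 0"] s by simp
qed

text \<open>
  The function \<open>h\<close>, dilated by \<open>k + 1\<close> and truncated to be bounded with bounded support. Dilating the function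
  replaces shrinking the variance of the Gaussian kernel. The window has radius \<open>(k + 1)\<^sup>2\<close>, which is of larger order than
  the dilation, so that for all \<open>v\<close> and \<open>z\<close> it eventually contains \<open>(k + 1) v + z\<close>.
\<close>

definition cutoff :: "nat \<Rightarrow> ((nat \<Rightarrow> real) \<Rightarrow> ennreal) \<Rightarrow> nat \<Rightarrow> (nat \<Rightarrow> real) \<Rightarrow> real" where
  "cutoff d h k w = enn2real (min (h (\<lambda>j\<in>{..<d}. w j / real (Suc k))) (of_nat k))
     * (if \<forall>j<d. \<bar>w j\<bar> \<le> (real (Suc k))\<^sup>2 then 1 else 0)"

definition smoothing :: "nat \<Rightarrow> ((nat \<Rightarrow> real) \<Rightarrow> ennreal) \<Rightarrow> nat \<Rightarrow> (nat \<Rightarrow> real) \<Rightarrow> real" where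
  "smoothing d h k y = blur d (cutoff d h k) y / sqrt (2 * pi) ^ d"

context
  fixes d :: nat and h :: "(nat \<Rightarrow> real) \<Rightarrow> ennreal"
  assumes h[measurable]: "h \<in> borel_measurable (borel_fun d)"
begin

lemma cutoff_measurable [measurable]: "cutoff d h k \<in> borel_measurable (borel_fun d)"
  unfolding cutoff_def[abs_def] by measurable

lemma cutoff_nonneg: "0 \<le> cutoff d h k w"
  by (simp add: cutoff_def)

lemma cutoff_le: "ennreal (cutoff d h k w) \<le> h (\<lambda>j\<in>{..<d}. w j / real (Suc k))"
proof -
  have "min x (of_nat k) < \<infinity>" for x :: ennreal by (simp add: min_less_iff_disj of_nat_less_top)
  then show ?thesis by (auto simp: cutoff_def)
qed

lemma cutoff_support: "cutoff d h k w \<noteq> 0 \<Longrightarrow> j < d \<Longrightarrow> \<bar>w j\<bar> \<le> (real (Suc k))\<^sup>2"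
  by (auto simp: cutoff_def split: if_splits)

lemma cutoff_integral:
  assumes I: "(\<integral>\<^sup>+ x. h x \<partial>lebesgue_fun d) \<le> ennreal I" and I0: "0 \<le> I"
  shows "integrable (lebesgue_fun d) (cutoff d h k)"
    "(\<integral>w. cutoff d h k w \<partial>lebesgue_fun d) \<le> real (Suc k) ^ d * I"
proof -
  have "(\<integral>\<^sup>+ w. ennreal (cutoff d h k w) \<partial>lebesgue_fun d) \<le> (\<integral>\<^sup>+ w. h (\<lambda>j\<in>{..<d}. w j / real (Suc k)) \<partial>lebesgue_fun d)"
    by (intro nn_integral_mono cutoff_le)
  also have "\<dots> = ennreal (real (Suc k) ^ d) * (\<integral>\<^sup>+ w. h (\<lambda>j\<in>{..<d}. (\<lambda>j\<in>{..<d}. real (Suc k) * w j) j / real (Suc k)) \<partial>lebesgue_fun d)"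
    by (rule nn_integral_lebesgue_fun_scale) simp_all
  also have "(\<integral>\<^sup>+ w. h (\<lambda>j\<in>{..<d}. (\<lambda>j\<in>{..<d}. real (Suc k) * w j) j / real (Suc k)) \<partial>lebesgue_fun d) = (\<integral>\<^sup>+ w. h w \<partial>lebesgue_fun d)"
  proof (intro nn_integral_cong arg_cong[where f=h])
    fix w assume "w \<in> space (lebesgue_fun d)"
    then show "(\<lambda>j\<in>{..<d}. (\<lambda>j\<in>{..<d}. real (Suc k) * w j) j / real (Suc k)) = w"
      by (auto simp: fun_eq_iff extensional_def restrict_def)
  qed
  also have "ennreal (real (Suc k) ^ d) * (\<integral>\<^sup>+ w. h w \<partial>lebesgue_fun d) \<le> ennreal (real (Suc k) ^ d) * ennreal I"
    by (intro mult_left_mono I) simp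
  also have "\<dots> = ennreal (real (Suc k) ^ d * I)" by (simp add: ennreal_mult')
  finally have le: "(\<integral>\<^sup>+ w. ennreal (cutoff d h k w) \<partial>lebesgue_fun d) \<le> ennreal (real (Suc k) ^ d * I)" .
  then have "(\<integral>\<^sup>+ w. ennreal (cutoff d h k w) \<partial>lebesgue_fun d) < \<infinity>"
    by (rule le_less_trans) simp
  then show i: "integrable (lebesgue_fun d) (cutoff d h k)"
    by (intro integrableI_nonneg) (auto simp: cutoff_nonneg)
  then show "(\<integral>w. cutoff d h k w \<partial>lebesgue_fun d) \<le> real (Suc k) ^ d * I"
    using le I0 by (simp add: nn_integral_eq_integral cutoff_nonneg)
qed

text \<open>
  The translation by \<open>y\<close> turns the kernel into the standard Gaussian density.
\<close>

lemma smoothing_eq_gauss: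
  assumes i: "integrable (lebesgue_fun d) (cutoff d h k)"
  shows "ennreal (smoothing d h k y) = (\<integral>\<^sup>+ z. ennreal (cutoff d h k (\<lambda>j\<in>{..<d}. y j + z j)) \<partial>gauss d)"
proof -
  let ?e = "\<lambda>w. exp (- (\<Sum>j<d. (w j - y j)\<^sup>2) / 2)"
  have ie: "integrable (lebesgue_fun d) (\<lambda>w. cutoff d h k w * ?e w)"
  proof (rule Bochner_Integration.integrable_bound[OF i])
    show "AE w in lebesgue_fun d. norm (cutoff d h k w * ?e w) \<le> norm (cutoff d h k w)"
      by (intro AE_I2) (auto simp: cutoff_nonneg intro!: mult_left_le sum_nonneg)
  qed measurable
  have "ennreal (sqrt (2 * pi) ^ d) * ennreal (smoothing d h k y) = ennreal (\<integral>w. cutoff d h k w * ?e w \<partial>lebesgue_fun d)"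
    by (simp add: smoothing_def blur_def ennreal_mult'[symmetric])
  also have "\<dots> = (\<integral>\<^sup>+ w. ennreal (cutoff d h k w * ?e w) \<partial>lebesgue_fun d)"
    using ie by (intro nn_integral_eq_integral[symmetric]) (auto simp: cutoff_nonneg)
  also have "\<dots> = (\<integral>\<^sup>+ z. ennreal (cutoff d h k (\<lambda>j\<in>{..<d}. y j + z j) * ?e (\<lambda>j\<in>{..<d}. y j + z j)) \<partial>lebesgue_fun d)"
    by (rule nn_integral_lebesgue_fun_translate) measurable
  also have "\<dots> = (\<integral>\<^sup>+ z. ennreal (exp (- dot d z z / 2)) * ennreal (cutoff d h k (\<lambda>j\<in>{..<d}. y j + z j)) \<partial>lebesgue_fun d)"
    by (intro nn_integral_cong) (simp add: ennreal_mult'[symmetric] cutoff_nonneg dot_def power2_eq_square mult.commute)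
  also have "\<dots> = ennreal (sqrt (2 * pi) ^ d) * (\<integral>\<^sup>+ z. ennreal (cutoff d h k (\<lambda>j\<in>{..<d}. y j + z j)) \<partial>gauss d)"
    by (rule nn_integral_gauss) measurable
  finally show ?thesis by (simp add: ennreal_mult_cancel_left)
qed

lemma smoothing_measurable [measurable]: "smoothing d h k \<in> borel_measurable (borel_fun d)"
proof -
  have "(\<lambda>(y, w). cutoff d h k w * exp (- (\<Sum>j<d. (w j - y j)\<^sup>2) / 2))
      \<in> borel_measurable ((borel_fun d) \<Otimes>\<^sub>M lebesgue_fun d)" by measurable
  then have "(\<lambda>y. \<integral>w. cutoff d h k w * exp (- (\<Sum>j<d. (w j - y j)\<^sup>2) / 2) \<partial>lebesgue_fun d) \<in> borel_measurable (borel_fun d)"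
    by (rule lebesgue_fun.borel_measurable_lebesgue_integral)
  then show ?thesis unfolding smoothing_def[abs_def] blur_def by measurable
qed

lemma smoothing_nonneg: "0 \<le> smoothing d h k y"
  unfolding smoothing_def blur_def by (intro divide_nonneg_nonneg integral_nonneg_AE AE_I2) (auto simp: cutoff_nonneg)

text \<open>
  At the point \<open>(k + 1) v\<close> the smoothing is an average of truncated values of \<open>h\<close> at \<open>v + z / (k + 1)\<close>, and these points
  converge to \<open>v\<close>. Lower semicontinuity handles each \<open>z\<close>, and Fatou's lemma the average.
\<close>

lemma smoothing_liminf:
  assumes i: "\<And>k. integrable (lebesgue_fun d) (cutoff d h k)"
    and lsc: "\<And>x u. x \<in> extensional {..<d} \<Longrightarrow> (\<And>k. u k \<in> extensional {..<d}) \<Longrightarrow>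
        (\<And>j. j < d \<Longrightarrow> (\<lambda>k. u k j) \<longlonglongrightarrow> x j) \<Longrightarrow> h x \<le> liminf (\<lambda>k. h (u k))"
    and v: "v \<in> extensional {..<d}"
  shows "h v \<le> liminf (\<lambda>k. ennreal (smoothing d h k (\<lambda>j. real (Suc k) * v j)))"
proof -
  have pt: "h v \<le> liminf (\<lambda>k. ennreal (cutoff d h k (\<lambda>j\<in>{..<d}. real (Suc k) * v j + z j)))" for z
    unfolding le_Liminf_iff
  proof (intro allI impI)
    fix a assume a: "a < h v"
    define u where "u = (\<lambda>k. \<lambda>j\<in>{..<d}. (real (Suc k) * v j + z j) / real (Suc k))"
    have "(\<lambda>k. u k j) \<longlonglongrightarrow> v j" if "j < d" for j
    proof -
      have "(\<lambda>k. v j + z j * inverse (real (Suc k))) \<longlonglongrightarrow> v j + z j * 0"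
        by (intro tendsto_intros LIMSEQ_inverse_real_of_nat)
      moreover have "u k j = v j + z j * inverse (real (Suc k))" for k
        using that by (simp add: u_def field_simps)
      ultimately show ?thesis by simp
    qed
    then have "h v \<le> liminf (\<lambda>k. h (u k))" by (intro lsc v) (auto simp: u_def)
    then have e1: "eventually (\<lambda>k. a < h (u k)) sequentially"
      using a unfolding le_Liminf_iff by blast
    have "a \<noteq> \<infinity>" using a by auto
    then obtain N :: nat where "a < of_nat N" using ennreal_Ex_less_of_nat[of a] by (auto simp: less_top)
    then have e2: "eventually (\<lambda>k. a < of_nat k) sequentially"
      unfolding eventually_sequentially by (meson less_le_trans of_nat_mono)
    have "eventually (\<lambda>k. \<forall>j\<in>{..<d}. \<bar>v j\<bar> + \<bar>z j\<bar> \<le> real (Suc k)) sequentially"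
    proof (intro eventually_ball_finite ballI)
      fix j
      obtain N :: nat where "\<bar>v j\<bar> + \<bar>z j\<bar> \<le> real N" using real_arch_simple by blast
      then show "eventually (\<lambda>k. \<bar>v j\<bar> + \<bar>z j\<bar> \<le> real (Suc k)) sequentially"
        unfolding eventually_sequentially by (intro exI[of _ N]) auto
    qed simp
    with e1 e2 show "eventually (\<lambda>k. a < ennreal (cutoff d h k (\<lambda>j\<in>{..<d}. real (Suc k) * v j + z j))) sequentially"
    proof eventually_elim
      case (elim k)
      have "\<bar>real (Suc k) * v j + z j\<bar> \<le> (real (Suc k))\<^sup>2" if j: "j < d" for j
      proof -
        have "\<bar>real (Suc k) * v j + z j\<bar> \<le> real (Suc k) * \<bar>v j\<bar> + \<bar>z j\<bar>"
          by (rule order_trans[OF abs_triangle_ineq]) (simp add: abs_mult)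
        also have "\<dots> \<le> real (Suc k) * (\<bar>v j\<bar> + \<bar>z j\<bar>)" by (simp add: distrib_left mult_le_cancel_right1)
        also have "\<dots> \<le> real (Suc k) * real (Suc k)" using elim(3) j by (intro mult_left_mono) auto
        finally show ?thesis by (simp add: power2_eq_square)
      qed
      then have "cutoff d h k (\<lambda>j\<in>{..<d}. real (Suc k) * v j + z j) = enn2real (min (h (u k)) (of_nat k))"
        by (simp add: cutoff_def u_def cong: restrict_cong)
      moreover have "min (h (u k)) (of_nat k) < \<infinity>" by (simp add: min_less_iff_disj of_nat_less_top)
      ultimately show ?case using elim by simp
    qed
  qed
  have "h v = (\<integral>\<^sup>+ z. h v \<partial>gauss d)" by (simp add: gauss.emeasure_space_1[simplified])
  also have "\<dots> \<le> (\<integral>\<^sup>+ z. liminf (\<lambda>k. ennreal (cutoff d h k (\<lambda>j\<in>{..<d}. real (Suc k) * v j + z j))) \<partial>gauss d)"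
    by (intro nn_integral_mono pt)
  also have "\<dots> \<le> liminf (\<lambda>k. \<integral>\<^sup>+ z. ennreal (cutoff d h k (\<lambda>j\<in>{..<d}. real (Suc k) * v j + z j)) \<partial>gauss d)"
    by (rule nn_integral_liminf) measurable
  also have "\<dots> = liminf (\<lambda>k. ennreal (smoothing d h k (\<lambda>j. real (Suc k) * v j)))"
    by (simp add: smoothing_eq_gauss[OF i])
  finally show ?thesis .
qed

end

context geometric_datum
begin

text \<open>
  Replace \<open>g i\<close> by a lower semicontinuous majorant \<open>h i\<close> whose integral is larger by at most \<open>\<delta>\<close>, bound the product from
  above by the lower limit of the products of smoothings, and apply \<open>smoothed_inequality\<close> to these. The
  dilations by \<open>s = k + 1\<close> cancel: the substitution on the left-hand side produces \<open>(1 / s) ^ n\<close> and the integrals of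
  the cutoffs produce \<open>\<Prod>\<^sub>i (s ^ d i) powr c i\<close>, whose product is 1 because of \<open>dims\<close>; so do the powers of \<open>2 * pi\<close>. The
  functions \<open>f i\<close> are real-valued, whereas the Borel majorants \<open>g i\<close> may take the value \<open>\<infinity>\<close>, which allows them to
  absorb null sets.
\<close>

theorem geometric_brascamp_lieb:
  fixes f :: "nat \<Rightarrow> (nat \<Rightarrow> real) \<Rightarrow> real" and g :: "nat \<Rightarrow> (nat \<Rightarrow> real) \<Rightarrow> ennreal"
  assumes f0: "\<And>i x. i < m \<Longrightarrow> x \<in> extensional {..<d i} \<Longrightarrow> 0 \<le> f i x"
    and g: "\<And>i. i < m \<Longrightarrow> g i \<in> borel_measurable (borel_fun (d i))"
    and fg: "\<And>i x. i < m \<Longrightarrow> x \<in> extensional {..<d i} \<Longrightarrow> ennreal (f i x) \<le> g i x"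
    and I: "\<And>i. i < m \<Longrightarrow> (\<integral>\<^sup>+ x. g i x \<partial>lebesgue_fun (d i)) \<le> ennreal (I i)" "\<And>i. i < m \<Longrightarrow> 0 \<le> I i"
  shows "(\<integral>\<^sup>+ x. ennreal (\<Prod>i<m. f i (lin (d i) n (Q i) x) powr c i) \<partial>lebesgue_fun n)
    \<le> ennreal (\<Prod>i<m. I i powr c i)"
proof -
  have main: "(\<integral>\<^sup>+ x. ennreal (\<Prod>i<m. f i (lin (d i) n (Q i) x) powr c i) \<partial>lebesgue_fun n)
    \<le> ennreal (\<Prod>i<m. (I i + \<delta>) powr c i)" if \<delta>: "0 < \<delta>" for \<delta>
  proof -
    define P where "P = (\<lambda>i h. h \<in> borel_measurable (borel_fun (d i)) \<and> (\<forall>x\<in>extensional {..<d i}. g i x \<le> h x) \<and>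
      (\<integral>\<^sup>+ x. h x \<partial>lebesgue_fun (d i)) \<le> ennreal (I i + \<delta>) \<and>
      (\<forall>x u. x \<in> extensional {..<d i} \<longrightarrow> (\<forall>k. u k \<in> extensional {..<d i}) \<longrightarrow>
        (\<forall>j<d i. (\<lambda>k. u k j) \<longlonglongrightarrow> x j) \<longrightarrow> h x \<le> liminf (\<lambda>k. h (u k))))"
    have "\<exists>h. P i h" if i: "i < m" for i
    proof (rule lsc_majorant[OF g[OF i] \<delta>])
      fix h assume h: "h \<in> borel_measurable (borel_fun (d i))" "\<And>x. x \<in> extensional {..<d i} \<Longrightarrow> g i x \<le> h x"
        "(\<integral>\<^sup>+ x. h x \<partial>lebesgue_fun (d i)) \<le> (\<integral>\<^sup>+ x. g i x \<partial>lebesgue_fun (d i)) + ennreal \<delta>"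
        "\<And>x u. x \<in> extensional {..<d i} \<Longrightarrow> (\<And>k. u k \<in> extensional {..<d i}) \<Longrightarrow>
           (\<And>j. j < d i \<Longrightarrow> (\<lambda>k. u k j) \<longlonglongrightarrow> x j) \<Longrightarrow> h x \<le> liminf (\<lambda>k. h (u k))"
      have "(\<integral>\<^sup>+ x. h x \<partial>lebesgue_fun (d i)) \<le> ennreal (I i) + ennreal \<delta>"
        by (rule order_trans[OF h(3) add_right_mono[OF I(1)[OF i]]])
      then have "(\<integral>\<^sup>+ x. h x \<partial>lebesgue_fun (d i)) \<le> ennreal (I i + \<delta>)" using I(2)[OF i] \<delta> by simp
      with h show ?thesis unfolding P_def by (intro exI[of _ h]) blast
    qed
    then obtain h where P: "\<And>i. i < m \<Longrightarrow> P i (h i)" by metis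
    have hm: "\<And>i. i < m \<Longrightarrow> h i \<in> borel_measurable (borel_fun (d i))"
      and gh: "\<And>i x. i < m \<Longrightarrow> x \<in> extensional {..<d i} \<Longrightarrow> g i x \<le> h i x"
      and hI: "\<And>i. i < m \<Longrightarrow> (\<integral>\<^sup>+ x. h i x \<partial>lebesgue_fun (d i)) \<le> ennreal (I i + \<delta>)"
      using P by (simp_all add: P_def)
    have lsc: "h i x \<le> liminf (\<lambda>k. h i (u k))" if "i < m" "x \<in> extensional {..<d i}"
      "\<And>k. u k \<in> extensional {..<d i}" "\<And>j. j < d i \<Longrightarrow> (\<lambda>k. u k j) \<longlonglongrightarrow> x j" for i x u
      using P[OF that(1)] that(2-4) unfolding P_def by blast
    have I\<delta>: "0 \<le> I i + \<delta>" if "i < m" for i using I(2)[OF that] \<delta> by simp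
    note ci = cutoff_integral[OF hm hI I\<delta>]
    define F where "F = (\<lambda>i k x. smoothing (d i) (h i) k (\<lambda>j. real (Suc k) * lin (d i) n (Q i) x j))"
    have F_eq: "F i k x = smoothing (d i) (h i) k (lin (d i) n (Q i) (\<lambda>j. real (Suc k) * x j))" for i k x
    proof -
      have "real (Suc k) * lin (d i) n (Q i) x j = lin (d i) n (Q i) (\<lambda>j. real (Suc k) * x j) j" if "j < d i" for j
        using that by (simp add: lin_def dot_def sum_distrib_left mult.left_commute)
      then show ?thesis unfolding F_def smoothing_def blur_def by simp
    qed
    have F0: "0 \<le> F i k x" if "i < m" for i k x unfolding F_def by (rule smoothing_nonneg[OF hm[OF that]])
    have Fm: "F i k \<in> borel_measurable (borel_fun n)" if i: "i < m" for i k
    proof -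
      have "(\<lambda>x. smoothing (d i) (h i) k (\<lambda>j\<in>{..<d i}. real (Suc k) * lin (d i) n (Q i) x j)) \<in> borel_measurable (borel_fun n)"
      proof (rule measurable_compose[OF _ smoothing_measurable[OF hm[OF i]]], rule measurable_restrict_fun)
        fix j
        have "(\<lambda>x. lin (d i) n (Q i) x j) \<in> borel_measurable (borel_fun n)"
          by (rule measurable_compose[OF measurable_lin measurable_coord])
        then show "(\<lambda>x. real (Suc k) * lin (d i) n (Q i) x j) \<in> borel_measurable (borel_fun n)"
          by (rule borel_measurable_times[OF borel_measurable_const])
      qed
      moreover have "smoothing (d i) (h i) k (\<lambda>j\<in>{..<d i}. real (Suc k) * lin (d i) n (Q i) x j) = F i k x" for x
        unfolding F_def smoothing_def blur_def by simp
      ultimately show ?thesis by simp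
    qed
    have bound: "(\<integral>\<^sup>+ x. ennreal (\<Prod>i<m. F i k x powr c i) \<partial>lebesgue_fun n) \<le> ennreal (\<Prod>i<m. (I i + \<delta>) powr c i)" for k
    proof -
      define s where "s = real (Suc k)"
      have s: "0 < s" by (simp add: s_def)
      let ?J = "\<lambda>i. \<integral>w. cutoff (d i) (h i) k w \<partial>lebesgue_fun (d i)"
      let ?A = "\<lambda>i x. blur (d i) (cutoff (d i) (h i) k) (lin (d i) n (Q i) x)"
      \<comment> \<open>The normalising factors of the Gaussian kernels; their product is that of the Gaussian weight on \<open>n\<close>-space.\<close>
      define Z where "Z = (\<Prod>i<m. (sqrt (2 * pi) ^ d i) powr c i)"
      have Z: "Z = sqrt (2 * pi) ^ n"
      proof -
        have "Z = (\<Prod>i<m. sqrt (2 * pi) powr (c i * real (d i)))"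
          unfolding Z_def by (intro prod.cong refl) (simp add: powr_realpow[symmetric] powr_powr mult.commute)
        also have "\<dots> = sqrt (2 * pi) powr (\<Sum>i<m. c i * real (d i))" by (simp add: powr_sum)
        finally show ?thesis by (simp add: dims powr_realpow)
      qed
      have "(\<integral>\<^sup>+ x. ennreal (\<Prod>i<m. F i k x powr c i) \<partial>lebesgue_fun n)
        = ennreal ((1 / s) ^ n) * (\<integral>\<^sup>+ x. ennreal (\<Prod>i<m. F i k (\<lambda>j\<in>{..<n}. 1 / s * x j) powr c i) \<partial>lebesgue_fun n)"
      proof (rule nn_integral_lebesgue_fun_scale)
        have "(\<lambda>x. \<Prod>i<m. F i k x powr c i) \<in> borel_measurable (borel_fun n)"
          using Fm by (intro borel_measurable_prod) auto
        then show "(\<lambda>x. ennreal (\<Prod>i<m. F i k x powr c i)) \<in> borel_measurable (borel_fun n)" by simp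
      qed (use s in simp)
      also have "(\<lambda>x. \<Prod>i<m. F i k (\<lambda>j\<in>{..<n}. 1 / s * x j) powr c i) = (\<lambda>x. \<Prod>i<m. (?A i x / sqrt (2 * pi) ^ d i) powr c i)"
      proof (intro ext prod.cong refl)
        fix x i
        have "lin (d i) n (Q i) (\<lambda>j. real (Suc k) * (\<lambda>j\<in>{..<n}. 1 / s * x j) j) = lin (d i) n (Q i) x"
          unfolding lin_def using s by (intro restrict_ext dot_cong) (auto simp: s_def)
        then show "F i k (\<lambda>j\<in>{..<n}. 1 / s * x j) powr c i = (?A i x / sqrt (2 * pi) ^ d i) powr c i"
          unfolding F_eq by (simp add: smoothing_def)
      qed
      also have "(\<lambda>x. \<Prod>i<m. (?A i x / sqrt (2 * pi) ^ d i) powr c i) = (\<lambda>x. inverse Z * (\<Prod>i<m. ?A i x powr c i))"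
      proof
        fix x
        have "(\<Prod>i<m. (?A i x / sqrt (2 * pi) ^ d i) powr c i) = (\<Prod>i<m. ?A i x powr c i / (sqrt (2 * pi) ^ d i) powr c i)"
          by (intro prod.cong refl powr_divide)
        then show "(\<Prod>i<m. (?A i x / sqrt (2 * pi) ^ d i) powr c i) = inverse Z * (\<Prod>i<m. ?A i x powr c i)"
          by (simp add: prod_dividef Z_def field_simps)
      qed
      also have "(\<integral>\<^sup>+ x. ennreal (inverse Z * (\<Prod>i<m. ?A i x powr c i)) \<partial>lebesgue_fun n)
         = ennreal (inverse Z) * (\<integral>\<^sup>+ x. ennreal (\<Prod>i<m. ?A i x powr c i) \<partial>lebesgue_fun n)"
      proof -
        have "(\<lambda>x. \<Prod>i<m. ?A i x powr c i) \<in> borel_measurable (lebesgue_fun n)"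
        proof (intro borel_measurable_prod)
          fix i assume "i \<in> {..<m}"
          then have i: "i < m" by simp
          have "(\<lambda>x. sqrt (2 * pi) ^ d i * smoothing (d i) (h i) k (lin (d i) n (Q i) x)) \<in> borel_measurable (lebesgue_fun n)"
            using measurable_compose[OF measurable_lin smoothing_measurable[OF hm[OF i]]] by simp
          then have "?A i \<in> borel_measurable (lebesgue_fun n)" by (simp add: smoothing_def)
          then show "(\<lambda>x. ?A i x powr c i) \<in> borel_measurable (lebesgue_fun n)" by simp
        qed
        then show ?thesis unfolding Z by (simp add: ennreal_mult' nn_integral_cmult)
      qed
      finally have eq: "(\<integral>\<^sup>+ x. ennreal (\<Prod>i<m. F i k x powr c i) \<partial>lebesgue_fun n)
        = ennreal ((1 / s) ^ n) * (ennreal (inverse Z) * (\<integral>\<^sup>+ x. ennreal (\<Prod>i<m. ?A i x powr c i) \<partial>lebesgue_fun n))" .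
      have "(\<integral>\<^sup>+ x. ennreal (\<Prod>i<m. ?A i x powr c i) \<partial>lebesgue_fun n) \<le> ennreal (sqrt (2 * pi) ^ n * (\<Prod>i<m. ?J i powr c i))"
      proof (rule smoothed_inequality[where K="(real (Suc k))\<^sup>2"])
        fix i w assume i: "i < m"
        show "cutoff (d i) (h i) k \<in> borel_measurable (borel_fun (d i))" by (rule cutoff_measurable[OF hm[OF i]])
        show "0 \<le> cutoff (d i) (h i) k w" by (rule cutoff_nonneg[OF hm[OF i]])
        show "integrable (lebesgue_fun (d i)) (cutoff (d i) (h i) k)" by (rule ci(1)[OF i i i])
        show "\<bar>w j\<bar> \<le> (real (Suc k))\<^sup>2" if "cutoff (d i) (h i) k w \<noteq> 0" "j < d i" for j
          by (rule cutoff_support[OF hm[OF i] that])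
      qed simp
      then have "(\<integral>\<^sup>+ x. ennreal (\<Prod>i<m. F i k x powr c i) \<partial>lebesgue_fun n)
        \<le> ennreal ((1 / s) ^ n) * (ennreal (inverse Z) * ennreal (sqrt (2 * pi) ^ n * (\<Prod>i<m. ?J i powr c i)))"
        unfolding eq by (intro mult_left_mono) auto
      also have "\<dots> = ennreal ((1 / s) ^ n * (\<Prod>i<m. ?J i powr c i))"
        unfolding Z using s by (simp add: ennreal_mult'[symmetric] prod_nonneg)
      also have "\<dots> \<le> ennreal ((1 / s) ^ n * (\<Prod>i<m. (s ^ d i * (I i + \<delta>)) powr c i))"
      proof (intro ennreal_leI mult_left_mono prod_mono conjI)
        fix i assume "i \<in> {..<m}"
        then have i: "i < m" by simp
        have "0 \<le> ?J i" using cutoff_nonneg[OF hm[OF i]] by (intro integral_nonneg_AE AE_I2) simp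
        then show "?J i powr c i \<le> (s ^ d i * (I i + \<delta>)) powr c i"
          using ci(2)[OF i i i, of k] c_pos[OF i] by (intro powr_mono2) (auto simp: s_def)
      qed (use s in auto)
      also have "(1 / s) ^ n * (\<Prod>i<m. (s ^ d i * (I i + \<delta>)) powr c i) = (\<Prod>i<m. (I i + \<delta>) powr c i)"
      proof -
        have "(\<Prod>i<m. (s ^ d i * (I i + \<delta>)) powr c i) = (\<Prod>i<m. s powr (c i * real (d i)) * (I i + \<delta>) powr c i)"
          using s I\<delta> by (intro prod.cong refl) (simp add: powr_mult powr_realpow[symmetric] powr_powr mult.commute)
        also have "\<dots> = s ^ n * (\<Prod>i<m. (I i + \<delta>) powr c i)"
          using s by (simp add: prod.distrib powr_sum[symmetric] dims powr_realpow)
        finally show ?thesis using s by (simp add: power_one_over)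
      qed
      finally show ?thesis .
    qed
    have "(\<integral>\<^sup>+ x. ennreal (\<Prod>i<m. f i (lin (d i) n (Q i) x) powr c i) \<partial>lebesgue_fun n)
      \<le> (\<integral>\<^sup>+ x. liminf (\<lambda>k. ennreal (\<Prod>i<m. F i k x powr c i)) \<partial>lebesgue_fun n)"
    proof (intro nn_integral_mono prod_powr_le_liminf)
      fix x i assume i: "i < m"
      have e: "lin (d i) n (Q i) x \<in> extensional {..<d i}" by (simp add: lin_def)
      show "0 \<le> f i (lin (d i) n (Q i) x)" by (rule f0[OF i e])
      show "0 \<le> c i" using c_pos[OF i] by simp
      have "ennreal (f i (lin (d i) n (Q i) x)) \<le> h i (lin (d i) n (Q i) x)"
        using fg[OF i e] gh[OF i e] by (rule order_trans)
      also have "\<dots> \<le> liminf (\<lambda>k. ennreal (F i k x))"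
        unfolding F_def by (rule smoothing_liminf[OF hm[OF i] ci(1)[OF i i i] lsc[OF i] e])
      finally show "ennreal (f i (lin (d i) n (Q i) x)) \<le> liminf (\<lambda>k. ennreal (F i k x))" .
    qed
    also have "\<dots> \<le> liminf (\<lambda>k. \<integral>\<^sup>+ x. ennreal (\<Prod>i<m. F i k x powr c i) \<partial>lebesgue_fun n)"
    proof (rule nn_integral_liminf)
      fix k
      have "(\<lambda>x. \<Prod>i<m. F i k x powr c i) \<in> borel_measurable (borel_fun n)"
        using Fm by (intro borel_measurable_prod) auto
      then show "(\<lambda>x. ennreal (\<Prod>i<m. F i k x powr c i)) \<in> borel_measurable (lebesgue_fun n)"
        by simp
    qed
    also have "\<dots> \<le> ennreal (\<Prod>i<m. (I i + \<delta>) powr c i)"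
      using bound by (intro Liminf_le) (auto intro: always_eventually)
    finally show ?thesis .
  qed
  have "(\<lambda>N. I i + inverse (real (Suc N))) \<longlonglongrightarrow> I i + 0" for i
    by (intro tendsto_add tendsto_const LIMSEQ_inverse_real_of_nat)
  then have "(\<lambda>N. ennreal (\<Prod>i<m. (I i + inverse (real (Suc N))) powr c i)) \<longlonglongrightarrow> ennreal (\<Prod>i<m. (I i + 0) powr c i)"
    using c_pos I(2) by (intro tendsto_ennrealI tendsto_prod tendsto_powr2 tendsto_const) (auto intro!: add_nonneg_nonneg)
  then have "(\<integral>\<^sup>+ x. ennreal (\<Prod>i<m. f i (lin (d i) n (Q i) x) powr c i) \<partial>lebesgue_fun n)
    \<le> ennreal (\<Prod>i<m. (I i + 0) powr c i)"
    by (rule LIMSEQ_le_const) (auto intro!: main)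
  then show ?thesis by simp
qed

end

section \<open>Cholesky factorisation\<close>

lemma lower_triangular_solve:
  fixes L :: "nat \<Rightarrow> nat \<Rightarrow> real"
  assumes "\<And>j. j < n \<Longrightarrow> L j j \<noteq> 0"
  shows "\<exists>l. \<forall>j<n. (\<Sum>k\<le>j. L j k * l k) = b j"
  using assms
proof (induction n)
  case (Suc n)
  then obtain l where l: "\<forall>j<n. (\<Sum>k\<le>j. L j k * l k) = b j" by auto
  let ?l = "l(n := (b n - (\<Sum>k<n. L n k * l k)) / L n n)"
  have "(\<Sum>k\<le>j. L j k * ?l k) = b j" if "j < Suc n" for j
  proof (cases "j = n")
    case True
    have "(\<Sum>k\<le>n. L n k * ?l k) = (\<Sum>k<n. L n k * l k) + L n n * ?l n"
      by (simp add: lessThan_Suc_atMost[symmetric])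
    then show ?thesis using True Suc.prems[of n] by simp
  next
    case False
    then have "(\<Sum>k\<le>j. L j k * ?l k) = (\<Sum>k\<le>j. L j k * l k)" using that by (intro sum.cong) auto
    then show ?thesis using l False that by simp
  qed
  then show ?case by blast
qed simp

lemma upper_triangular_solve:
  fixes L :: "nat \<Rightarrow> nat \<Rightarrow> real"
  assumes "\<And>j. j < n \<Longrightarrow> L j j \<noteq> 0" and "\<And>j k. j < k \<Longrightarrow> k < n \<Longrightarrow> L j k = 0"
  shows "\<exists>y. \<forall>k<n. (\<Sum>j<n. L j k * y j) = b k"
  using assms
proof (induction n arbitrary: b)
  case (Suc n)
  have "\<exists>y. \<forall>k<n. (\<Sum>j<n. L j k * y j) = b k - L n k * (b n / L n n)"
    by (rule Suc.IH) (use Suc.prems in auto)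
  then obtain y where y: "\<forall>k<n. (\<Sum>j<n. L j k * y j) = b k - L n k * (b n / L n n)"
    by blast
  let ?y = "y(n := b n / L n n)"
  have "(\<Sum>j<Suc n. L j k * ?y j) = b k" if "k < Suc n" for k
  proof (cases "k = n")
    case True
    have "(\<Sum>j<n. L j n * y j) = 0" using Suc.prems(2) by (intro sum.neutral) auto
    then show ?thesis using True Suc.prems(1)[of n] by simp
  next
    case False
    then show ?thesis using y that by simp
  qed
  then show ?case by blast
qed simp

text \<open>
  Induction on the size. The new row \<open>l\<close> is determined by forward substitution, and its diagonal entry is the
  square root of \<open>q = a n n - \<bar>l\<bar>\<^sup>2\<close>. This is positive because it is the value of the quadratic form at \<open>(y, 1)\<close>, where
  \<open>y\<close> solves \<open>L\<^sup>T y = - l\<close>.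
\<close>

lemma cholesky_entries:
  fixes a :: "nat \<Rightarrow> nat \<Rightarrow> real"
  assumes "\<And>j k. j < n \<Longrightarrow> k < n \<Longrightarrow> a j k = a k j"
    and "\<And>x. \<exists>j<n. x j \<noteq> 0 \<Longrightarrow> 0 < (\<Sum>j<n. \<Sum>k<n. x j * (a j k * x k))"
  shows "\<exists>L. (\<forall>j<n. 0 < L j j) \<and> (\<forall>j k. j < k \<longrightarrow> L j k = 0) \<and>
    (\<forall>j<n. \<forall>k<n. a j k = (\<Sum>i<n. L j i * L k i))"
  using assms
proof (induction n)
  case 0
  show ?case by (intro exI[of _ "\<lambda>_ _. 0"]) auto
next
  case (Suc n)
  have "\<exists>L. (\<forall>j<n. 0 < L j j) \<and> (\<forall>j k. j < k \<longrightarrow> L j k = 0) \<and>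
    (\<forall>j<n. \<forall>k<n. a j k = (\<Sum>i<n. L j i * L k i))"
  proof (rule Suc.IH)
    show "a j k = a k j" if "j < n" "k < n" for j k using Suc.prems(1) that by simp
    fix x :: "nat \<Rightarrow> real" assume "\<exists>j<n. x j \<noteq> 0"
    then have "\<exists>j<Suc n. (x(n := 0)) j \<noteq> 0" by (auto intro: less_SucI)
    from Suc.prems(2)[OF this] show "0 < (\<Sum>j<n. \<Sum>k<n. x j * (a j k * x k))" by simp
  qed
  then obtain L where L: "\<And>j. j < n \<Longrightarrow> 0 < L j j" "\<And>j k. j < k \<Longrightarrow> L j k = 0"
    "\<And>j k. j < n \<Longrightarrow> k < n \<Longrightarrow> a j k = (\<Sum>i<n. L j i * L k i)" by blast
  have "\<exists>l. \<forall>j<n. (\<Sum>k\<le>j. L j k * l k) = a j n"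
    by (rule lower_triangular_solve) (use L(1) in force)
  then obtain l where l: "\<And>j. j < n \<Longrightarrow> (\<Sum>k\<le>j. L j k * l k) = a j n" by blast
  have l': "(\<Sum>k<n. L j k * l k) = a j n" if j: "j < n" for j
  proof -
    have "(\<Sum>k<n. L j k * l k) = (\<Sum>k\<le>j. L j k * l k)"
      using j L(2) by (intro sum.mono_neutral_right) auto
    then show ?thesis using l[OF j] by simp
  qed
  have "\<exists>y. \<forall>k<n. (\<Sum>j<n. L j k * y j) = - l k"
    by (rule upper_triangular_solve) (use L in force)+
  then obtain y where y: "\<And>k. k < n \<Longrightarrow> (\<Sum>j<n. L j k * y j) = - l k" by blast
  \<comment> \<open>The square of the diagonal entry that the new row needs.\<close>
  define q where "q = a n n - (\<Sum>k<n. (l k)\<^sup>2)"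
  have "0 < q"
  proof -
    let ?x = "y(n := 1)"
    have "0 < (\<Sum>j<Suc n. \<Sum>k<Suc n. ?x j * (a j k * ?x k))"
      by (rule Suc.prems(2)) (auto intro!: exI[of _ n])
    also have "\<dots> = (\<Sum>j<n. \<Sum>k<n. y j * (a j k * y k)) + (\<Sum>j<n. y j * a j n) + ((\<Sum>k<n. a n k * y k) + a n n)"
      by (simp add: sum.distrib)
    also have "(\<Sum>k<n. a n k * y k) = (\<Sum>j<n. y j * a j n)"
      using Suc.prems(1) by (intro sum.cong) (auto simp: mult.commute)
    also have "(\<Sum>j<n. y j * a j n) = (\<Sum>j<n. \<Sum>k<n. l k * (L j k * y j))"
      by (intro sum.cong refl) (simp add: l'[symmetric] sum_distrib_left mult_ac)
    also have "\<dots> = (\<Sum>k<n. l k * (\<Sum>j<n. L j k * y j))"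
      by (subst sum.swap) (simp add: sum_distrib_left)
    also have "\<dots> = - (\<Sum>k<n. (l k)\<^sup>2)"
      by (simp add: y power2_eq_square sum_negf)
    also have "(\<Sum>j<n. \<Sum>k<n. y j * (a j k * y k)) = (\<Sum>j<n. \<Sum>k<n. \<Sum>i<n. (L j i * y j) * (L k i * y k))"
      by (intro sum.cong refl) (simp add: L(3) sum_distrib_left sum_distrib_right mult_ac)
    also have "\<dots> = (\<Sum>j<n. \<Sum>i<n. \<Sum>k<n. (L j i * y j) * (L k i * y k))"
      by (intro sum.cong refl sum.swap)
    also have "\<dots> = (\<Sum>i<n. \<Sum>j<n. \<Sum>k<n. (L j i * y j) * (L k i * y k))"
      by (rule sum.swap)
    also have "\<dots> = (\<Sum>i<n. (l i)\<^sup>2)"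
    proof (intro sum.cong refl)
      fix i assume "i \<in> {..<n}"
      then have "(\<Sum>j<n. L j i * y j) * (\<Sum>k<n. L k i * y k) = (l i)\<^sup>2" by (simp add: y power2_eq_square)
      then show "(\<Sum>j<n. \<Sum>k<n. (L j i * y j) * (L k i * y k)) = (l i)\<^sup>2" by (simp add: sum_product)
    qed
    finally show ?thesis by (simp add: q_def)
  qed
  define L' where "L' = (\<lambda>j k. if j < n then L j k else if k < n then l k else if k = n \<and> j = n then sqrt q else 0)"
  have "L' j i = 0" if "j < i" for i j
    using that L(2) by (auto simp: L'_def)
  moreover have "0 < L' j j" if "j < Suc n" for j
    using that L(1) \<open>0 < q\<close> by (auto simp: L'_def less_Suc_eq)
  moreover have "a j k = (\<Sum>i<Suc n. L' j i * L' k i)" if jk: "j < Suc n" "k < Suc n" for j k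
  proof -
    consider "j < n" "k < n" | "j < n" "k = n" | "j = n" "k < n" | "j = n" "k = n" using jk by linarith
    then show ?thesis
    proof cases
      case 1
      then show ?thesis using L(2,3) by (simp add: L'_def)
    next
      case 2
      then show ?thesis using L(2) l' by (simp add: L'_def)
    next
      case 3
      then show ?thesis using L(2) l' Suc.prems(1)[of j k] by (simp add: L'_def mult.commute)
    next
      case 4
      then show ?thesis using \<open>0 < q\<close> by (simp add: L'_def q_def power2_eq_square)
    qed
  qed
  ultimately show ?case by (intro exI[of _ L']) blast
qed

lemma inv_mat_eqI:
  assumes A: "A \<in> carrier_mat n n" and B: "B \<in> carrier_mat n n" and AB: "A * B = 1\<^sub>m n" "B * A = 1\<^sub>m n"
  shows "inv_mat A = B"
proof (cases "mat_inverse A")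
  case None
  have "A \<in> Units (ring_mat TYPE(real) n ())"
    using A B AB by (auto simp: Units_def ring_mat_def)
  with mat_inverse(1)[OF A None, of "()"] show ?thesis by simp
next
  case (Some C)
  from mat_inverse(2)[OF A Some] have C: "A * C = 1\<^sub>m n" "C * A = 1\<^sub>m n" "C \<in> carrier_mat n n" by auto
  have "C = C * (A * B)" using C AB by simp
  also have "\<dots> = (C * A) * B" by (rule assoc_mult_mat[symmetric, OF C(3) A B])
  also have "\<dots> = B" using C B by simp
  finally show ?thesis by (simp add: inv_mat_def Some)
qed

text \<open>
  The inverse \<open>K\<close> of the factor is carried along because the quadratic form of \<open>A\<^sup>-\<^sup>1\<close> is \<open>\<bar>K x\<bar>\<^sup>2\<close>.
\<close>

definition is_cholesky :: "nat \<Rightarrow> real mat \<Rightarrow> real mat \<Rightarrow> real mat \<Rightarrow> bool" where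
  "is_cholesky n A L K \<longleftrightarrow> L \<in> carrier_mat n n \<and> K \<in> carrier_mat n n \<and>
     (\<forall>j<n. 0 < L $$ (j, j)) \<and> (\<forall>j k. j < k \<longrightarrow> k < n \<longrightarrow> L $$ (j, k) = 0) \<and>
     A = L * transpose_mat L \<and> L * K = 1\<^sub>m n \<and> K * L = 1\<^sub>m n"

lemma scalar_prod_mult_mat_vec_eq:
  assumes "A \<in> carrier_mat n n" "x \<in> carrier_vec n"
  shows "scalar_prod x (A *\<^sub>v x) = (\<Sum>j<n. \<Sum>k<n. vec_index x j * (A $$ (j, k) * vec_index x k))"
  using assms by (simp add: scalar_prod_def sum_distrib_left lessThan_atLeast0 row_def)

lemma det_lower_triangular_eq:
  assumes "L \<in> carrier_mat n n" "\<And>j k. j < k \<Longrightarrow> k < n \<Longrightarrow> L $$ (j, k) = 0"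
  shows "Determinant.det L = (\<Prod>j<n. L $$ (j, j))"
  using det_lower_triangular[OF assms(2) assms(1)] assms(1)
  by (simp add: prod_list_diag_prod lessThan_atLeast0)

lemma cholesky_exists:
  assumes A: "symmetric_pos_def n A"
  obtains L K where "is_cholesky n A L K"
proof -
  have Ac: "A \<in> carrier_mat n n" and sym: "transpose_mat A = A"
    and pos: "\<And>x. x \<in> carrier_vec n \<Longrightarrow> x \<noteq> 0\<^sub>v n \<Longrightarrow> 0 < scalar_prod x (A *\<^sub>v x)"
    using A by (auto simp: symmetric_pos_def_def)
  have "\<exists>L. (\<forall>j<n. 0 < L j j) \<and> (\<forall>j k. j < k \<longrightarrow> L j k = 0) \<and>
    (\<forall>j<n. \<forall>k<n. A $$ (j, k) = (\<Sum>i<n. L j i * L k i))"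
  proof (rule cholesky_entries)
    show "A $$ (j, k) = A $$ (k, j)" if "j < n" "k < n" for j k
      using that Ac arg_cong[OF sym, of "\<lambda>M. M $$ (k, j)"] by simp
    fix x :: "nat \<Rightarrow> real" assume "\<exists>j<n. x j \<noteq> 0"
    then obtain j where "j < n" "x j \<noteq> 0" by blast
    then have "vec n x \<noteq> 0\<^sub>v n" by (metis index_vec index_zero_vec(1))
    then have "0 < scalar_prod (vec n x) (A *\<^sub>v vec n x)" by (intro pos) auto
    then show "0 < (\<Sum>j<n. \<Sum>k<n. x j * (A $$ (j, k) * x k))"
      using scalar_prod_mult_mat_vec_eq[OF Ac, of "vec n x"] by simp
  qed
  then obtain l where l: "\<And>j. j < n \<Longrightarrow> 0 < l j j" "\<And>j k. j < k \<Longrightarrow> l j k = 0"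
    "\<And>j k. j < n \<Longrightarrow> k < n \<Longrightarrow> A $$ (j, k) = (\<Sum>i<n. l j i * l k i)" by blast
  define L where "L = Matrix.mat n n (\<lambda>(j, k). l j k)"
  have Lc: "L \<in> carrier_mat n n" by (simp add: L_def)
  have "Determinant.det L = (\<Prod>j<n. L $$ (j, j))"
    by (rule det_lower_triangular_eq[OF Lc]) (auto simp: L_def l(2))
  also have "\<dots> \<noteq> 0" using l(1) by (force simp: L_def)
  finally have "L \<in> Units (ring_mat TYPE(real) n ())" by (rule det_non_zero_imp_unit[OF Lc])
  then obtain K where K: "K \<in> carrier_mat n n" "L * K = 1\<^sub>m n" "K * L = 1\<^sub>m n"
    by (auto simp: Units_def ring_mat_def)
  have "A = L * transpose_mat L"
    using Ac by (intro eq_matI) (auto simp: L_def l(3) scalar_prod_def lessThan_atLeast0)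
  then have "is_cholesky n A L K"
    using Lc K l(1,2) by (auto simp: is_cholesky_def L_def)
  then show ?thesis by (rule that)
qed

lemma scalar_prod_adjoint:
  fixes M :: "real mat"
  assumes "M \<in> carrier_mat r n" "x \<in> carrier_vec n" "y \<in> carrier_vec r"
  shows "scalar_prod (M *\<^sub>v x) y = scalar_prod x (transpose_mat M *\<^sub>v y)"
  using transpose_vec_mult_scalar[OF assms] assms
  by (metis comm_scalar_prod mult_mat_vec_carrier transpose_carrier_mat)

lemma cholesky_inv_mat:
  assumes "is_cholesky n A L K"
  shows "inv_mat A = transpose_mat K * K"
proof (rule inv_mat_eqI)
  have c: "L \<in> carrier_mat n n" "K \<in> carrier_mat n n" and A: "A = L * transpose_mat L"
    and LK: "L * K = 1\<^sub>m n" "K * L = 1\<^sub>m n" using assms by (auto simp: is_cholesky_def)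
  have t: "transpose_mat L * transpose_mat K = 1\<^sub>m n" "transpose_mat K * transpose_mat L = 1\<^sub>m n"
    using LK c by (metis transpose_mult transpose_one)+
  show "A \<in> carrier_mat n n" "transpose_mat K * K \<in> carrier_mat n n" using c A by auto
  have "A * (transpose_mat K * K) = L * (transpose_mat L * (transpose_mat K * K))"
    unfolding A using c by (intro assoc_mult_mat) auto
  also have "transpose_mat L * (transpose_mat K * K) = (transpose_mat L * transpose_mat K) * K"
    using c by (intro assoc_mult_mat[symmetric]) auto
  finally show "A * (transpose_mat K * K) = 1\<^sub>m n" using t LK c by simp
  have "(transpose_mat K * K) * A = transpose_mat K * (K * (L * transpose_mat L))"
    unfolding A using c by (intro assoc_mult_mat) auto
  also have "K * (L * transpose_mat L) = (K * L) * transpose_mat L"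
    using c by (intro assoc_mult_mat[symmetric]) auto
  finally show "(transpose_mat K * K) * A = 1\<^sub>m n" using t LK c by simp
qed

lemma cholesky_inverse_form:
  assumes ch: "is_cholesky n A L K" and x: "x \<in> carrier_vec n"
  shows "scalar_prod (inv_mat A *\<^sub>v x) x = scalar_prod (K *\<^sub>v x) (K *\<^sub>v x)"
proof -
  have K: "K \<in> carrier_mat n n" using ch by (simp add: is_cholesky_def)
  have "inv_mat A *\<^sub>v x = transpose_mat K *\<^sub>v (K *\<^sub>v x)"
    unfolding cholesky_inv_mat[OF ch] using K x by (intro assoc_mult_mat_vec) auto
  then show ?thesis
    using transpose_vec_mult_scalar[OF K x, of "K *\<^sub>v x"] K x by simp
qed

lemma cholesky_det:
  assumes "is_cholesky n A L K"
  shows "Determinant.det A = (\<Prod>j<n. L $$ (j, j))\<^sup>2"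
proof -
  have c: "L \<in> carrier_mat n n" and A: "A = L * transpose_mat L"
    and low: "\<And>j k. j < k \<Longrightarrow> k < n \<Longrightarrow> L $$ (j, k) = 0"
    using assms by (auto simp: is_cholesky_def)
  have "Determinant.det A = Determinant.det L * Determinant.det (transpose_mat L)"
    unfolding A using c by (intro Determinant.det_mult) auto
  then show ?thesis
    using Determinant.det_transpose[OF c] det_lower_triangular_eq[OF c low] by (simp add: power2_eq_square)
qed

text \<open>
  If \<open>B\<close> is surjective then its transpose is injective.
\<close>

lemma symmetric_pos_def_conjugate:
  assumes A: "symmetric_pos_def n A" and B: "B \<in> carrier_mat r n"
    and surj: "(\<lambda>x. B *\<^sub>v x) ` carrier_vec n = carrier_vec r"
  shows "symmetric_pos_def r (B * A * transpose_mat B)"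
proof -
  have Ac: "A \<in> carrier_mat n n" and sym: "transpose_mat A = A"
    and pos: "\<And>x. x \<in> carrier_vec n \<Longrightarrow> x \<noteq> 0\<^sub>v n \<Longrightarrow> 0 < scalar_prod x (A *\<^sub>v x)"
    using A by (auto simp: symmetric_pos_def_def)
  have "transpose_mat (B * A * transpose_mat B) = B * (A * transpose_mat B)"
  proof -
    have "transpose_mat (B * A * transpose_mat B) = B * transpose_mat (B * A)"
      using B Ac by (subst transpose_mult[of _ r n _ r]) auto
    also have "transpose_mat (B * A) = A * transpose_mat B"
      using B Ac sym by (subst transpose_mult[of _ r n _ n]) auto
    finally show ?thesis .
  qed
  also have "\<dots> = B * A * transpose_mat B" using B Ac by (intro assoc_mult_mat[symmetric]) auto
  finally have "transpose_mat (B * A * transpose_mat B) = B * A * transpose_mat B" .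
  moreover have "0 < scalar_prod x (B * A * transpose_mat B *\<^sub>v x)" if x: "x \<in> carrier_vec r" "x \<noteq> 0\<^sub>v r" for x
  proof -
    let ?y = "transpose_mat B *\<^sub>v x"
    have y: "?y \<in> carrier_vec n" using B x by simp
    have "?y \<noteq> 0\<^sub>v n"
    proof
      assume y0: "?y = 0\<^sub>v n"
      obtain z where z: "z \<in> carrier_vec n" "x = B *\<^sub>v z" using surj x by blast
      have "scalar_prod x x = scalar_prod ?y z"
        using transpose_vec_mult_scalar[OF B z(1) x(1)] z(2) by simp
      also have "\<dots> = 0" using y0 z by simp
      finally have "(\<Sum>i<r. (vec_index x i)\<^sup>2) = 0"
        using x by (simp add: scalar_prod_def lessThan_atLeast0 power2_eq_square)
      then have "\<forall>i<r. vec_index x i = 0" by (subst (asm) sum_nonneg_eq_0_iff) auto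
      then have "x = 0\<^sub>v r" using x by (intro eq_vecI) auto
      then show False using x by simp
    qed
    then have "0 < scalar_prod ?y (A *\<^sub>v ?y)" by (rule pos[OF y])
    also have "\<dots> = scalar_prod x (B *\<^sub>v (A *\<^sub>v ?y))"
      using B Ac x y by (intro transpose_vec_mult_scalar) auto
    also have "B *\<^sub>v (A *\<^sub>v ?y) = B * A *\<^sub>v ?y"
      using B Ac y by (intro assoc_mult_mat_vec[symmetric]) auto
    also have "\<dots> = B * A * transpose_mat B *\<^sub>v x"
      using B Ac x by (intro assoc_mult_mat_vec[symmetric]) auto
    finally show ?thesis .
  qed
  ultimately show ?thesis using B Ac by (auto simp: symmetric_pos_def_def)
qed

section \<open>The Brascamp-Lieb constant\<close>

lemma inj_on_vec_lebesgue_fun: "inj_on (vec n) (space (lebesgue_fun n))"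
  unfolding space_lebesgue_fun by (rule inj_on_vec_PiE)

lemma lebesgue_vec_eq: "lebesgue_vec n = completion (embed_measure (lebesgue_fun n) (vec n))"
  by (simp add: lebesgue_vec_def lebesgue_fun_def)

lemma nn_integral_lebesgue_vec_le:
  "(\<integral>\<^sup>+ x. F x \<partial>lebesgue_vec n) \<le> (\<integral>\<^sup>+ x. F (vec n x) \<partial>lebesgue_fun n)"
proof -
  have "(\<integral>\<^sup>+ x. F x \<partial>embed_measure (lebesgue_fun n) (vec n)) \<le> 1 * (\<integral>\<^sup>+ x. F (vec n x) \<partial>lebesgue_fun n)"
    by (rule nn_integral_le_of_measurable_eq) (simp add: nn_integral_embed_measure'[OF inj_on_vec_lebesgue_fun])
  then show ?thesis by (simp add: lebesgue_vec_eq nn_integral_completion)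
qed

lemma nn_integral_lebesgue_vec:
  assumes "(\<lambda>x. F (vec n x)) \<in> borel_measurable (borel_fun n)"
  shows "(\<integral>\<^sup>+ x. F x \<partial>lebesgue_vec n) = (\<integral>\<^sup>+ x. F (vec n x) \<partial>lebesgue_fun n)"
proof -
  have "F \<in> borel_measurable (embed_measure (lebesgue_fun n) (vec n))"
    by (rule measurable_embed_measure1) (use assms in simp)
  then show ?thesis
    by (simp add: lebesgue_vec_eq nn_integral_completion nn_integral_embed_measure'[OF inj_on_vec_lebesgue_fun])
qed

text \<open>
  An integrable function for the completed measure agrees with a Borel function outside a Borel null set;
  on that null set the majorant is \<open>\<infinity>\<close>.
\<close>

lemma borel_majorant_of_integrable:
  fixes f :: "real vec \<Rightarrow> real"
  assumes f: "integrable (lebesgue_vec n) f" and f0: "\<And>x. x \<in> carrier_vec n \<Longrightarrow> 0 \<le> f x"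
  obtains g where "g \<in> borel_measurable (borel_fun n)"
    "\<And>x. ennreal (f (vec n x)) \<le> g x"
    "(\<integral>\<^sup>+ x. g x \<partial>lebesgue_fun n) = ennreal (\<integral>x. f x \<partial>lebesgue_vec n)"
proof -
  let ?E = "embed_measure (lebesgue_fun n) (vec n :: (nat \<Rightarrow> real) \<Rightarrow> real vec)"
  have sp: "space ?E = carrier_vec n"
    using space_lebesgue_vec[of n] by (simp add: lebesgue_vec_eq)
  have "f \<in> borel_measurable (completion ?E)" using f by (simp add: lebesgue_vec_eq)
  then obtain f' where f'[measurable]: "f' \<in> borel_measurable ?E" and ae: "AE x in ?E. f x = f' x"
    using completion_ex_borel_measurable_real by blast
  from ae obtain N where N: "{x \<in> space ?E. f x \<noteq> f' x} \<subseteq> N" "emeasure ?E N = 0" "N \<in> sets ?E"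
    by (rule AE_E)
  have vm: "vec n \<in> lebesgue_fun n \<rightarrow>\<^sub>M ?E" by (rule measurable_embed_measure2'[OF inj_on_vec_lebesgue_fun])
  define G where "G = (\<lambda>x. ennreal (f' x) + \<infinity> * indicator N x)"
  have Gm: "G \<in> borel_measurable ?E" unfolding G_def using N(3) by measurable
  show ?thesis
  proof (rule that[of "\<lambda>x. G (vec n x)"])
    show "(\<lambda>x. G (vec n x)) \<in> borel_measurable (borel_fun n)"
      using measurable_compose[OF vm Gm] by (simp cong: measurable_cong_sets add: sets_lebesgue_fun)
    show "ennreal (f (vec n x)) \<le> G (vec n x)" for x
    proof (cases "vec n x \<in> N")
      case False
      then have "f (vec n x) = f' (vec n x)" using N(1) sp by auto
      then show ?thesis by (simp add: G_def)
    qed (simp add: G_def)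
    have "(\<integral>\<^sup>+ x. G (vec n x) \<partial>lebesgue_fun n) = (\<integral>\<^sup>+ x. G x \<partial>?E)"
      by (rule nn_integral_embed_measure'[OF inj_on_vec_lebesgue_fun Gm, symmetric])
    also have "\<dots> = (\<integral>\<^sup>+ x. ennreal (f x) \<partial>?E)"
    proof (rule nn_integral_cong_AE)
      have "AE x in ?E. x \<notin> N" using N(2,3) by (intro AE_not_in) auto
      then show "AE x in ?E. G x = ennreal (f x)" using ae
        by eventually_elim (simp add: G_def)
    qed
    also have "\<dots> = (\<integral>\<^sup>+ x. ennreal (f x) \<partial>lebesgue_vec n)" by (simp add: lebesgue_vec_eq nn_integral_completion)
    also have "\<dots> = ennreal (\<integral>x. f x \<partial>lebesgue_vec n)"
      using f f0 by (intro nn_integral_eq_integral AE_I2) auto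
    finally show "(\<integral>\<^sup>+ x. G (vec n x) \<partial>lebesgue_fun n) = ennreal (\<integral>x. f x \<partial>lebesgue_vec n)" .
  qed
qed

definition entries :: "real mat \<Rightarrow> nat \<Rightarrow> nat \<Rightarrow> real" where
  "entries M j k = M $$ (j, k)"

lemma mult_mat_vec_vec:
  assumes "M \<in> carrier_mat r n"
  shows "M *\<^sub>v vec n x = vec r (lin r n (entries M) x)"
  using assms by (intro eq_vecI) (auto simp: lin_def dot_def entries_def scalar_prod_def lessThan_atLeast0)

lemma scalar_prod_vec: "scalar_prod (vec n x) (vec n y) = dot n x y"
  by (simp add: scalar_prod_def dot_def lessThan_atLeast0)

lemma lower_map_eq_lin:
  assumes "\<And>j k. j < k \<Longrightarrow> k < n \<Longrightarrow> L $$ (j, k) = 0"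
  shows "lower_map n (entries L) (\<lambda>_. 0) x = lin n n (entries L) x"
  unfolding lower_map_def lin_def dot_def
proof (rule restrict_ext)
  fix j assume "j \<in> {..<n}"
  then show "0 + (\<Sum>k\<le>j. entries L j k * x k) = (\<Sum>k<n. entries L j k * x k)"
    using assms by (auto simp: entries_def not_le intro!: sum.mono_neutral_left) (meson not_le)
qed

context
  fixes n :: nat and A L K :: "real mat"
  assumes ch: "is_cholesky n A L K"
begin

lemma cholesky_carrier: "L \<in> carrier_mat n n" "K \<in> carrier_mat n n"
  using ch by (auto simp: is_cholesky_def)

lemma cholesky_lower: "lower_map n (entries L) (\<lambda>_. 0) x = lin n n (entries L) x"
  by (rule lower_map_eq_lin) (use ch in \<open>auto simp: is_cholesky_def\<close>)

lemma cholesky_det_pos: "0 < (\<Prod>j<n. L $$ (j, j))"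
  using ch by (intro prod_pos) (auto simp: is_cholesky_def)

lemma nn_integral_cholesky:
  assumes "f \<in> borel_measurable (borel_fun n)"
  shows "(\<integral>\<^sup>+ x. f x \<partial>lebesgue_fun n)
    = ennreal (\<Prod>j<n. L $$ (j, j)) * (\<integral>\<^sup>+ x. f (lin n n (entries L) x) \<partial>lebesgue_fun n)"
  using nn_integral_lower_map[OF assms, of "entries L" "\<lambda>_. 0"] ch
  by (simp add: cholesky_lower is_cholesky_def) (simp add: entries_def)

lemma cholesky_inverse_vec:
  assumes "x \<in> carrier_vec n"
  shows "K *\<^sub>v (L *\<^sub>v x) = x" "L *\<^sub>v (K *\<^sub>v x) = x"
proof -
  have "K *\<^sub>v (L *\<^sub>v x) = (K * L) *\<^sub>v x"
    by (rule assoc_mult_mat_vec[symmetric, OF cholesky_carrier(2,1) assms])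
  then show "K *\<^sub>v (L *\<^sub>v x) = x" using ch assms by (simp add: is_cholesky_def)
  have "L *\<^sub>v (K *\<^sub>v x) = (L * K) *\<^sub>v x"
    by (rule assoc_mult_mat_vec[symmetric, OF cholesky_carrier assms])
  then show "L *\<^sub>v (K *\<^sub>v x) = x" using ch assms by (simp add: is_cholesky_def)
qed

lemma gaussian_form_vec:
  "scalar_prod (inv_mat A *\<^sub>v vec n x) (vec n x) = dot n (lin n n (entries K) x) (lin n n (entries K) x)"
  by (simp add: cholesky_inverse_form[OF ch] mult_mat_vec_vec[OF cholesky_carrier(2)] scalar_prod_vec)

lemma gaussian_measurable:
  "(\<lambda>x. exp (- scalar_prod (inv_mat A *\<^sub>v vec n x) (vec n x) / 2)) \<in> borel_measurable (borel_fun n)"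
proof -
  have "(\<lambda>y. exp (- dot n y y / 2)) \<in> borel_measurable (borel_fun n)" by measurable
  from measurable_compose[OF measurable_lin this] show ?thesis unfolding gaussian_form_vec .
qed

text \<open>
  The substitution by the Cholesky factor turns the quadratic form of the inverse matrix into \<open>\<bar>x\<bar>\<^sup>2\<close>.
\<close>

lemma nn_integral_gaussian:
  "(\<integral>\<^sup>+ x. ennreal (exp (- scalar_prod (inv_mat A *\<^sub>v x) x / 2)) \<partial>lebesgue_vec n)
    = ennreal ((\<Prod>j<n. L $$ (j, j)) * sqrt (2 * pi) ^ n)"
proof -
  have "(\<integral>\<^sup>+ x. ennreal (exp (- scalar_prod (inv_mat A *\<^sub>v x) x / 2)) \<partial>lebesgue_vec n)
    = (\<integral>\<^sup>+ x. ennreal (exp (- scalar_prod (inv_mat A *\<^sub>v vec n x) (vec n x) / 2)) \<partial>lebesgue_fun n)"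
    by (rule nn_integral_lebesgue_vec) (use gaussian_measurable in simp)
  also have "\<dots> = ennreal (\<Prod>j<n. L $$ (j, j)) * (\<integral>\<^sup>+ x. ennreal (exp (- scalar_prod
      (inv_mat A *\<^sub>v vec n (lin n n (entries L) x)) (vec n (lin n n (entries L) x)) / 2)) \<partial>lebesgue_fun n)"
    by (rule nn_integral_cholesky) (use gaussian_measurable in simp)
  also have "(\<integral>\<^sup>+ x. ennreal (exp (- scalar_prod
      (inv_mat A *\<^sub>v vec n (lin n n (entries L) x)) (vec n (lin n n (entries L) x)) / 2)) \<partial>lebesgue_fun n)
      = (\<integral>\<^sup>+ x. ennreal (exp (- dot n x x / 2)) * 1 \<partial>lebesgue_fun n)"
  proof (intro nn_integral_cong)
    fix x :: "nat \<Rightarrow> real"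
    have "K *\<^sub>v vec n (lin n n (entries L) x) = vec n x"
      unfolding mult_mat_vec_vec[OF cholesky_carrier(1), symmetric] by (rule cholesky_inverse_vec) simp
    then show "ennreal (exp (- scalar_prod (inv_mat A *\<^sub>v vec n (lin n n (entries L) x)) (vec n (lin n n (entries L) x)) / 2))
      = ennreal (exp (- dot n x x / 2)) * 1"
      by (simp add: cholesky_inverse_form[OF ch] scalar_prod_vec)
  qed
  also have "\<dots> = ennreal (sqrt (2 * pi) ^ n)"
    by (subst nn_integral_gauss) (simp_all add: gauss.emeasure_space_1[simplified])
  finally show ?thesis using cholesky_det_pos by (simp add: ennreal_mult'[symmetric] less_imp_le)
qed

lemma gaussian_integrable:
  "integrable (lebesgue_vec n) (\<lambda>x. exp (- scalar_prod (inv_mat A *\<^sub>v x) x / 2))"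
proof (rule integrableI_nonneg)
  have "(\<lambda>x. exp (- scalar_prod (inv_mat A *\<^sub>v x) x / 2)) \<in> borel_measurable (embed_measure (lebesgue_fun n) (vec n))"
    by (rule measurable_embed_measure1) (use gaussian_measurable in simp)
  then show "(\<lambda>x. exp (- scalar_prod (inv_mat A *\<^sub>v x) x / 2)) \<in> borel_measurable (lebesgue_vec n)"
    unfolding lebesgue_vec_eq by (rule measurable_completion)
  show "(\<integral>\<^sup>+ x. ennreal (exp (- scalar_prod (inv_mat A *\<^sub>v x) x / 2)) \<partial>lebesgue_vec n) < \<infinity>"
    unfolding nn_integral_gaussian by simp
qed simp

lemma integral_gaussian:
  "(\<integral>x. exp (- scalar_prod (inv_mat A *\<^sub>v x) x / 2) \<partial>lebesgue_vec n) = (\<Prod>j<n. L $$ (j, j)) * sqrt (2 * pi) ^ n"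
proof -
  have "ennreal (\<integral>x. exp (- scalar_prod (inv_mat A *\<^sub>v x) x / 2) \<partial>lebesgue_vec n)
      = ennreal ((\<Prod>j<n. L $$ (j, j)) * sqrt (2 * pi) ^ n)"
    unfolding nn_integral_gaussian[symmetric]
    by (rule nn_integral_eq_integral[symmetric, OF gaussian_integrable]) simp
  then show ?thesis
    using cholesky_det_pos by (subst (asm) ennreal_inj) (auto intro!: integral_nonneg_AE)
qed

end

lemma weighted_sum_form:
  fixes W :: "nat \<Rightarrow> real mat"
  assumes W: "\<And>i. i < m \<Longrightarrow> W i \<in> carrier_mat n n" and x: "x \<in> carrier_vec n"
  shows "scalar_prod x (Matrix.mat n n (\<lambda>(j, k). \<Sum>i<m. (c i \<cdot>\<^sub>m W i) $$ (j, k)) *\<^sub>v x)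
    = (\<Sum>i<m. c i * scalar_prod x (W i *\<^sub>v x))" (is "scalar_prod x (?M *\<^sub>v x) = _")
proof -
  let ?t = "\<lambda>i j k. c i * (vec_index x j * (W i $$ (j, k) * vec_index x k))"
  have "scalar_prod x (?M *\<^sub>v x) = (\<Sum>j<n. \<Sum>k<n. vec_index x j * (?M $$ (j, k) * vec_index x k))"
    by (rule scalar_prod_mult_mat_vec_eq[OF _ x]) simp
  also have "\<dots> = (\<Sum>j<n. \<Sum>k<n. \<Sum>i<m. ?t i j k)"
  proof (intro sum.cong refl)
    fix j k assume jk: "j \<in> {..<n}" "k \<in> {..<n}"
    have "?M $$ (j, k) = (\<Sum>i<m. (c i \<cdot>\<^sub>m W i) $$ (j, k))" using jk by simp
    also have "\<dots> = (\<Sum>i<m. c i * W i $$ (j, k))"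
    proof (intro sum.cong refl)
      fix i assume "i \<in> {..<m}"
      then show "(c i \<cdot>\<^sub>m W i) $$ (j, k) = c i * W i $$ (j, k)" using jk W[of i] by auto
    qed
    finally show "vec_index x j * (?M $$ (j, k) * vec_index x k) = (\<Sum>i<m. ?t i j k)"
      by (simp add: sum_distrib_left sum_distrib_right mult_ac)
  qed
  also have "\<dots> = (\<Sum>j<n. \<Sum>i<m. \<Sum>k<n. ?t i j k)" by (intro sum.cong refl sum.swap)
  also have "\<dots> = (\<Sum>i<m. \<Sum>j<n. \<Sum>k<n. ?t i j k)" by (rule sum.swap)
  also have "\<dots> = (\<Sum>i<m. c i * scalar_prod x (W i *\<^sub>v x))"
  proof (intro sum.cong refl)
    fix i assume "i \<in> {..<m}"
    then show "(\<Sum>j<n. \<Sum>k<n. ?t i j k) = c i * scalar_prod x (W i *\<^sub>v x)"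
      using scalar_prod_mult_mat_vec_eq[OF W x, of i] by (simp add: sum_distrib_left)
  qed
  finally show ?thesis .
qed

lemma conjugate_form:
  fixes B :: "real mat"
  assumes B: "B \<in> carrier_mat r n" and E: "E \<in> carrier_mat r r" and x: "x \<in> carrier_vec n"
  shows "scalar_prod x (transpose_mat B * E * B *\<^sub>v x) = scalar_prod (E *\<^sub>v (B *\<^sub>v x)) (B *\<^sub>v x)"
proof -
  have "transpose_mat B * E * B *\<^sub>v x = transpose_mat B * E *\<^sub>v (B *\<^sub>v x)"
    using B E x by (intro assoc_mult_mat_vec) auto
  also have "\<dots> = transpose_mat B *\<^sub>v (E *\<^sub>v (B *\<^sub>v x))"
    using B E x by (intro assoc_mult_mat_vec) auto
  finally have "scalar_prod x (transpose_mat B * E * B *\<^sub>v x) = scalar_prod (B *\<^sub>v x) (E *\<^sub>v (B *\<^sub>v x))"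
    using B E x by (simp add: scalar_prod_adjoint)
  also have "\<dots> = scalar_prod (E *\<^sub>v (B *\<^sub>v x)) (B *\<^sub>v x)"
    using B E x by (intro comm_scalar_prod[of _ r]) auto
  finally show ?thesis .
qed

text \<open>
  In the coordinates given by the Cholesky factors the map \<open>B\<close> becomes \<open>Q\<close>, and \<open>Q Q\<^sup>T = K' (B A B\<^sup>T) K'\<^sup>T = 1\<close>.
\<close>

lemma normalized_map:
  fixes B :: "real mat"
  assumes ch: "is_cholesky n A L K" and ch': "is_cholesky r (B * A * transpose_mat B) L' K'"
    and A: "A \<in> carrier_mat n n" and B: "B \<in> carrier_mat r n"
  defines "Q \<equiv> K' * (B * L)"
  shows "Q \<in> carrier_mat r n"
    and "x \<in> carrier_vec n \<Longrightarrow> Q *\<^sub>v x = K' *\<^sub>v (B *\<^sub>v (L *\<^sub>v x))"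
    and "x \<in> carrier_vec n \<Longrightarrow> L' *\<^sub>v (Q *\<^sub>v x) = B *\<^sub>v (L *\<^sub>v x)"
    and "Q * transpose_mat Q = 1\<^sub>m r"
proof -
  note L = cholesky_carrier[OF ch] and L' = cholesky_carrier[OF ch']
  show Q: "Q \<in> carrier_mat r n" using L L' B by (auto simp: Q_def)
  have Qx: "Q *\<^sub>v x = K' *\<^sub>v (B *\<^sub>v (L *\<^sub>v x))" if x: "x \<in> carrier_vec n" for x
  proof -
    have "Q *\<^sub>v x = K' *\<^sub>v (B * L *\<^sub>v x)"
      unfolding Q_def using L L' B x by (intro assoc_mult_mat_vec) auto
    also have "B * L *\<^sub>v x = B *\<^sub>v (L *\<^sub>v x)" by (rule assoc_mult_mat_vec[OF B L(1) x])
    finally show ?thesis .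
  qed
  show "x \<in> carrier_vec n \<Longrightarrow> Q *\<^sub>v x = K' *\<^sub>v (B *\<^sub>v (L *\<^sub>v x))" by (rule Qx)
  show "x \<in> carrier_vec n \<Longrightarrow> L' *\<^sub>v (Q *\<^sub>v x) = B *\<^sub>v (L *\<^sub>v x)"
    using B L by (simp add: Qx cholesky_inverse_vec[OF ch'])
  let ?P = "B * L"
  have P: "?P \<in> carrier_mat r n" using B L by auto
  have PP: "?P * transpose_mat ?P = L' * transpose_mat L'"
  proof -
    have "?P * transpose_mat ?P = B * L * (transpose_mat L * transpose_mat B)"
      using B L by (simp add: transpose_mult)
    also have "\<dots> = B * (L * (transpose_mat L * transpose_mat B))"
      using B L by (intro assoc_mult_mat) auto
    also have "L * (transpose_mat L * transpose_mat B) = L * transpose_mat L * transpose_mat B"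
      using B L by (intro assoc_mult_mat[symmetric]) auto
    also have "\<dots> = A * transpose_mat B" using ch by (simp add: is_cholesky_def)
    also have "B * (A * transpose_mat B) = B * A * transpose_mat B"
      using B A by (intro assoc_mult_mat[symmetric]) auto
    finally show ?thesis using ch' by (simp add: is_cholesky_def)
  qed
  have "Q * transpose_mat Q = K' * ?P * (transpose_mat ?P * transpose_mat K')"
    unfolding Q_def using L' P by (simp add: transpose_mult)
  also have "\<dots> = K' * (?P * (transpose_mat ?P * transpose_mat K'))"
    using L' P by (intro assoc_mult_mat[of _ r r _ n _ r]) auto
  also have "?P * (transpose_mat ?P * transpose_mat K') = ?P * transpose_mat ?P * transpose_mat K'"
    using L' P by (intro assoc_mult_mat[symmetric]) auto
  also have "\<dots> = L' * (transpose_mat L' * transpose_mat K')"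
    unfolding PP using L' by (intro assoc_mult_mat) auto
  also have "transpose_mat L' * transpose_mat K' = 1\<^sub>m r"
    using ch' transpose_mult[OF L'(2,1)] by (simp add: is_cholesky_def)
  finally show "Q * transpose_mat Q = 1\<^sub>m r" using ch' L' by (simp add: is_cholesky_def)
qed

lemma coisometry_entries:
  assumes Q: "Q \<in> carrier_mat r n" and QQ: "Q * transpose_mat Q = 1\<^sub>m r"
  shows "(\<Sum>j<n. (\<Sum>k<r. entries Q k j * w k)\<^sup>2) = dot r w w"
proof -
  let ?w = "vec r w" and ?y = "transpose_mat Q *\<^sub>v vec r w"
  have y: "?y \<in> carrier_vec n" using Q by simp
  have "scalar_prod ?y ?y = scalar_prod ?w (Q *\<^sub>v ?y)"
    by (rule transpose_vec_mult_scalar[OF Q y]) simp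
  also have "Q *\<^sub>v ?y = Q * transpose_mat Q *\<^sub>v ?w"
    using Q by (intro assoc_mult_mat_vec[symmetric]) auto
  finally have "scalar_prod ?y ?y = dot r w w" by (simp add: QQ scalar_prod_vec)
  moreover have "scalar_prod ?y ?y = (\<Sum>j<n. (\<Sum>k<r. entries Q k j * w k)\<^sup>2)"
    using Q by (simp add: scalar_prod_def lessThan_atLeast0 power2_eq_square entries_def row_def col_def)
  ultimately show ?thesis by simp
qed

theorem theorem2:
  fixes n m :: nat and d :: "nat \<Rightarrow> nat" and c :: "nat \<Rightarrow> real"
    and B :: "nat \<Rightarrow> real mat" and A :: "real mat"
    and C :: real and g :: "nat \<Rightarrow> real vec \<Rightarrow> real"
  assumes datum: "brascamp_lieb_datum n m d c B"
    and scaling: "(\<Sum>i<m. c i * real (d i)) = real n"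
    and A: "symmetric_pos_def n A"
    and A_inv: "inv_mat A =
      mat n n (\<lambda>(j, k). \<Sum>i<m.
        (c i \<cdot>\<^sub>m (transpose_mat (B i) * inv_mat (B i * A * transpose_mat (B i)) * B i)) $$ (j, k))"
  defines "C \<equiv> sqrt (Determinant.det A /
      (\<Prod>i<m. Determinant.det (B i * A * transpose_mat (B i)) powr c i))"
    and "g \<equiv> (\<lambda>i x.
      exp (- (scalar_prod (inv_mat (B i * A * transpose_mat (B i)) *\<^sub>v x) x) / 2))"
  shows "is_brascamp_lieb_constant n m d c B (ennreal C)
    \<and> brascamp_lieb_input m d g
    \<and> brascamp_lieb_lhs n m c B g = ennreal C * brascamp_lieb_rhs m d c g"
proof -
  define D where "D = (\<lambda>i. B i * A * transpose_mat (B i))"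
  have D_fold: "B i * A * transpose_mat (B i) = D i" for i by (simp add: D_def)
  have c: "0 < c i" and B: "B i \<in> carrier_mat (d i) n"
    and surj: "(\<lambda>x. B i *\<^sub>v x) ` carrier_vec n = carrier_vec (d i)" if "i < m" for i
    using datum that by (auto simp: brascamp_lieb_datum_def)
  obtain L K where ch: "is_cholesky n A L K" using cholesky_exists[OF A] by blast
  note LK = cholesky_carrier[OF ch]
  have "\<exists>L K. is_cholesky (d i) (D i) L K" if "i < m" for i
    using cholesky_exists[OF symmetric_pos_def_conjugate[OF A B[OF that] surj[OF that]]] unfolding D_def by blast
  then obtain Li Ki where chi: "\<And>i. i < m \<Longrightarrow> is_cholesky (d i) (D i) (Li i) (Ki i)" by metis
  note LKi = cholesky_carrier[OF chi]
  define detL where "detL = (\<Prod>j<n. L $$ (j, j))"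
  define detLi where "detLi = (\<lambda>i. \<Prod>j<d i. Li i $$ (j, j))"
  have detL: "0 < detL" unfolding detL_def by (rule cholesky_det_pos[OF ch])
  have detLi: "0 < detLi i" if "i < m" for i unfolding detLi_def by (rule cholesky_det_pos[OF chi[OF that]])
  define Q where "Q = (\<lambda>i. Ki i * (B i * L))"
  have Am: "A \<in> carrier_mat n n" using A by (simp add: symmetric_pos_def_def)
  note nm = normalized_map[OF ch chi[folded D_fold] Am B, folded Q_def[unfolded fun_eq_iff, rule_format]]
  note Qc = nm(1) and Qx = nm(2) and LQ = nm(3) and QQ = nm(4)
  have D_form: "scalar_prod (inv_mat (D i) *\<^sub>v y) y = scalar_prod (Ki i *\<^sub>v y) (Ki i *\<^sub>v y)"
    if "i < m" "y \<in> carrier_vec (d i)" for i y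
    by (rule cholesky_inverse_form[OF chi[OF that(1)] that(2)])
  \<comment> \<open>The hypothesis on \<open>A\<close>, as an identity of quadratic forms.\<close>
  have A_form: "(\<Sum>i<m. c i * scalar_prod (inv_mat (D i) *\<^sub>v (B i *\<^sub>v x)) (B i *\<^sub>v x)) = scalar_prod (inv_mat A *\<^sub>v x) x"
    if x: "x \<in> carrier_vec n" for x
  proof -
    let ?W = "\<lambda>i. transpose_mat (B i) * inv_mat (D i) * B i"
    have Ic: "inv_mat (D i) \<in> carrier_mat (d i) (d i)" if "i < m" for i
      unfolding cholesky_inv_mat[OF chi[OF that]] using LKi[OF that] by auto
    have Wc: "?W i \<in> carrier_mat n n" if "i < m" for i
      using B[OF that] Ic[OF that] by (meson mult_carrier_mat transpose_carrier_mat)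
    have Ac: "inv_mat A \<in> carrier_mat n n" unfolding cholesky_inv_mat[OF ch] using LK by auto
    have "scalar_prod (inv_mat A *\<^sub>v x) x = scalar_prod x (inv_mat A *\<^sub>v x)"
      using Ac x by (intro comm_scalar_prod[of _ n]) auto
    also have "\<dots> = (\<Sum>i<m. c i * scalar_prod x (?W i *\<^sub>v x))"
      unfolding A_inv D_fold by (rule weighted_sum_form[OF Wc x])
    also have "\<dots> = (\<Sum>i<m. c i * scalar_prod (inv_mat (D i) *\<^sub>v (B i *\<^sub>v x)) (B i *\<^sub>v x))"
      by (intro sum.cong refl) (simp add: conjugate_form[OF B Ic x])
    finally show ?thesis ..
  qed
  interpret geometric_datum n m d c "\<lambda>i. entries (Q i)"
  proof
    show "0 < c i" if "i < m" for i by (rule c[OF that])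
    show "(\<Sum>i<m. c i * real (d i)) = real n" by (rule scaling)
  next
    show "(\<Sum>j<n. (\<Sum>k<d i. entries (Q i) k j * w k)\<^sup>2) = dot (d i) w w" if "i < m" for i w
      by (rule coisometry_entries[OF Qc[OF that that] QQ[OF that that]])
  next
    fix x
    let ?y = "L *\<^sub>v vec n x"
    have y: "?y \<in> carrier_vec n" using LK by simp
    have "dot (d i) (lin (d i) n (entries (Q i)) x) (lin (d i) n (entries (Q i)) x)
        = scalar_prod (inv_mat (D i) *\<^sub>v (B i *\<^sub>v ?y)) (B i *\<^sub>v ?y)" if i: "i < m" for i
    proof -
      have "dot (d i) (lin (d i) n (entries (Q i)) x) (lin (d i) n (entries (Q i)) x)
        = scalar_prod (Q i *\<^sub>v vec n x) (Q i *\<^sub>v vec n x)"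
        by (simp add: mult_mat_vec_vec[OF Qc[OF i i]] scalar_prod_vec)
      then show ?thesis using B[OF i] y by (simp add: Qx[OF i i] D_form[OF i])
    qed
    then have "(\<Sum>i<m. c i * dot (d i) (lin (d i) n (entries (Q i)) x) (lin (d i) n (entries (Q i)) x))
        = scalar_prod (inv_mat A *\<^sub>v ?y) ?y"
      by (simp add: A_form[OF y, symmetric])
    also have "\<dots> = dot n x x"
      by (simp add: cholesky_inverse_form[OF ch y] cholesky_inverse_vec[OF ch] scalar_prod_vec)
    finally show "(\<Sum>i<m. c i * dot (d i) (lin (d i) n (entries (Q i)) x) (lin (d i) n (entries (Q i)) x)) = dot n x x" .
  qed
  have C: "C = detL / (\<Prod>i<m. detLi i powr c i)"
  proof -
    have "Determinant.det (D i) powr c i = (detLi i powr c i)\<^sup>2" if i: "i < m" for i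
    proof -
      have "Determinant.det (D i) = (detLi i)\<^sup>2" unfolding detLi_def by (rule cholesky_det[OF chi[OF i]])
      then show ?thesis using detLi[OF i] by (simp add: power2_eq_square powr_mult)
    qed
    then have "(\<Prod>i<m. Determinant.det (D i) powr c i) = (\<Prod>i<m. detLi i powr c i)\<^sup>2"
      by (simp add: prod_power_distrib)
    moreover have "Determinant.det A = detL\<^sup>2" unfolding detL_def by (rule cholesky_det[OF ch])
    ultimately have "C = sqrt ((detL / (\<Prod>i<m. detLi i powr c i))\<^sup>2)"
      unfolding C_def D_fold by (simp add: power_divide)
    then show ?thesis using detL by (simp add: prod_nonneg)
  qed
  have detprod: "0 < (\<Prod>i<m. detLi i powr c i)" using detLi by (intro prod_pos) force
  have C0: "0 < C" using detL detprod by (simp add: C)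
  have ineq: "brascamp_lieb_inequality n m d c B (ennreal C)"
    unfolding brascamp_lieb_inequality_def
  proof (intro allI impI)
    fix f assume "brascamp_lieb_input m d f"
    then have fi: "integrable (lebesgue_vec (d i)) (f i)" and f0: "\<And>x. x \<in> carrier_vec (d i) \<Longrightarrow> 0 \<le> f i x"
      if "i < m" for i using that by (auto simp: brascamp_lieb_input_def)
    define J where "J = (\<lambda>i. \<integral>x. f i x \<partial>lebesgue_vec (d i))"
    have J0: "0 \<le> J i" if "i < m" for i
      unfolding J_def by (intro integral_nonneg_AE AE_I2) (use f0[OF that] in simp)
    have "\<exists>h. h \<in> borel_measurable (borel_fun (d i)) \<and> (\<forall>x. ennreal (f i (vec (d i) x)) \<le> h x) \<and>
      (\<integral>\<^sup>+ x. h x \<partial>lebesgue_fun (d i)) = ennreal (J i)" if "i < m" for i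
      unfolding J_def by (rule borel_majorant_of_integrable[OF fi[OF that] f0[OF that]]) auto
    then obtain h where hm: "\<And>i. i < m \<Longrightarrow> h i \<in> borel_measurable (borel_fun (d i))"
      and fh: "\<And>i x. i < m \<Longrightarrow> ennreal (f i (vec (d i) x)) \<le> h i x"
      and hJ: "\<And>i. i < m \<Longrightarrow> (\<integral>\<^sup>+ x. h i x \<partial>lebesgue_fun (d i)) = ennreal (J i)" by metis
    have "(\<integral>\<^sup>+ x. ennreal (\<Prod>i<m. f i (Li i *\<^sub>v vec (d i) (lin (d i) n (entries (Q i)) x)) powr c i) \<partial>lebesgue_fun n)
      \<le> ennreal (\<Prod>i<m. (J i / detLi i) powr c i)"
    \<comment> \<open>The functions \<open>f i\<close> in the coordinates given by \<open>Li i\<close>, where their integrals are divided by \<open>detLi i\<close>.\<close>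
    proof (rule geometric_brascamp_lieb[where f="\<lambda>i y. f i (Li i *\<^sub>v vec (d i) y)" and g="\<lambda>i y. h i (lin (d i) (d i) (entries (Li i)) y)"])
      fix i assume i: "i < m"
      show "0 \<le> f i (Li i *\<^sub>v vec (d i) y)" for y using LKi[OF i] by (intro f0[OF i]) auto
      show "(\<lambda>y. h i (lin (d i) (d i) (entries (Li i)) y)) \<in> borel_measurable (borel_fun (d i))"
        by (rule measurable_compose[OF measurable_lin hm[OF i]])
      show "ennreal (f i (Li i *\<^sub>v vec (d i) y)) \<le> h i (lin (d i) (d i) (entries (Li i)) y)" for y
        unfolding mult_mat_vec_vec[OF LKi(1)[OF i]] by (rule fh[OF i])
      show "0 \<le> J i / detLi i" using J0[OF i] detLi[OF i] by simp
      have "ennreal (detLi i) * (\<integral>\<^sup>+ y. h i (lin (d i) (d i) (entries (Li i)) y) \<partial>lebesgue_fun (d i)) = ennreal (J i)"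
        using nn_integral_cholesky[OF chi[OF i] hm[OF i]] hJ[OF i] by (simp add: detLi_def)
      also have "\<dots> = ennreal (detLi i) * ennreal (J i / detLi i)"
        using detLi[OF i] by (simp add: ennreal_mult'[symmetric])
      finally show "(\<integral>\<^sup>+ y. h i (lin (d i) (d i) (entries (Li i)) y) \<partial>lebesgue_fun (d i)) \<le> ennreal (J i / detLi i)"
        using detLi[OF i] by (simp add: ennreal_mult_cancel_left)
    qed
    note geo = this
    have "brascamp_lieb_lhs n m c B f \<le> (\<integral>\<^sup>+ x. ennreal (\<Prod>i<m. f i (B i *\<^sub>v vec n x) powr c i) \<partial>lebesgue_fun n)"
      unfolding brascamp_lieb_lhs_def by (rule nn_integral_lebesgue_vec_le)
    also have "\<dots> \<le> ennreal detL * (\<integral>\<^sup>+ x. ennreal (\<Prod>i<m. f i (B i *\<^sub>v vec n (lin n n (entries L) x)) powr c i) \<partial>lebesgue_fun n)"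
      unfolding detL_def
    proof (rule nn_integral_le_of_measurable_eq[where T="lin n n (entries L)"
          and F="\<lambda>x. ennreal (\<Prod>i<m. f i (B i *\<^sub>v vec n x) powr c i)"])
      fix u :: "(nat \<Rightarrow> real) \<Rightarrow> ennreal" assume "u \<in> borel_measurable (lebesgue_fun n)"
      then show "(\<integral>\<^sup>+ x. u x \<partial>lebesgue_fun n)
          = ennreal (\<Prod>j<n. L $$ (j, j)) * (\<integral>\<^sup>+ x. u (lin n n (entries L) x) \<partial>lebesgue_fun n)"
        by (intro nn_integral_cholesky[OF ch]) simp
    qed
    also have "(\<integral>\<^sup>+ x. ennreal (\<Prod>i<m. f i (B i *\<^sub>v vec n (lin n n (entries L) x)) powr c i) \<partial>lebesgue_fun n)
      = (\<integral>\<^sup>+ x. ennreal (\<Prod>i<m. f i (Li i *\<^sub>v vec (d i) (lin (d i) n (entries (Q i)) x)) powr c i) \<partial>lebesgue_fun n)"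
    proof (intro nn_integral_cong arg_cong[where f=ennreal] prod.cong refl)
      fix x i assume "i \<in> {..<m}"
      then have i: "i < m" by simp
      show "f i (B i *\<^sub>v vec n (lin n n (entries L) x)) powr c i
        = f i (Li i *\<^sub>v vec (d i) (lin (d i) n (entries (Q i)) x)) powr c i"
        unfolding mult_mat_vec_vec[OF LK(1), symmetric] mult_mat_vec_vec[OF Qc[OF i i], symmetric] by (simp add: LQ[OF i i])
    qed
    also have "ennreal detL * \<dots> \<le> ennreal detL * ennreal (\<Prod>i<m. (J i / detLi i) powr c i)"
      by (intro mult_left_mono geo) simp
    also have "\<dots> = ennreal C * brascamp_lieb_rhs m d c f"
    proof -
      have "(\<Prod>i<m. (J i / detLi i) powr c i) = (\<Prod>i<m. J i powr c i / detLi i powr c i)"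
        by (intro prod.cong refl powr_divide)
      then have "detL * (\<Prod>i<m. (J i / detLi i) powr c i) = C * (\<Prod>i<m. J i powr c i)"
        by (simp add: prod_dividef C)
      then show ?thesis
        using detL C0 by (simp add: brascamp_lieb_rhs_def J_def ennreal_mult'[symmetric] less_imp_le)
    qed
    finally show "brascamp_lieb_lhs n m c B f \<le> ennreal C * brascamp_lieb_rhs m d c f" .
  qed
  have g_int: "(\<integral>x. g i x \<partial>lebesgue_vec (d i)) = detLi i * sqrt (2 * pi) ^ d i" if i: "i < m" for i
    unfolding g_def detLi_def D_fold by (rule integral_gaussian[OF chi[OF i]])
  have input: "brascamp_lieb_input m d g"
    unfolding brascamp_lieb_input_def g_def D_fold using gaussian_integrable[OF chi] by auto
  have lhs: "brascamp_lieb_lhs n m c B g = ennreal (detL * sqrt (2 * pi) ^ n)"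
  proof -
    have "brascamp_lieb_lhs n m c B g = (\<integral>\<^sup>+ x. ennreal (exp (- scalar_prod (inv_mat A *\<^sub>v x) x / 2)) \<partial>lebesgue_vec n)"
      unfolding brascamp_lieb_lhs_def
    proof (intro nn_integral_cong arg_cong[where f=ennreal])
      fix x assume "x \<in> space (lebesgue_vec n)"
      then have x: "x \<in> carrier_vec n" by simp
      have "(\<Prod>i<m. g i (B i *\<^sub>v x) powr c i)
        = (\<Prod>i<m. exp (- (c i * scalar_prod (inv_mat (D i) *\<^sub>v (B i *\<^sub>v x)) (B i *\<^sub>v x)) / 2))"
        unfolding g_def D_fold by (intro prod.cong refl) (simp add: exp_powr_real mult_ac)
      also have "\<dots> = exp (- scalar_prod (inv_mat A *\<^sub>v x) x / 2)"
        unfolding exp_sum[OF finite_lessThan, symmetric] A_form[OF x, symmetric]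
        by (simp add: sum_negf sum_divide_distrib)
      finally show "(\<Prod>i<m. g i (B i *\<^sub>v x) powr c i) = exp (- scalar_prod (inv_mat A *\<^sub>v x) x / 2)" .
    qed
    then show ?thesis unfolding detL_def by (simp only: nn_integral_gaussian[OF ch])
  qed
  define r where "r = (\<Prod>i<m. (detLi i * sqrt (2 * pi) ^ d i) powr c i)"
  have rhs: "brascamp_lieb_rhs m d c g = ennreal r"
    unfolding brascamp_lieb_rhs_def r_def by (intro arg_cong[where f=ennreal] prod.cong refl) (simp add: g_int)
  have r: "r = (\<Prod>i<m. detLi i powr c i) * sqrt (2 * pi) ^ n"
  proof -
    have "r = (\<Prod>i<m. detLi i powr c i * sqrt (2 * pi) powr (c i * real (d i)))"
      unfolding r_def using detLi
      by (intro prod.cong refl) (simp add: powr_mult powr_realpow[symmetric] powr_powr mult.commute less_imp_le)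
    also have "\<dots> = (\<Prod>i<m. detLi i powr c i) * sqrt (2 * pi) powr (\<Sum>i<m. c i * real (d i))"
      by (simp add: prod.distrib powr_sum)
    finally show ?thesis by (simp add: scaling powr_realpow)
  qed
  have r0: "0 < r" unfolding r using detprod by simp
  have eq: "brascamp_lieb_lhs n m c B g = ennreal C * brascamp_lieb_rhs m d c g"
  proof -
    have "detL / p * (p * s) = detL * s" if "0 < p" for p s :: real using that by simp
    from this[OF detprod] have "C * r = detL * sqrt (2 * pi) ^ n" unfolding C r .
    then show ?thesis unfolding lhs rhs using C0 by (simp add: ennreal_mult'[symmetric] less_imp_le)
  qed
  \<comment> \<open>A smaller constant would violate the equality for \<open>g\<close>, whose right-hand side \<open>r\<close> is positive and finite.\<close>
  have "ennreal C \<le> C'" if "brascamp_lieb_inequality n m d c B C'" for C'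
  proof -
    have "brascamp_lieb_lhs n m c B g \<le> C' * brascamp_lieb_rhs m d c g"
      using that input unfolding brascamp_lieb_inequality_def by blast
    then have "ennreal C * ennreal r \<le> C' * ennreal r" by (simp only: eq rhs)
    then show ?thesis using r0 by (simp add: mult.commute[of _ "ennreal r"] ennreal_mult_le_mult_iff)
  qed
  with ineq input eq show ?thesis unfolding is_brascamp_lieb_constant_def by blast
qed

end
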